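(* Let $K$ be an algebraically closed field of arbitrary characteristic. Let $\widetilde{X} \subseteq \mathbb{P}^{r+1}_K$ be a rational normal scroll of codimension at least $2$ with vertex $\mathrm{Vert}(\widetilde{X})=\mathbb{P}^h_K$ ($h\ge -1$), a cone over the smooth rational normal scroll $\widetilde{X}_0\subset\langle\widetilde{X}_0\rangle=\mathbb{P}^{r-h}_K$, and let $p \in \mathbb{P}^{r+1}_K \setminus \widetilde{X}$ be a closed point. Then one of the following holds: (a) $\mathrm{Sec}_p(\widetilde{X}) = \langle \mathrm{Vert}(\widetilde{X}), p \rangle = \mathbb{P}^{h+1}_K$ and $\Sigma_p(\widetilde{X}) = 2\,\mathrm{Vert}(\widetilde{X}) \subseteq \mathbb{P}^{h+1}_K$. (b) $\mathrm{Sec}_p(\widetilde{X}) = \langle \mathrm{Vert}(\widetilde{X}), L \rangle = \mathbb{P}^{h+2}_K$ for some line $L \subseteq \langle \widetilde{X}_0 \rangle$ and either (i) $\Sigma_p(\widetilde{X}) = \mathrm{Join}(\mathrm{Vert}(\widetilde{X}), Z) \subseteq \mathbb{P}^{h+2}_K$, where $Z \subseteq L$ consists of two simple points; or (ii) $\Sigma_p(\widetilde{X}) = 2\langle \mathrm{Vert}(\widetilde{X}), Z \rangle \subseteq \mathbb{P}^{h+2}_K$, where $Z \subseteq L$ consists of one simple point. (c) $\mathrm{Sec}_p(\widetilde{X}) = \langle \mathrm{Vert}(\widetilde{X}), P \rangle = \mathbb{P}^{h+3}_K$ for some plane $P \subseteq \langle \widetilde{X}_0 \rangle$ and $\Sigma_p(\widetilde{X})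 = \mathrm{Join}(\mathrm{Vert}(\widetilde{X}), W)$, where $W \subseteq P$ is either a smooth conic or the union of two lines $L, L' \subseteq P$ such that $L \subseteq \mathbb{L}(x)\cap\widetilde{X}_0$ for some $x \in \mathbb{P}^1_K$ and $L'$ is a line section of $\widetilde{X}_0$. (d) $\mathrm{Sec}_p(\widetilde{X}) = \langle \mathrm{Vert}(\widetilde{X}), D \rangle = \mathbb{P}^{h+4}_K$ for some $3$-dimensional linear space $D \subseteq \langle \widetilde{X}_0 \rangle$ and $\Sigma_p(\widetilde{X}) = \mathrm{Join}(\mathrm{Vert}(\widetilde{X}), V)$, where $V \subseteq D$ is a smooth quadric surface.
   Context: Smooth rational normal scroll: given integers $1\le a_1\le\dots\le a_n$ ($n\ge1$), choose complementary linear subspaces $\Lambda_i\cong\mathbb{P}^{a_i}_K$ spanning $\mathbb{P}^{N}_K$, $N=a_1+\dots+a_n+n-1$, and embeddings $\phi_i:\mathbb{P}^1_K\to\Lambda_i$ as rational normal curves of degree $a_i$. Then $S(a_1,\dots,a_n)=\bigcup_{x\in\mathbb{P}^1_K}\langle\phi_1(x),\dots,\phi_n(x)\rangle$ is the smooth rational normal scroll of type $(a_1,\dots,a_n)$; it has a projection morphism to $\mathbb{P}^1_K$ with fibers the rulings $\mathbb{L}(x)=\langle\phi_1(x),\dots,\phi_n(x)\rangle$. A line section is a line contained in the scroll that is mapped isomorphically onto $\mathbb{P}^1_K$. Here $\langle\cdot\rangle$ denotes linear span. A rational normal scroll $\widetilde{X}\subseteq\mathbb{P}^{r+1}_K$ with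 vertex $\mathrm{Vert}(\widetilde{X})=\mathbb{P}^h_K$ ($h\ge-1$, with $\mathbb{P}^{-1}_K=\emptyset$) is the cone $\mathrm{Join}(\mathrm{Vert}(\widetilde{X}),\widetilde{X}_0)$ over a smooth rational normal scroll $\widetilde{X}_0$ in a linear subspace $\langle\widetilde{X}_0\rangle=\mathbb{P}^{r-h}_K$ complementary to $\mathrm{Vert}(\widetilde{X})$. The symbol $\mathbb{L}(x)$ in the claim refers to the rulings of $\widetilde{X}_0$. $\mathrm{Join}(Y,Z)$ is the (reduced) embedded join, i.e. the closure of the union of the lines $\langle y,z\rangle$ with $y\in Y$, $z\in Z$, $y\neq z$; $\mathrm{Join}(\emptyset,Z)=Z$. For a hyperplane $E$ of a linear space $M$, $2E\subseteq M$ is the double hyperplane, i.e. the subscheme of $M$ defined by the square of a linear form defining $E$ (and $2\emptyset=\emptyset$). For a closed point $p\in\mathbb{P}^{r+1}_K\setminus\widetilde{X}$, the secant cone is $\mathrm{Sec}_p(\widetilde{X})=\bigcup_{q\in\widetilde{X},\ \mathrm{length}(\widetilde{X}\cap\langle p,q\rangle)\ge 2}\langle p,q\rangle$, with the convention $\mathrm{Sec}_p(\widetilde{X})=\{p\}$ if there is no such $q$. The secant locus $\Sigma_p(\widetilde{X})$ is the scheme-theoretic intersection of $\widetilde{X}$ and $\mathrm{Sec}_p(\widetilde{X})$. *)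

theory Defs
  imports "HOL-Analysis.Analysis" "HOL-Library.Poly_Mapping" "HOL-Library.Extended_Nat"
    "HOL-Library.Numeral_Type"
begin

section \<open>Projective space and its linear subspaces\<close>

text \<open>The points of projective space of dimension \<open>CARD('n) - 1\<close> over \<open>'k\<close> are the
  one-dimensional linear subspaces of \<open>'k ^ 'n\<close>. Over an algebraically closed field these are
  exactly the closed points.\<close>

typedef (overloaded) ('k, 'n) proj =
    "{l :: ('k::field ^ 'n::finite) set. vec.subspace l \<and> vec.dim l = 1}"
  morphisms rep_proj Abs_proj
proof
  show "vec.span {axis undefined 1} \<in> {l :: ('k ^ 'n) set. vec.subspace l \<and> vec.dim l = 1}"
    by (auto simp: axis_eq_0_iff)
qed

text \<open>The point with homogeneous coordinates \<open>v\<close>; only meaningful for \<open>v \<noteq> 0\<close>.\<close>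

definition pt :: "'k::field ^ 'n \<Rightarrow> ('k, 'n::finite) proj"
  where "pt v = Abs_proj (vec.span {v})"

definition projectivization :: "('k::field ^ 'n::finite) set \<Rightarrow> ('k, 'n) proj set"
  where "projectivization U = {x. rep_proj x \<subseteq> U}"

definition vec_span :: "('k::field, 'n::finite) proj set \<Rightarrow> ('k ^ 'n) set"
  where "vec_span A = vec.span (\<Union>x\<in>A. rep_proj x)"

definition lin_span :: "('k::field, 'n::finite) proj set \<Rightarrow> ('k, 'n) proj set"
  where "lin_span A = projectivization (vec_span A)"

text \<open>\<open>linear_space d A\<close>: \<open>A\<close> is a linearly embedded projective \<open>d\<close>-space. The dimension is an
  integer because \<open>d = -1\<close>, the empty space, is allowed.\<close>

definition linear_space :: "int \<Rightarrow> ('k::field, 'n::finite) proj set \<Rightarrow> bool"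
  where "linear_space d A \<longleftrightarrow>
    (\<exists>U. vec.subspace U \<and> int (vec.dim U) = d + 1 \<and> A = projectivization U)"

definition complementary :: "('k::field, 'n::finite) proj set \<Rightarrow> ('k, 'n) proj set \<Rightarrow> bool"
  where "complementary A B \<longleftrightarrow> A \<inter> B = {} \<and> lin_span (A \<union> B) = UNIV"


section \<open>Homogeneous coordinate ring\<close>

type_synonym ('k, 'n) mpoly = "('n \<Rightarrow>\<^sub>0 nat) \<Rightarrow>\<^sub>0 'k"

definition mpoly_eval :: "('k::field, 'n::finite) mpoly \<Rightarrow> 'k ^ 'n \<Rightarrow> 'k"
  where "mpoly_eval f v =
    (\<Sum>m\<in>Poly_Mapping.keys f. Poly_Mapping.lookup f m * (\<Prod>i\<in>UNIV. v $ i ^ Poly_Mapping.lookup m i))"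

definition mpoly_deriv :: "'n \<Rightarrow> ('k::field, 'n::finite) mpoly \<Rightarrow> ('k, 'n) mpoly"
  where "mpoly_deriv i f =
    (\<Sum>m\<in>Poly_Mapping.keys f. Poly_Mapping.single (m - Poly_Mapping.single i 1)
       (of_nat (Poly_Mapping.lookup m i) * Poly_Mapping.lookup f m))"

definition homogeneous :: "nat \<Rightarrow> ('k::field, 'n::finite) mpoly \<Rightarrow> bool"
  where "homogeneous d f \<longleftrightarrow>
    (\<forall>m\<in>Poly_Mapping.keys f. (\<Sum>i\<in>UNIV. Poly_Mapping.lookup m i) = d)"

text \<open>The ideal generated by a set: the span in the ring viewed as a module over itself.\<close>

definition ideal_gen :: "'a::comm_ring_1 set \<Rightarrow> 'a set"
  where "ideal_gen = module.span (*)"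

definition homogeneous_ideal :: "('k::field, 'n::finite) mpoly set \<Rightarrow> bool"
  where "homogeneous_ideal I \<longleftrightarrow> I = ideal_gen {f \<in> I. \<exists>d. homogeneous d f}"

text \<open>Saturation with respect to the irrelevant ideal.\<close>

definition saturation :: "('k::field, 'n::finite) mpoly set \<Rightarrow> ('k, 'n) mpoly set"
  where "saturation I = {f. \<exists>d. \<forall>g. homogeneous d g \<longrightarrow> g * f \<in> I}"


section \<open>Zariski topology\<close>

text \<open>A polynomial vanishes at a point if it vanishes on the whole line representing the point;
  over an infinite field this means that all homogeneous components vanish there, so arbitrary
  polynomials can be allowed in the next two definitions.\<close>

definition zeros :: "('k::field, 'n::finite) mpoly set \<Rightarrow> ('k, 'n) proj set"
  where "zeros F = {x. \<forall>f\<in>F. \<forall>v\<in>rep_proj x. mpoly_eval f v = 0}"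

definition vanishing_ideal :: "('k::field, 'n::finite) proj set \<Rightarrow> ('k, 'n) mpoly set"
  where "vanishing_ideal A = {f. \<forall>x\<in>A. \<forall>v\<in>rep_proj x. mpoly_eval f v = 0}"

definition zclosed :: "('k::field, 'n::finite) proj set \<Rightarrow> bool"
  where "zclosed A \<longleftrightarrow> (\<exists>F. A = zeros F)"

definition zclosure :: "('k::field, 'n::finite) proj set \<Rightarrow> ('k, 'n) proj set"
  where "zclosure A = \<Inter>{B. zclosed B \<and> A \<subseteq> B}"

definition zirreducible :: "('k::field, 'n::finite) proj set \<Rightarrow> bool"
  where "zirreducible A \<longleftrightarrow> A \<noteq> {} \<and>
    (\<forall>B C. zclosed B \<and> zclosed C \<and> A \<subseteq> B \<union> C \<longrightarrow> A \<subseteq> B \<or> A \<subseteq> C)"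

text \<open>Krull dimension of a closed set.\<close>

definition zdim :: "('k::field, 'n::finite) proj set \<Rightarrow> enat"
  where "zdim A = Sup {enat n | n. \<exists>c :: nat \<Rightarrow> ('k, 'n) proj set.
    (\<forall>i\<le>n. zclosed (c i) \<and> zirreducible (c i) \<and> c i \<subseteq> A) \<and> (\<forall>i<n. c i \<subset> c (Suc i))}"

text \<open>Morphisms from \<open>A\<close> to a projective space are the maps that are locally given by tuples of
  homogeneous polynomials of equal degree. The neighbourhood of \<open>x\<close> on which the tuple is used is
  the non-vanishing locus of the tuple in \<open>A\<close>, which is no restriction: multiply the tuple by a
  form that vanishes outside the desired neighbourhood but not at \<open>x\<close>.\<close>

definition regular_map ::
    "('k::field, 'n::finite) proj set \<Rightarrow> (('k, 'n) proj \<Rightarrow> ('k, 'm::finite) proj) \<Rightarrow> bool"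
  where "regular_map A f \<longleftrightarrow> (\<forall>x\<in>A. \<exists>d. \<exists>F :: 'm \<Rightarrow> ('k, 'n) mpoly.
    (\<forall>j. homogeneous d (F j)) \<and>
    (\<forall>v\<in>rep_proj x - {0}. (\<chi> j. mpoly_eval (F j) v) \<noteq> 0) \<and>
    (\<forall>y\<in>A. \<forall>v\<in>rep_proj y - {0}.
       (\<chi> j. mpoly_eval (F j) v) \<noteq> 0 \<longrightarrow> f y = pt (\<chi> j. mpoly_eval (F j) v)))"

definition isomorphism ::
    "('k::field, 'n::finite) proj set \<Rightarrow> ('k, 'm::finite) proj set \<Rightarrow>
     (('k, 'n) proj \<Rightarrow> ('k, 'm) proj) \<Rightarrow> bool"
  where "isomorphism A B f \<longleftrightarrow>
    bij_betw f A B \<and> regular_map A f \<and> regular_map B (inv_into A f)"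


section \<open>Closed subschemes\<close>

text \<open>Closed subschemes of projective space correspond bijectively, with inclusions reversed, to
  saturated homogeneous ideals of the homogeneous coordinate ring, and are represented by these
  ideals throughout; the empty scheme is the unit ideal \<open>UNIV\<close>. A closed set \<open>A\<close> with its
  reduced structure is the ideal \<open>vanishing_ideal A\<close>.\<close>

definition closed_subscheme :: "('k::field, 'n::finite) mpoly set \<Rightarrow> bool"
  where "closed_subscheme I \<longleftrightarrow> homogeneous_ideal I \<and> saturation I = I"

definition scheme_inter ::
    "('k::field, 'n::finite) mpoly set \<Rightarrow> ('k, 'n) mpoly set \<Rightarrow> ('k, 'n) mpoly set"
  where "scheme_inter I J = saturation (ideal_gen (I \<union> J))"

text \<open>The length of the structure sheaf of the subscheme given by \<open>I\<close>: ideal sheaves of the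
  subscheme are the saturated homogeneous ideals containing \<open>I\<close>. It is finite precisely for
  finite subschemes.\<close>

definition scheme_length :: "('k::field, 'n::finite) mpoly set \<Rightarrow> enat"
  where "scheme_length I = Sup {enat n | n. \<exists>c :: nat \<Rightarrow> ('k, 'n) mpoly set.
    (\<forall>i\<le>n. closed_subscheme (c i) \<and> I \<subseteq> c i) \<and> (\<forall>i<n. c i \<subset> c (Suc i))}"

text \<open>\<open>double_hyperplane M E\<close> is the subscheme \<open>2 E\<close> of the linear space \<open>M\<close>. Any two linear forms
  cutting out the hyperplane \<open>E\<close> of \<open>M\<close> are proportional modulo the ideal of \<open>M\<close>, so
  adjoining the squares of all of them is the same as adjoining one. For \<open>M\<close> a point and \<open>E\<close>
  empty this is the unit ideal, i.e. the empty scheme.\<close>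

definition double_hyperplane ::
    "('k::field, 'n::finite) proj set \<Rightarrow> ('k, 'n) proj set \<Rightarrow> ('k, 'n) mpoly set"
  where "double_hyperplane M E = saturation (ideal_gen
    (vanishing_ideal M \<union> {l ^ 2 | l. homogeneous 1 l \<and> M \<inter> zeros {l} = E}))"

text \<open>A smooth quadric hypersurface in the linear space \<open>M\<close>: at each of its points the differential
  of the defining quadratic form is non-zero in some direction inside \<open>M\<close>. This is correct in
  characteristic two as well. For a plane \<open>M\<close> these are the smooth conics.\<close>

definition smooth_quadric :: "('k::field, 'n::finite) proj set \<Rightarrow> ('k, 'n) proj set \<Rightarrow> bool"
  where "smooth_quadric M Q \<longleftrightarrow> (\<exists>q. homogeneous 2 q \<and> Q = M \<inter> zeros {q} \<and>
    (\<forall>x\<in>Q. \<forall>v\<in>rep_proj x - {0}. \<exists>u\<in>vec_span M.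
       (\<Sum>i\<in>UNIV. mpoly_eval (mpoly_deriv i q) v * u $ i) \<noteq> 0))"

definition embedded_join ::
    "('k::field, 'n::finite) proj set \<Rightarrow> ('k, 'n) proj set \<Rightarrow> ('k, 'n) proj set"
  where "embedded_join Y Z = (if Y = {} then Z
    else zclosure (\<Union>{lin_span {y, z} | y z. y \<in> Y \<and> z \<in> Z \<and> y \<noteq> z}))"


section \<open>Rational normal scrolls\<close>

text \<open>\<open>f\<close> embeds the projective line as a rational normal curve of degree \<open>a\<close> in the
  \<open>a\<close>-dimensional linear space \<open>M\<close>: it is the Veronese map with respect to some basis.\<close>

definition rational_normal_embedding ::
    "nat \<Rightarrow> ('k::field, 'n::finite) proj set \<Rightarrow> (('k, 2) proj \<Rightarrow> ('k, 'n) proj) \<Rightarrow> bool"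
  where "rational_normal_embedding a M f \<longleftrightarrow> (\<exists>b :: nat \<Rightarrow> 'k ^ 'n.
    inj_on b {..a} \<and> vec.independent (b ` {..a}) \<and>
    M = projectivization (vec.span (b ` {..a})) \<and>
    (\<forall>v. v \<noteq> 0 \<longrightarrow> f (pt v) = pt (\<Sum>j\<le>a. (v $ 1 ^ (a - j) * v $ 2 ^ j) *s b j)))"

definition ruling ::
    "nat \<Rightarrow> (nat \<Rightarrow> ('k, 2) proj \<Rightarrow> ('k, 'n) proj) \<Rightarrow> ('k, 2) proj \<Rightarrow> ('k::field, 'n::finite) proj set"
  where "ruling n \<phi> x = lin_span ((\<lambda>i. \<phi> i x) ` {..<n})"

definition scroll ::
    "nat \<Rightarrow> (nat \<Rightarrow> ('k, 2) proj \<Rightarrow> ('k, 'n) proj) \<Rightarrow> ('k::field, 'n::finite) proj set"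
  where "scroll n \<phi> = (\<Union>x. ruling n \<phi> x)"

text \<open>\<open>smooth_scroll_data M a \<phi>\<close>: the maps \<open>\<phi> i\<close> for \<open>i < length a\<close> define a smooth rational
  normal scroll of type \<open>a\<close> (indexed from 0) in the linear space \<open>M\<close>. The spaces \<open>\<Lambda> i\<close> are
  complementary because they span a space of the maximal possible dimension.\<close>

definition smooth_scroll_data ::
    "('k::field, 'n::finite) proj set \<Rightarrow> nat list \<Rightarrow> (nat \<Rightarrow> ('k, 2) proj \<Rightarrow> ('k, 'n) proj) \<Rightarrow> bool"
  where "smooth_scroll_data M a \<phi> \<longleftrightarrow>
    length a \<ge> 1 \<and> sorted a \<and> (\<forall>i<length a. a ! i \<ge> 1) \<and>
    linear_space (int (sum_list a) + int (length a) - 1) M \<and>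
    (\<exists>\<Lambda>. (\<forall>i<length a. linear_space (int (a ! i)) (\<Lambda> i) \<and>
             rational_normal_embedding (a ! i) (\<Lambda> i) (\<phi> i)) \<and>
          lin_span (\<Union>i<length a. \<Lambda> i) = M)"

definition scroll_projection ::
    "nat \<Rightarrow> (nat \<Rightarrow> ('k, 2) proj \<Rightarrow> ('k, 'n) proj) \<Rightarrow> ('k::field, 'n::finite) proj \<Rightarrow> ('k, 2) proj"
  where "scroll_projection n \<phi> y = (THE x. y \<in> ruling n \<phi> x)"

definition line_section ::
    "nat \<Rightarrow> (nat \<Rightarrow> ('k, 2) proj \<Rightarrow> ('k, 'n) proj) \<Rightarrow> ('k::field, 'n::finite) proj set \<Rightarrow> bool"
  where "line_section n \<phi> L \<longleftrightarrow> linear_space 1 L \<and> L \<subseteq> scroll n \<phi> \<and>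
    isomorphism L UNIV (scroll_projection n \<phi>)"


section \<open>Secant cone and secant locus\<close>

definition secant_cone ::
    "('k::field, 'n::finite) proj \<Rightarrow> ('k, 'n) proj set \<Rightarrow> ('k, 'n) proj set"
  where "secant_cone p X =
    (let Q = {q \<in> X. scheme_length
                (scheme_inter (vanishing_ideal X) (vanishing_ideal (lin_span {p, q}))) \<ge> 2}
     in if Q = {} then {p} else (\<Union>q\<in>Q. lin_span {p, q}))"

definition secant_locus ::
    "('k::field, 'n::finite) proj \<Rightarrow> ('k, 'n) proj set \<Rightarrow> ('k, 'n) mpoly set"
  where "secant_locus p X =
    scheme_inter (vanishing_ideal X) (vanishing_ideal (secant_cone p X))"

end

theory Submission
  imports Defs
begin

text \<open>
  In coordinates adapted to the scroll, \<open>X\<close> is the locus where a matrix \<open>M\<close> of linear forms with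
  two rows has rank at most one, and the vertex is the projectivization of the common kernel
  \<open>U\<close> of these forms. For \<open>p\<close> outside \<open>X\<close> the two rows of \<open>M(p)\<close> span a plane \<open>R\<close> of row vectors. Let \<open>S\<close>
  be the linear space of all vectors \<open>v\<close> such that both rows of \<open>M(v)\<close> lie in \<open>R\<close>.

  The secant cone is the projectivization of \<open>S\<close>. On the line through \<open>p\<close> and a point \<open>q\<close> of \<open>X\<close>, a
  minor of \<open>M\<close> restricts to a binary quadric divisible by the equation of \<open>q\<close>. If two of these quadrics are
  linearly independent, they generate the ideal of the point \<open>q\<close> up to saturation, so that the
  intersection with the line is a simple point; a computation with exterior products shows that they are
  all proportional only if \<open>q\<close> lies in \<open>S\<close> (\<open>secant_not_in_S\<close>). Conversely, for \<open>q\<close> in \<open>S\<close> the line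
  either meets \<open>X\<close> in a second point or is tangent to \<open>X\<close> at \<open>q\<close> (\<open>secant_in_S\<close>). The second case uses that
  the tangent spaces of \<open>X\<close> are cut out by the differentials of the minors. This is seen from the
  parametrization: modulo the ruling, a vector annihilated by these differentials is a multiple of the velocity
  of a curve that moves the ruling (\<open>scroll_coords.tangent\<close>). Finally, each line through \<open>p\<close> in \<open>S\<close> meets the
  quadric cut out in \<open>S\<close> by one minor, because the field is algebraically closed
  (\<open>secant_cone_eq\<close>).

  Choose two columns of \<open>M(p)\<close> that are linearly independent. The corresponding columns of \<open>M\<close> map \<open>S / U\<close>
  injectively to the space of matrices with two rows and two columns, and on \<open>S\<close> all minors of \<open>M\<close> are
  multiples of the determinant of this block. So \<open>X\<close> meets the secant cone in a quadric \<open>Q\<close>, the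
  determinant restricted to a space of matrices of dimension at most four, which contains an
  invertible matrix. The four alternatives of the theorem are the four possible dimensions: in
  dimension one \<open>Q\<close> is the double vertex; in dimension two it is given by a binary form with two
  roots or a double root; in dimension three the space of matrices is the hyperplane orthogonal to some
  matrix \<open>G\<close>, and \<open>Q\<close> is a cone over a smooth conic if \<open>G\<close> has rank two, and over two lines if \<open>G\<close> has rank
  one: the matrices with a fixed column, which lie in a ruling, and the matrices with a fixed row, which
  form a line section; in dimension four \<open>Q\<close> is a cone over the quadric surface of all
  matrices of determinant zero.

  The scheme structure is found by division with remainder. If some line in \<open>S\<close> meets \<open>Q\<close> in exactly two
  points, then every polynomial that vanishes on \<open>Q\<close> is a multiple of the determinant on \<open>S\<close>
  (\<open>div_det_on\<close>), so that the secant locus is reduced. Otherwise the determinant is the square of a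
  linear form on \<open>S\<close>. Then \<open>p\<close> is a tangent vector to \<open>X\<close> along the zeros of this form, so every
  polynomial vanishing on \<open>X\<close> is divisible by the square on \<open>S\<close> (\<open>div_square_on\<close>), and the secant
  locus is a double linear space.
\<close>

section \<open>Substitution into polynomials\<close>

text \<open>Coefficients are mapped by \<open>h\<close> and variables by \<open>Y\<close>. Besides evaluation at a vector, this covers the
  restriction to a curve (values in \<open>'k poly\<close>) and to a family of lines (values in polynomials over
  the coordinate ring).\<close>

definition mpoly_subst ::
    "('k::field \<Rightarrow> 'r::comm_ring_1) \<Rightarrow> ('n::finite \<Rightarrow> 'r) \<Rightarrow> ('k, 'n) mpoly \<Rightarrow> 'r"
  where "mpoly_subst h Y f =
    (\<Sum>m\<in>Poly_Mapping.keys f.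
       h (Poly_Mapping.lookup f m) * (\<Prod>i\<in>UNIV. Y i ^ Poly_Mapping.lookup m i))"

lemma mpoly_eval_eq_subst: "mpoly_eval f v = mpoly_subst (\<lambda>c. c) (($) v) f"
  by (simp add: mpoly_eval_def mpoly_subst_def)

locale coeff_hom =
  fixes h :: "'k::field \<Rightarrow> 'r::comm_ring_1"
  assumes hom_zero: "h 0 = 0" and hom_one: "h 1 = 1"
    and hom_add: "h (x + y) = h x + h y" and hom_mult: "h (x * y) = h x * h y"
begin

lemma subst_superset:
  assumes "finite A" "Poly_Mapping.keys f \<subseteq> A"
  shows "mpoly_subst h Y f =
    (\<Sum>m\<in>A. h (Poly_Mapping.lookup f m) * (\<Prod>i\<in>UNIV. Y i ^ Poly_Mapping.lookup m i))"
  unfolding mpoly_subst_def using assms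
  by (intro sum.mono_neutral_left) (auto simp: hom_zero Poly_Mapping.in_keys_iff)

lemma subst_add: "mpoly_subst h Y (f + g) = mpoly_subst h Y f + mpoly_subst h Y g"
proof -
  let ?A = "Poly_Mapping.keys f \<union> Poly_Mapping.keys g"
  have "Poly_Mapping.keys (f + g) \<subseteq> ?A" by (rule Poly_Mapping.keys_add)
  then show ?thesis
    by (subst (1 2 3) subst_superset[where A = ?A])
      (auto simp: Poly_Mapping.lookup_add hom_add sum.distrib distrib_right)
qed

lemma subst_0 [simp]: "mpoly_subst h Y 0 = 0"
  by (simp add: mpoly_subst_def)

lemma subst_sum: "mpoly_subst h Y (sum g A) = (\<Sum>a\<in>A. mpoly_subst h Y (g a))"
  by (induction A rule: infinite_finite_induct) (auto simp: subst_add)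

lemma subst_single:
  "mpoly_subst h Y (Poly_Mapping.single m c) = h c * (\<Prod>i\<in>UNIV. Y i ^ Poly_Mapping.lookup m i)"
  by (cases "c = 0") (auto simp: mpoly_subst_def hom_zero)

lemma subst_1 [simp]: "mpoly_subst h Y 1 = 1"
  using subst_single[of Y 0 1] by (simp add: hom_one)

end

lemma mpoly_monomials:
  fixes f :: "('k::field, 'n::finite) mpoly"
  shows "f = (\<Sum>m\<in>Poly_Mapping.keys f. Poly_Mapping.single m (Poly_Mapping.lookup f m))"
  by (rule poly_mapping_eqI)
    (auto simp: Poly_Mapping.lookup_sum Poly_Mapping.lookup_single when_def sum.delta
      Poly_Mapping.in_keys_iff)

context coeff_hom
begin

lemma subst_mult: "mpoly_subst h Y (f * g) = mpoly_subst h Y f * mpoly_subst h Y g"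
proof -
  have "mpoly_subst h Y (Poly_Mapping.single m c * Poly_Mapping.single m' c') =
      mpoly_subst h Y (Poly_Mapping.single m c) * mpoly_subst h Y (Poly_Mapping.single m' c')" for m m' c c'
    by (simp add: Poly_Mapping.mult_single subst_single hom_mult Poly_Mapping.lookup_add power_add
        prod.distrib algebra_simps)
  then show ?thesis
    by (subst (1) mpoly_monomials[of f], subst (1) mpoly_monomials[of g],
        subst (3) mpoly_monomials[of f], subst (3) mpoly_monomials[of g])
       (simp only: sum_product subst_sum)
qed

lemma subst_power: "mpoly_subst h Y (f ^ n) = mpoly_subst h Y f ^ n"
  by (induction n) (auto simp: subst_mult)

lemma subst_minus: "mpoly_subst h Y (- f) = - mpoly_subst h Y f"
  using subst_add[of Y "- f" f] by (simp add: eq_neg_iff_add_eq_0)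

lemma subst_diff: "mpoly_subst h Y (f - g) = mpoly_subst h Y f - mpoly_subst h Y g"
  using subst_add[of Y f "- g"] by (simp add: subst_minus)

end

lemma subst_compose:
  fixes g :: "'r::comm_ring_1 \<Rightarrow> 's::comm_ring_1" and Y :: "'n::finite \<Rightarrow> 'r"
  assumes "\<And>x y. g (x + y) = g x + g y" "\<And>x y. g (x * y) = g x * g y" "g 1 = 1" "g 0 = 0"
  shows "g (mpoly_subst h Y f) = mpoly_subst (\<lambda>c. g (h c)) (\<lambda>i. g (Y i)) f"
proof -
  have p: "g (x ^ n) = g x ^ n" for x n by (induction n) (auto simp: assms)
  have pr: "g (prod u A) = (\<Prod>a\<in>A. g (u a))" for u :: "'n \<Rightarrow> 'r" and A
    by (induction A rule: infinite_finite_induct) (auto simp: assms)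
  have s: "g (sum u A) = (\<Sum>a\<in>A. g (u a))" for u :: "('n \<Rightarrow>\<^sub>0 nat) \<Rightarrow> 'r" and A
    by (induction A rule: infinite_finite_induct) (auto simp: assms)
  show ?thesis by (simp add: mpoly_subst_def s assms pr p)
qed

interpretation eval_hom: coeff_hom "\<lambda>c::'k::field. c"
  by unfold_locales auto

interpretation curve_hom: coeff_hom "\<lambda>c::'k::field. [:c:]"
  by unfold_locales (auto simp: one_pCons)

lemma mpoly_eval_simps [simp]:
  "mpoly_eval 0 v = 0" "mpoly_eval 1 v = 1"
  "mpoly_eval (f + g) v = mpoly_eval f v + mpoly_eval g v"
  "mpoly_eval (f * g) v = mpoly_eval f v * mpoly_eval g v"
  "mpoly_eval (f - g) v = mpoly_eval f v - mpoly_eval g v"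
  "mpoly_eval (- f) v = - mpoly_eval f v"
  "mpoly_eval (f ^ n) v = mpoly_eval f v ^ n"
  "mpoly_eval (Poly_Mapping.single 0 c) v = c"
  "mpoly_eval (sum u A) v = (\<Sum>a\<in>A. mpoly_eval (u a) v)"
  by (simp_all add: mpoly_eval_eq_subst eval_hom.subst_add eval_hom.subst_mult eval_hom.subst_diff
      eval_hom.subst_power eval_hom.subst_sum eval_hom.subst_minus eval_hom.subst_single)

lemma mpoly_eval_numeral [simp]: "mpoly_eval (numeral k) v = numeral k"
  using mpoly_eval_simps(8)[of "numeral k" v] by simp

lemma infinite_field_poly_zero:
  fixes p :: "'k::field poly"
  assumes "infinite (UNIV :: 'k set)" "\<And>x. poly p x = 0" shows "p = 0"
  using assms poly_roots_finite[of p] by auto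

text \<open>On the line joining two points where \<open>f\<close> and \<open>g\<close> do not vanish, both are non-zero polynomials
  in one variable.\<close>

lemma mpoly_eval_zero_of_prod:
  fixes f g :: "('k::field, 'n::finite) mpoly"
  assumes inf: "infinite (UNIV :: 'k set)" and fg: "\<And>v. mpoly_eval (f * g) v = 0"
    and w: "mpoly_eval g w \<noteq> 0"
  shows "mpoly_eval f v = 0"
proof (rule ccontr)
  assume v: "mpoly_eval f v \<noteq> 0"
  define l where "l = (\<lambda>f :: ('k, 'n) mpoly. mpoly_subst (\<lambda>c. [:c:]) (\<lambda>i. [:v $ i, w $ i - v $ i:]) f)"
  have l: "poly (l u) t = mpoly_eval u (v + t *s (w - v))" for u t
    unfolding l_def mpoly_eval_eq_subst
    by (subst subst_compose[where g = "\<lambda>p. poly p t"]) (auto simp: mpoly_subst_def algebra_simps)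
  have "poly (l f) 0 \<noteq> 0" "poly (l g) 1 \<noteq> 0" using v w unfolding l by auto
  then have "l f * l g \<noteq> 0" by auto
  moreover have "poly (l f * l g) t = 0" for t
    using fg[of "v + t *s (w - v)"] by (simp add: l)
  then have "l f * l g = 0" by (intro infinite_field_poly_zero[OF inf])
  ultimately show False by simp
qed

lemma infinite_alg_closed: "infinite (UNIV :: 'k::alg_closed_field set)"
proof
  assume fin: "finite (UNIV :: 'k set)"
  \<comment> \<open>this polynomial has the value 1 everywhere\<close>
  define p where "p = (\<Prod>a\<in>(UNIV::'k set). [:-a, 1:]) + 1"
  have e: "poly p x = 1" for x
    using fin by (auto simp: p_def poly_prod prod_zero_iff)
  have d: "degree (\<Prod>a\<in>(UNIV::'k set). [:-a, 1:]) = card (UNIV :: 'k set)"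
    by (subst degree_prod_eq_sum_degree) auto
  have "card (UNIV :: 'k set) > 0" using fin by (simp add: card_gt_0_iff)
  then have "degree p > 0" unfolding p_def by (subst degree_add_eq_left) (auto simp: d)
  then obtain x where "poly p x = 0" using alg_closed_imp_poly_has_root by blast
  then show False using e by simp
qed


section \<open>Directional derivatives\<close>

definition dderiv :: "('k::field, 'n::finite) mpoly \<Rightarrow> 'k ^ 'n \<Rightarrow> 'k ^ 'n \<Rightarrow> 'k"
  where "dderiv f v u = (\<Sum>i\<in>UNIV. mpoly_eval (mpoly_deriv i f) v * u $ i)"

lemma dderiv_add: "dderiv f v (u + u') = dderiv f v u + dderiv f v u'"
  by (simp add: dderiv_def distrib_left sum.distrib)

lemma dderiv_scale: "dderiv f v (c *s u) = c * dderiv f v u"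
  by (simp add: dderiv_def sum_distrib_left algebra_simps)

lemma prod_power_diff_single:
  "(\<Prod>j\<in>(UNIV::'n::finite set). (v $ j :: 'k::field) ^ Poly_Mapping.lookup (m - Poly_Mapping.single i 1) j) =
    v $ i ^ (Poly_Mapping.lookup m i - 1) * (\<Prod>j\<in>UNIV - {i}. v $ j ^ Poly_Mapping.lookup m j)"
  by (subst prod.remove[of _ i])
    (auto simp: Poly_Mapping.lookup_minus Poly_Mapping.lookup_single intro!: prod.cong)

lemma chain_rule:
  fixes f :: "('k::field, 'n::finite) mpoly" and Y :: "'n \<Rightarrow> 'k poly"
  shows "poly (pderiv (mpoly_subst (\<lambda>c. [:c:]) Y f)) t =
    dderiv f (\<chi> i. poly (Y i) t) (\<chi> i. poly (pderiv (Y i)) t)"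
proof -
  let ?v = "\<chi> i. poly (Y i) t" and ?u = "\<chi> i. poly (pderiv (Y i)) t"
  have pds: "pderiv (sum g A) = (\<Sum>a\<in>A. pderiv (g a))" for g :: "('n \<Rightarrow>\<^sub>0 nat) \<Rightarrow> 'k poly" and A
    by (induction A rule: infinite_finite_induct) (auto simp: pderiv_add)
  have d: "mpoly_eval (mpoly_deriv i f) v = (\<Sum>m\<in>Poly_Mapping.keys f. Poly_Mapping.lookup f m *
        (of_nat (Poly_Mapping.lookup m i) * (v $ i ^ (Poly_Mapping.lookup m i - 1) *
          (\<Prod>j\<in>UNIV - {i}. v $ j ^ Poly_Mapping.lookup m j))))" for i v
    unfolding mpoly_deriv_def mpoly_eval_simps
    by (intro sum.cong refl)
      (simp only: mpoly_eval_eq_subst eval_hom.subst_single prod_power_diff_single, simp)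
  have "poly (pderiv (mpoly_subst (\<lambda>c. [:c:]) Y f)) t =
      (\<Sum>m\<in>Poly_Mapping.keys f. Poly_Mapping.lookup f m * (\<Sum>i\<in>UNIV.
        (\<Prod>j\<in>UNIV - {i}. ?v $ j ^ Poly_Mapping.lookup m j) *
        (of_nat (Poly_Mapping.lookup m i) * ?v $ i ^ (Poly_Mapping.lookup m i - 1) * ?u $ i)))"
    unfolding mpoly_subst_def
    by (simp add: pds pderiv_smult poly_sum pderiv_prod poly_prod pderiv_power poly_power mult_ac)
  also have "\<dots> = dderiv f ?v ?u"
    unfolding dderiv_def d
    by (simp only: sum_distrib_left sum_distrib_right)
       (subst sum.swap, simp add: algebra_simps)
  finally show ?thesis .
qed

definition line_poly :: "('k::field, 'n::finite) mpoly \<Rightarrow> 'k ^ 'n \<Rightarrow> 'k ^ 'n \<Rightarrow> 'k poly"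
  where "line_poly f v u = mpoly_subst (\<lambda>c. [:c:]) (\<lambda>i. [:v $ i, u $ i:]) f"

lemma poly_line_poly: "poly (line_poly f v u) t = mpoly_eval f (v + t *s u)"
  unfolding line_poly_def mpoly_eval_eq_subst
  by (subst subst_compose[where g = "\<lambda>p. poly p t"]) (auto simp: mpoly_subst_def algebra_simps)

lemma line_poly_coeff_0: "coeff (line_poly f v u) 0 = mpoly_eval f v"
  using poly_line_poly[of f v u 0] by (simp add: poly_0_coeff_0)

lemma line_poly_coeff_1: "coeff (line_poly f v u) 1 = dderiv f v u"
proof -
  have "coeff (line_poly f v u) 1 = poly (pderiv (line_poly f v u)) 0"
    by (simp add: poly_0_coeff_0 coeff_pderiv)
  also have "\<dots> = dderiv f v u"
    unfolding line_poly_def chain_rule by (simp add: pderiv_pCons)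
  finally show ?thesis .
qed

lemma line_poly_hom:
  "line_poly (f + g) v u = line_poly f v u + line_poly g v u"
  "line_poly (f - g) v u = line_poly f v u - line_poly g v u"
  "line_poly (f * g) v u = line_poly f v u * line_poly g v u"
  by (simp_all add: line_poly_def curve_hom.subst_add curve_hom.subst_diff curve_hom.subst_mult)

lemma dderiv_hom:
  "dderiv (f + g) v u = dderiv f v u + dderiv g v u"
  "dderiv (f - g) v u = dderiv f v u - dderiv g v u"
  "dderiv (f * g) v u = mpoly_eval f v * dderiv g v u + dderiv f v u * mpoly_eval g v"
  unfolding line_poly_coeff_1[symmetric] line_poly_hom
  by (simp_all add: coeff_mult line_poly_coeff_0)

lemma dderiv_zero_of_line:
  fixes f :: "('k::field, 'n::finite) mpoly"
  assumes "infinite (UNIV :: 'k set)" "\<And>t. mpoly_eval f (v + t *s u) = 0"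
  shows "dderiv f v u = 0"
proof -
  have "line_poly f v u = 0" by (rule infinite_field_poly_zero) (auto simp: assms poly_line_poly)
  then show ?thesis by (metis line_poly_coeff_1 coeff_0)
qed


section \<open>Linear forms\<close>

abbreviation lfun :: "('k::field ^ 'n::finite \<Rightarrow> 'k) \<Rightarrow> bool"
  where "lfun \<equiv> Vector_Spaces.linear (*s) (*)"

lemma lfun_iff: "lfun f \<longleftrightarrow> (\<forall>x y. f (x + y) = f x + f y) \<and> (\<forall>c x. f (c *s x) = c * f x)"
  by (auto simp: Vector_Spaces.linear_iff vec.vector_space_axioms
      vector_space_over_itself.vector_space_axioms)

lemma lfunD:
  assumes "lfun f"
  shows "f (x + y) = f x + f y" "f (c *s x) = c * f x" "f (x - y) = f x - f y" "f 0 = 0"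
    "f (- x) = - f x" "f (sum g A) = (\<Sum>a\<in>A. f (g a))"
proof -
  interpret Vector_Spaces.linear "(*s)" "(*)" f by fact
  show "f (x + y) = f x + f y" "f (c *s x) = c * f x" "f (x - y) = f x - f y" "f 0 = 0"
    "f (- x) = - f x" "f (sum g A) = (\<Sum>a\<in>A. f (g a))"
    by (simp_all add: add scale diff zero neg sum)
qed

definition lform :: "('k::field ^ 'n::finite \<Rightarrow> 'k) \<Rightarrow> ('k, 'n) mpoly"
  where "lform f = (\<Sum>i\<in>UNIV. Poly_Mapping.single (Poly_Mapping.single i 1) (f (axis i 1)))"

lemma prod_power_single:
  "(\<Prod>j\<in>(UNIV::'n::finite set). (Y j :: 'r::comm_ring_1) ^ Poly_Mapping.lookup (Poly_Mapping.single i 1) j) = Y i"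
  by (subst prod.remove[of _ i]) (auto simp: Poly_Mapping.lookup_single intro!: prod.neutral)

lemma lform_eval:
  assumes "lfun f" shows "mpoly_eval (lform f) v = f v"
proof -
  have "v = (\<Sum>i\<in>UNIV. v $ i *s axis i 1)"
    by (simp add: vec_eq_iff axis_def if_distrib sum.delta cong: if_cong)
  then have "f v = f (\<Sum>i\<in>UNIV. v $ i *s axis i 1)" by (rule arg_cong)
  also have "\<dots> = (\<Sum>i\<in>UNIV. v $ i * f (axis i 1))" by (simp only: lfunD[OF assms])
  also have "\<dots> = mpoly_eval (lform f) v"
    unfolding lform_def mpoly_eval_eq_subst eval_hom.subst_sum eval_hom.subst_single prod_power_single
    by (simp add: algebra_simps)
  finally show ?thesis by simp
qed

lemma lfun_component: "lfun (\<lambda>v. v $ i)"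
  by (simp add: lfun_iff)

lemma lfun_combine:
  assumes "lfun f" "lfun g"
  shows "lfun (\<lambda>v. a * f v + b * g v)"
  using assms by (simp add: lfun_iff algebra_simps)

lemma dderiv_lform: assumes "lfun f" shows "dderiv (lform f) v u = f u"
proof -
  have "line_poly (lform f) v u = (\<Sum>i\<in>UNIV. smult (f (axis i 1)) [:v $ i, u $ i:])"
    unfolding line_poly_def lform_def curve_hom.subst_sum curve_hom.subst_single prod_power_single
    by (simp add: mult.commute)
  then have "coeff (line_poly (lform f) v u) 1 = (\<Sum>i\<in>UNIV. f (axis i 1) * u $ i)"
    by (simp add: coeff_sum)
  also have "\<dots> = mpoly_eval (lform f) u"
    unfolding lform_def mpoly_eval_eq_subst eval_hom.subst_sum eval_hom.subst_single prod_power_single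
    by simp
  finally show ?thesis by (simp add: line_poly_coeff_1[symmetric] lform_eval assms del: One_nat_def)
qed

lemma homogeneous_add: "homogeneous d f \<Longrightarrow> homogeneous d g \<Longrightarrow> homogeneous d (f + g)"
  using Poly_Mapping.keys_add[of f g] by (auto simp: homogeneous_def)

lemma homogeneous_0: "homogeneous d 0"
  by (simp add: homogeneous_def)

lemma homogeneous_sum: "(\<And>a. a \<in> A \<Longrightarrow> homogeneous d (g a)) \<Longrightarrow> homogeneous d (sum g A)"
  by (induction A rule: infinite_finite_induct) (auto intro: homogeneous_add homogeneous_0)

lemma homogeneous_uminus: "homogeneous d f \<Longrightarrow> homogeneous d (- f)"
  by (auto simp: homogeneous_def Poly_Mapping.in_keys_iff)

lemma homogeneous_diff: "homogeneous d f \<Longrightarrow> homogeneous d g \<Longrightarrow> homogeneous d (f - g)"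
  using homogeneous_add[OF _ homogeneous_uminus, of d f g] by simp

lemma homogeneous_single:
  "(\<Sum>i\<in>UNIV. Poly_Mapping.lookup m i) = d \<Longrightarrow> homogeneous d (Poly_Mapping.single m c)"
  by (auto simp: homogeneous_def)

lemma homogeneous_mult:
  assumes "homogeneous d f" "homogeneous e g" shows "homogeneous (d + e) (f * g)"
  unfolding homogeneous_def
proof
  fix m assume "m \<in> Poly_Mapping.keys (f * g)"
  then obtain x y where "m = x + y" "x \<in> Poly_Mapping.keys f" "y \<in> Poly_Mapping.keys g"
    using Poly_Mapping.keys_mult[of f g] by auto
  then show "(\<Sum>i\<in>UNIV. Poly_Mapping.lookup m i) = d + e"
    using assms by (auto simp: homogeneous_def Poly_Mapping.lookup_add sum.distrib)
qed

lemma homogeneous_const: "homogeneous 0 (Poly_Mapping.single 0 c)"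
  by (rule homogeneous_single) simp

lemma homogeneous_lform: "homogeneous 1 (lform f)"
  unfolding lform_def
  by (intro homogeneous_sum homogeneous_single) (simp add: Poly_Mapping.lookup_single when_def)

lemma homogeneous_eval_scale:
  assumes "homogeneous d f" shows "mpoly_eval f (t *s v) = t ^ d * mpoly_eval f v"
proof -
  have "(\<Prod>i\<in>UNIV. (t *s v) $ i ^ Poly_Mapping.lookup m i) =
      t ^ d * (\<Prod>i\<in>UNIV. v $ i ^ Poly_Mapping.lookup m i)" if "m \<in> Poly_Mapping.keys f" for m
  proof -
    have "(\<Prod>i\<in>UNIV. t ^ Poly_Mapping.lookup m i) = t ^ d"
      using assms that unfolding homogeneous_def by (metis power_sum)
    then show ?thesis by (simp add: power_mult_distrib prod.distrib)
  qed
  then show ?thesis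
    unfolding mpoly_eval_def sum_distrib_left by (intro sum.cong) (auto simp: algebra_simps)
qed

lemma homogeneous_1_lfun:
  fixes l :: "('k::field, 'n::finite) mpoly"
  assumes "homogeneous 1 l" shows "lfun (mpoly_eval l)"
proof -
  have m: "\<exists>i. m = Poly_Mapping.single i 1" if "m \<in> Poly_Mapping.keys l" for m
  proof -
    have s: "(\<Sum>i\<in>UNIV. Poly_Mapping.lookup m i) = 1"
      using assms that by (auto simp: homogeneous_def)
    then obtain i where i: "Poly_Mapping.lookup m i = 1" "\<forall>j\<in>UNIV. j \<noteq> i \<longrightarrow> Poly_Mapping.lookup m j = 0"
      by (metis sum_eq_1_iff[of "UNIV::'n set" "Poly_Mapping.lookup m"] finite_class.finite_UNIV)
    have "m = Poly_Mapping.single i 1"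
      using i by (intro poly_mapping_eqI) (auto simp: Poly_Mapping.lookup_single when_def)
    then show ?thesis ..
  qed
  then obtain i where i: "\<And>m. m \<in> Poly_Mapping.keys l \<Longrightarrow> m = Poly_Mapping.single (i m) 1" by metis
  have "mpoly_eval l v = (\<Sum>m\<in>Poly_Mapping.keys l. Poly_Mapping.lookup l m * v $ i m)" for v
    unfolding mpoly_eval_def
  proof (rule sum.cong[OF refl])
    fix m assume m: "m \<in> Poly_Mapping.keys l"
    have "(\<Prod>j\<in>UNIV. v $ j ^ Poly_Mapping.lookup m j) = v $ i m"
      by (subst i[OF m], rule prod_power_single)
    then show "Poly_Mapping.lookup l m * (\<Prod>j\<in>UNIV. v $ j ^ Poly_Mapping.lookup m j) =
      Poly_Mapping.lookup l m * v $ i m" by simp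
  qed
  then show ?thesis
    by (simp add: lfun_iff sum.distrib sum_distrib_left algebra_simps)
qed


section \<open>Division along a direction\<close>

lemma map_poly_ring_hom:
  fixes g :: "'a::comm_ring_1 \<Rightarrow> 'b::comm_ring_1"
  assumes g: "g 0 = 0" "\<And>x y. g (x + y) = g x + g y" "\<And>x y. g (x * y) = g x * g y"
  shows "map_poly g (p + q) = map_poly g p + map_poly g q"
    "map_poly g (p * q) = map_poly g p * map_poly g q"
proof -
  have s: "g (sum u A) = (\<Sum>a\<in>A. g (u a))" for u :: "nat \<Rightarrow> 'a" and A
    by (induction A rule: infinite_finite_induct) (auto simp: g)
  show "map_poly g (p + q) = map_poly g p + map_poly g q"
    by (rule poly_eqI) (simp add: coeff_map_poly g)
  show "map_poly g (p * q) = map_poly g p * map_poly g q"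
    by (rule poly_eqI) (simp add: coeff_map_poly g coeff_mult s)
qed

text \<open>A polynomial \<open>F\<close> in one variable over the coordinate ring is a family of polynomials in one
  variable, parametrized by the points \<open>y\<close>.\<close>

abbreviation coeffs_at :: "('k::field, 'n::finite) mpoly poly \<Rightarrow> 'k ^ 'n \<Rightarrow> 'k poly"
  where "coeffs_at F y \<equiv> map_poly (\<lambda>c. mpoly_eval c y) F"

lemma eval_poly_mpoly:
  "mpoly_eval (poly F g) y = poly (coeffs_at F y) (mpoly_eval g y)"
  by (induction F) (auto simp: map_poly_pCons)

text \<open>The restrictions of \<open>f\<close> to all the lines in direction \<open>e\<close>, as one polynomial in the parameter
  of the line whose coefficients are polynomials in the base point.\<close>

lemma slice:
  fixes f :: "('k::field, 'n::finite) mpoly" and \<pi> :: "'k ^ 'n \<Rightarrow> 'k ^ 'n"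
  assumes "\<And>i. lfun (\<lambda>y. \<pi> y $ i)"
  obtains F where "\<And>y. coeffs_at F y = line_poly f (\<pi> y) e"
proof
  fix y
  define F where "F = mpoly_subst (\<lambda>c. [:Poly_Mapping.single 0 c:])
    (\<lambda>i. [:lform (\<lambda>y. \<pi> y $ i), Poly_Mapping.single 0 (e $ i):]) f"
  show "coeffs_at F y = line_poly f (\<pi> y) e"
    unfolding F_def line_poly_def
    by (subst subst_compose[where g = "\<lambda>F. coeffs_at F y"])
       (auto simp: map_poly_ring_hom map_poly_pCons lform_eval assms)
qed

lemma eval_line_slice:
  assumes "coeffs_at F y = line_poly f (\<pi> y) e" "lfun l"
  shows "mpoly_eval (poly F (lform l)) y = mpoly_eval f (\<pi> y + l y *s e)"
  using assms by (simp add: eval_poly_mpoly lform_eval poly_line_poly)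

lemma slice_div_linear:
  fixes f :: "('k::field, 'n::finite) mpoly" and \<pi> :: "'k ^ 'n \<Rightarrow> 'k ^ 'n"
  assumes \<pi>: "\<And>i. lfun (\<lambda>y. \<pi> y $ i)" and l: "lfun l"
    and f: "\<And>y. mpoly_eval f (\<pi> y) = 0"
  obtains K where "\<And>y. mpoly_eval f (\<pi> y + l y *s e) = l y * mpoly_eval K y"
proof -
  obtain F where F: "\<And>y. coeffs_at F y = line_poly f (\<pi> y) e" by (rule slice[OF \<pi>, of f e]) blast
  obtain f0 G where FG: "F = pCons f0 G" by (cases F)
  have "mpoly_eval f0 y = 0" for y
    using f[of y] line_poly_coeff_0[of f "\<pi> y" e] unfolding F[symmetric] FG
    by (simp add: map_poly_pCons)
  then have "mpoly_eval f (\<pi> y + l y *s e) = l y * mpoly_eval (poly G (lform l)) y" for y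
    unfolding eval_line_slice[where f = f and \<pi> = \<pi> and e = e, OF F l, symmetric] FG by (simp add: lform_eval l)
  then show ?thesis using that by blast
qed

lemma slice_div_square:
  fixes f :: "('k::field, 'n::finite) mpoly" and \<pi> :: "'k ^ 'n \<Rightarrow> 'k ^ 'n"
  assumes \<pi>: "\<And>i. lfun (\<lambda>y. \<pi> y $ i)" and l: "lfun l"
    and f: "\<And>y. mpoly_eval f (\<pi> y) = 0" and df: "\<And>y. dderiv f (\<pi> y) e = 0"
  obtains K where "\<And>y. mpoly_eval f (\<pi> y + l y *s e) = (l y)\<^sup>2 * mpoly_eval K y"
proof -
  obtain F where F: "\<And>y. coeffs_at F y = line_poly f (\<pi> y) e" by (rule slice[OF \<pi>, of f e]) blast
  obtain f0 f1 G where FG: "F = pCons f0 (pCons f1 G)" by (metis pCons_cases)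
  have "mpoly_eval f0 y = 0" for y
    using f[of y] line_poly_coeff_0[of f "\<pi> y" e] unfolding F[symmetric] FG
    by (simp add: map_poly_pCons)
  moreover have "mpoly_eval f1 y = 0" for y
    using df[of y] line_poly_coeff_1[of f "\<pi> y" e] unfolding F[symmetric] FG
    by (simp add: map_poly_pCons)
  ultimately have "mpoly_eval f (\<pi> y + l y *s e) = (l y)\<^sup>2 * mpoly_eval (poly G (lform l)) y" for y
    unfolding eval_line_slice[where f = f and \<pi> = \<pi> and e = e, OF F l, symmetric] FG
    by (simp add: lform_eval l power2_eq_square algebra_simps)
  then show ?thesis using that by blast
qed

text \<open>The quadratic divisor is monic, so division with remainder works over any commutative ring.\<close>

lemma div_monic_quadratic:
  fixes F :: "'a::comm_ring_1 poly"
  obtains K r0 r1 where "F = K * [:c, b, 1:] + [:r0, r1:]"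
proof (induction F arbitrary: thesis)
  case 0
  show ?case by (rule 0[of 0 0 0]) simp
next
  case (pCons a F)
  obtain K r0 r1 where F: "F = K * [:c, b, 1:] + [:r0, r1:]" by (rule pCons.IH)
  have "pCons a F = pCons r1 K * [:c, b, 1:] + [:a - c * r1, r0 - b * r1:]"
    unfolding F by (simp add: algebra_simps)
  then show ?case by (rule pCons.prems)
qed

definition det_form ::
    "('k::field ^ 'n::finite \<Rightarrow> 'k) \<Rightarrow> ('k ^ 'n \<Rightarrow> 'k) \<Rightarrow> ('k ^ 'n \<Rightarrow> 'k) \<Rightarrow> ('k ^ 'n \<Rightarrow> 'k) \<Rightarrow> ('k, 'n) mpoly"
  where "det_form A B C D = lform A * lform D - lform B * lform C"

text \<open>The remainder of \<open>f\<close> under division by the quadric is at most linear in the parameter of each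
  line in direction \<open>e\<close>, so it vanishes on the lines that meet the quadric in two points. The
  discriminant is a polynomial in the base point, and one line on which it does not vanish is
  enough for the remainder to vanish everywhere. In characteristic two the discriminant may vanish
  identically for some directions \<open>e\<close>, so its non-vanishing is a condition on \<open>e\<close> as well.\<close>

lemma slice_div_det:
  fixes f :: "('k::alg_closed_field, 'n::finite) mpoly" and \<pi> :: "'k ^ 'n \<Rightarrow> 'k ^ 'n"
  assumes \<pi>: "\<And>i. lfun (\<lambda>y. \<pi> y $ i)" and l: "lfun l"
    and lin: "lfun A" "lfun B" "lfun C" "lfun D"
    and e: "mpoly_eval (det_form A B C D) e \<noteq> 0"
    and f: "\<And>y T. mpoly_eval (det_form A B C D) (\<pi> y + T *s e) = 0 \<Longrightarrow> mpoly_eval f (\<pi> y + T *s e) = 0"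
    and two: "T1 \<noteq> T2" "mpoly_eval (det_form A B C D) (\<pi> y0 + T1 *s e) = 0"
      "mpoly_eval (det_form A B C D) (\<pi> y0 + T2 *s e) = 0"
  obtains K where "\<And>y. mpoly_eval f (\<pi> y + l y *s e) =
    mpoly_eval (det_form A B C D) (\<pi> y + l y *s e) * mpoly_eval K y"
proof -
  let ?q = "det_form A B C D"
  define \<kappa> where "\<kappa> = mpoly_eval ?q e"
  define b where "b = Poly_Mapping.single 0 (1 / \<kappa>) *
      (lform (\<lambda>y. A (\<pi> y)) * Poly_Mapping.single 0 (D e) + lform (\<lambda>y. D (\<pi> y)) * Poly_Mapping.single 0 (A e)
      - lform (\<lambda>y. B (\<pi> y)) * Poly_Mapping.single 0 (C e) - lform (\<lambda>y. C (\<pi> y)) * Poly_Mapping.single 0 (B e))"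
  define c where "c = Poly_Mapping.single 0 (1 / \<kappa>) *
      (lform (\<lambda>y. A (\<pi> y)) * lform (\<lambda>y. D (\<pi> y)) - lform (\<lambda>y. B (\<pi> y)) * lform (\<lambda>y. C (\<pi> y)))"
  have \<pi>lin: "\<pi> (x + y) = \<pi> x + \<pi> y" "\<pi> (t *s x) = t *s \<pi> x" for x y t
    using \<pi> by (simp_all add: vec_eq_iff lfun_iff)
  have lin\<pi>: "lfun (\<lambda>y. A (\<pi> y))" "lfun (\<lambda>y. B (\<pi> y))" "lfun (\<lambda>y. C (\<pi> y))" "lfun (\<lambda>y. D (\<pi> y))"
    using lin by (simp_all add: lfun_iff \<pi>lin)
  have q_eq: "mpoly_eval ?q v = A v * D v - B v * C v" for v
    by (simp add: det_form_def lform_eval lin)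
  have \<kappa>: "\<kappa> \<noteq> 0" "\<kappa> = A e * D e - B e * C e" using e by (auto simp: \<kappa>_def q_eq)
  have q_line: "mpoly_eval ?q (\<pi> y + T *s e) = \<kappa> * (T\<^sup>2 + mpoly_eval b y * T + mpoly_eval c y)" for y T
  proof -
    have kb: "\<kappa> * mpoly_eval b y = A (\<pi> y) * D e + D (\<pi> y) * A e - B (\<pi> y) * C e - C (\<pi> y) * B e"
      using \<kappa>(1) by (simp add: b_def lform_eval lin\<pi>)
    have kc: "\<kappa> * mpoly_eval c y = A (\<pi> y) * D (\<pi> y) - B (\<pi> y) * C (\<pi> y)"
      using \<kappa>(1) by (simp add: c_def lform_eval lin\<pi>)
    have "\<kappa> * (T\<^sup>2 + mpoly_eval b y * T + mpoly_eval c y) =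
        \<kappa> * T\<^sup>2 + \<kappa> * mpoly_eval b y * T + \<kappa> * mpoly_eval c y" by (simp only: algebra_simps)
    also have "\<dots> = mpoly_eval ?q (\<pi> y + T *s e)"
      unfolding kb kc unfolding \<kappa>(2) by (simp add: q_eq lfunD lin power2_eq_square algebra_simps)
    finally show ?thesis by simp
  qed
  obtain F where F: "\<And>y. coeffs_at F y = line_poly f (\<pi> y) e" by (rule slice[OF \<pi>, of f e]) blast
  obtain K r0 r1 where Fdiv: "F = K * [:c, b, 1:] + [:r0, r1:]" by (rule div_monic_quadratic)
  have line: "mpoly_eval f (\<pi> y + T *s e) =
      poly (coeffs_at K y) T * (T\<^sup>2 + mpoly_eval b y * T + mpoly_eval c y)
      + (mpoly_eval r0 y + mpoly_eval r1 y * T)" for y T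
  proof -
    have "coeffs_at F y = coeffs_at K y * [:mpoly_eval c y, mpoly_eval b y, 1:] +
        [:mpoly_eval r0 y, mpoly_eval r1 y:]"
      unfolding Fdiv by (simp add: map_poly_ring_hom map_poly_pCons del: mult_pCons_right)
    then show ?thesis
      unfolding poly_line_poly[symmetric] F[symmetric]
      by (simp add: algebra_simps power2_eq_square)
  qed
  define disc where "disc = b\<^sup>2 - 4 * c"
  have disc_roots: "mpoly_eval disc y = (U1 - U2)\<^sup>2"
    if "\<And>T. T\<^sup>2 + mpoly_eval b y * T + mpoly_eval c y = (T - U1) * (T - U2)" for y U1 U2
  proof -
    have "mpoly_eval c y = U1 * U2" using that[of 0] by simp
    moreover have "mpoly_eval b y = - (U1 + U2)"
    proof -
      have "(U1 + U2) + mpoly_eval b y = 0" using that[of 1] calculation by (simp add: algebra_simps)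
      then show ?thesis by (rule add_eq_0_iff[THEN iffD1])
    qed
    ultimately have "mpoly_eval disc y = (- (U1 + U2))\<^sup>2 - 4 * (U1 * U2)" by (simp only: disc_def mpoly_eval_simps mpoly_eval_numeral)
    then show ?thesis by (simp add: power2_eq_square algebra_simps)
  qed
  have split: "\<exists>U1 U2. \<forall>T. T\<^sup>2 + bb * T + cc = (T - U1) * (T - U2)" for bb cc :: 'k
  proof -
    obtain U1 where U1: "poly [:cc, bb, 1:] U1 = 0"
      using alg_closed_imp_poly_has_root[of "[:cc, bb, 1:]"] by auto
    have "T\<^sup>2 + bb * T + cc = (T - U1) * (T - (- bb - U1))" for T
    proof -
      have "U1 * (bb + U1) + cc = poly [:cc, bb, 1:] U1" by (simp add: algebra_simps)
      also have "\<dots> = 0" by (rule U1)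
      finally have cc: "cc = - (U1 * (bb + U1))" by (rule add_eq_0_iff[THEN iffD1])
      show ?thesis unfolding cc by (simp add: algebra_simps power2_eq_square)
    qed
    then show ?thesis by blast
  qed
  have van: "mpoly_eval r0 y = 0 \<and> mpoly_eval r1 y = 0" if d: "mpoly_eval disc y \<noteq> 0" for y
  proof -
    obtain U1 U2 where U: "\<And>T. T\<^sup>2 + mpoly_eval b y * T + mpoly_eval c y = (T - U1) * (T - U2)"
      using split by meson
    have ne: "U1 \<noteq> U2" using d disc_roots[OF U] by auto
    have "mpoly_eval r0 y + mpoly_eval r1 y * T = 0" if "T = U1 \<or> T = U2" for T
      using f[of y T] line[of y T] q_line[of y T] that unfolding U by auto
    then have *: "mpoly_eval r0 y + mpoly_eval r1 y * U1 = 0" "mpoly_eval r0 y + mpoly_eval r1 y * U2 = 0"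
      by auto
    then have "mpoly_eval r1 y * (U1 - U2) = 0" by (auto simp: algebra_simps add_eq_0_iff2)
    then show ?thesis using ne * by auto
  qed
  have "mpoly_eval disc y0 \<noteq> 0"
  proof -
    obtain U1 U2 where U: "\<And>T. T\<^sup>2 + mpoly_eval b y0 * T + mpoly_eval c y0 = (T - U1) * (T - U2)"
      using split by meson
    have "(T1 - U1) * (T1 - U2) = 0" "(T2 - U1) * (T2 - U2) = 0"
      using two(2,3) \<kappa>(1) unfolding q_line U by auto
    then have "U1 \<noteq> U2" using two(1) by auto
    then show ?thesis using disc_roots[OF U] by simp
  qed
  then have "mpoly_eval r0 y = 0" "mpoly_eval r1 y = 0" for y
    using mpoly_eval_zero_of_prod[OF infinite_alg_closed, of r0 disc y0 y]
      mpoly_eval_zero_of_prod[OF infinite_alg_closed, of r1 disc y0 y] van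
    by (auto simp del: mpoly_eval_simps simp: mpoly_eval_simps(4))
  then have "mpoly_eval f (\<pi> y + l y *s e) = mpoly_eval ?q (\<pi> y + l y *s e) *
      mpoly_eval (Poly_Mapping.single 0 (1 / \<kappa>) * poly K (lform l)) y" for y
    using \<kappa>(1) unfolding line q_line by (simp add: eval_poly_mpoly lform_eval l)
  then show ?thesis using that by blast
qed


section \<open>Splitting off a line\<close>

lemma projection_exists:
  fixes S :: "('k::field ^ 'n::finite) set"
  assumes "vec.subspace S"
  obtains P where "\<And>i. lfun (\<lambda>y. P y $ i)" "\<And>y. P y \<in> S" "\<And>y. y \<in> S \<Longrightarrow> P y = y"
proof -
  have "\<exists>g. g ` UNIV \<subseteq> S \<and> Vector_Spaces.linear (*s) (*s) g \<and> (\<forall>v\<in>S. g (id v) = v)"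
    by (rule vec.linear_exists_left_inverse_on) (auto simp: assms Vector_Spaces.linear_iff vec.vector_space_axioms)
  then obtain g where g: "range g \<subseteq> S" "Vector_Spaces.linear (*s) (*s) g" "\<forall>v\<in>S. g v = v" by auto
  have "g (x + y) = g x + g y" "g (c *s x) = c *s g x" for x y c
    using g(2) by (auto simp: Vector_Spaces.linear_iff)
  then have "lfun (\<lambda>y. g y $ i)" for i
    by (simp add: lfun_iff)
  then show ?thesis using that g by blast
qed

lemma lfun_vanishing_on:
  fixes E :: "('k::field ^ 'n::finite) set"
  assumes "vec.subspace E" "e \<notin> E"
  obtains l where "lfun l" "\<And>y. y \<in> E \<Longrightarrow> l y = 0" "l e = 1"
proof -
  obtain P where P: "\<And>i. lfun (\<lambda>y. P y $ i)" "\<And>y. P y \<in> E" "\<And>y. y \<in> E \<Longrightarrow> P y = y"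
    by (rule projection_exists[OF assms(1)]) blast
  have "e - P e \<noteq> 0" using P(2)[of e] assms(2) by auto
  then obtain i where i: "(e - P e) $ i \<noteq> 0" by (auto simp: vec_eq_iff)
  define l where "l y = (y - P y) $ i / (e - P e) $ i" for y
  show ?thesis
  proof (rule that)
    show "lfun l" using P(1) by (simp add: l_def lfun_iff diff_divide_distrib add_divide_distrib algebra_simps)
    show "l y = 0" if "y \<in> E" for y using P(3)[OF that] by (simp add: l_def)
    show "l e = 1" using i by (simp add: l_def)
  qed
qed

lemma splitting:
  fixes S :: "('k::field ^ 'n::finite) set"
  assumes "vec.subspace S" "e \<in> S" "lfun l" "l e = 1"
  obtains \<pi> where "\<And>i. lfun (\<lambda>y. \<pi> y $ i)" "\<And>y. \<pi> y \<in> S" "\<And>y. l (\<pi> y) = 0"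
    "\<And>y. y \<in> S \<Longrightarrow> \<pi> y + l y *s e = y"
proof -
  obtain P where P: "\<And>i. lfun (\<lambda>y. P y $ i)" "\<And>y. P y \<in> S" "\<And>y. y \<in> S \<Longrightarrow> P y = y"
    by (rule projection_exists[OF assms(1)]) blast
  have P': "P (x + y) = P x + P y" "P (c *s x) = c *s P x" for x y c
    using P(1) by (simp_all add: vec_eq_iff lfun_iff)
  show ?thesis
  proof (rule that[of "\<lambda>y. P y - l (P y) *s e"])
    show "lfun (\<lambda>y. (P y - l (P y) *s e) $ i)" for i
      by (simp add: lfun_iff P' lfunD[OF assms(3)] algebra_simps)
    show "P y - l (P y) *s e \<in> S" for y
      using assms P by (simp add: vec.subspace_diff vec.subspace_scale)
    show "l (P y - l (P y) *s e) = 0" for y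
      by (simp add: lfunD[OF assms(3)] assms(4))
    show "P y - l (P y) *s e + l y *s e = y" if "y \<in> S" for y using P(3)[OF that] by simp
  qed
qed

text \<open>The values on the hyperplane \<open>l = 0\<close> of \<open>S\<close> are the constant coefficient of the expansion of \<open>f\<close> in the
  direction \<open>e\<close> transverse to it.\<close>

lemma div_linear_on:
  fixes f :: "('k::field, 'n::finite) mpoly"
  assumes S: "vec.subspace S" and e: "e \<in> S" and l: "lfun l" "l e = 1"
    and f: "\<And>y. y \<in> S \<Longrightarrow> l y = 0 \<Longrightarrow> mpoly_eval f y = 0"
  obtains K where "\<And>y. y \<in> S \<Longrightarrow> mpoly_eval f y = l y * mpoly_eval K y"
proof -
  obtain \<pi> where \<pi>: "\<And>i. lfun (\<lambda>y. \<pi> y $ i)" "\<And>y. \<pi> y \<in> S" "\<And>y. l (\<pi> y) = 0"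
    "\<And>y. y \<in> S \<Longrightarrow> \<pi> y + l y *s e = y" by (rule splitting[OF S e l]) blast
  obtain K where "\<And>y. mpoly_eval f (\<pi> y + l y *s e) = l y * mpoly_eval K y"
    using slice_div_linear[OF \<pi>(1) l(1), of f e] f \<pi> by metis
  then show ?thesis using that \<pi>(4) by metis
qed

text \<open>Here the first two coefficients of the expansion in the direction \<open>e\<close> vanish.\<close>

lemma div_square_on:
  fixes f :: "('k::field, 'n::finite) mpoly"
  assumes S: "vec.subspace S" and e: "e \<in> S" and l: "lfun l" "l e = 1"
    and f: "\<And>y. y \<in> S \<Longrightarrow> l y = 0 \<Longrightarrow> mpoly_eval f y = 0 \<and> dderiv f y e = 0"
  obtains K where "\<And>y. y \<in> S \<Longrightarrow> mpoly_eval f y = (l y)\<^sup>2 * mpoly_eval K y"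
proof -
  obtain \<pi> where \<pi>: "\<And>i. lfun (\<lambda>y. \<pi> y $ i)" "\<And>y. \<pi> y \<in> S" "\<And>y. l (\<pi> y) = 0"
    "\<And>y. y \<in> S \<Longrightarrow> \<pi> y + l y *s e = y" by (rule splitting[OF S e l]) blast
  obtain K where "\<And>y. mpoly_eval f (\<pi> y + l y *s e) = (l y)\<^sup>2 * mpoly_eval K y"
    using slice_div_square[OF \<pi>(1) l(1), of f e] f \<pi> by metis
  then show ?thesis using that \<pi>(4) by metis
qed

text \<open>The direction \<open>y1 + y2\<close> is transverse to the quadric, and the line through \<open>y1\<close> in this direction
  meets it in exactly the two points \<open>y1\<close> and \<open>- y2\<close>.\<close>

lemma div_det_on:
  fixes f :: "('k::alg_closed_field, 'n::finite) mpoly"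
  assumes S: "vec.subspace S" and lin: "lfun A" "lfun B" "lfun C" "lfun D"
    and y: "y1 \<in> S" "y2 \<in> S" "mpoly_eval (det_form A B C D) y1 = 0"
      "mpoly_eval (det_form A B C D) y2 = 0" "mpoly_eval (det_form A B C D) (y1 + y2) \<noteq> 0"
    and f: "\<And>y. y \<in> S \<Longrightarrow> mpoly_eval (det_form A B C D) y = 0 \<Longrightarrow> mpoly_eval f y = 0"
  obtains K where "\<And>y. y \<in> S \<Longrightarrow> mpoly_eval f y = mpoly_eval (det_form A B C D) y * mpoly_eval K y"
proof -
  let ?q = "det_form A B C D"
  define e where "e = y1 + y2"
  have q_eq: "mpoly_eval ?q v = A v * D v - B v * C v" for v
    by (simp add: det_form_def lform_eval lin)
  have e: "e \<in> S" "mpoly_eval ?q e \<noteq> 0" using y S by (auto simp: e_def vec.subspace_add)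
  have "e \<noteq> 0" using e(2) by (auto simp: q_eq lfunD lin)
  then obtain l where l: "lfun l" "l e = 1"
    using lfun_vanishing_on[of "{0}" e] by (metis singletonD vec.subspace_single_0)
  obtain \<pi> where \<pi>: "\<And>i. lfun (\<lambda>y. \<pi> y $ i)" "\<And>y. \<pi> y \<in> S"
    "\<And>y. y \<in> S \<Longrightarrow> \<pi> y + l y *s e = y" by (rule splitting[OF S e(1) l]) blast
  have y1: "\<pi> y1 + l y1 *s e = y1" by (rule \<pi>(3)[OF y(1)])
  then have y2: "\<pi> y1 + (l y1 - 1) *s e = - y2"
    by (simp add: e_def vec_eq_iff algebra_simps)
  obtain K where "\<And>y. mpoly_eval f (\<pi> y + l y *s e) =
      mpoly_eval ?q (\<pi> y + l y *s e) * mpoly_eval K y"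
  proof (rule slice_div_det[OF \<pi>(1) l(1) lin e(2), of f "l y1" "l y1 - 1" y1])
    show "mpoly_eval f (\<pi> y + T *s e) = 0" if "mpoly_eval ?q (\<pi> y + T *s e) = 0" for y T
      using that f \<pi>(2) S e by (simp add: vec.subspace_add vec.subspace_scale)
    show "mpoly_eval ?q (\<pi> y1 + l y1 *s e) = 0" unfolding y1 by (rule y(3))
    show "mpoly_eval ?q (\<pi> y1 + (l y1 - 1) *s e) = 0"
      unfolding y2 using y(4) by (simp add: q_eq lfunD lin)
  qed auto
  then show ?thesis using that \<pi>(3) by metis
qed


section \<open>Points and linear subspaces\<close>

lemma rep_proj_subspace: "vec.subspace (rep_proj x)" and rep_proj_dim: "vec.dim (rep_proj x) = 1"
  using rep_proj[of x] by auto

lemma proj_cases: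
  obtains v where "v \<noteq> 0" "x = pt v" "rep_proj x = range (\<lambda>c. c *s v)"
proof -
  obtain B where B: "B \<subseteq> rep_proj x" "vec.independent B" "rep_proj x \<subseteq> vec.span B" "card B = 1"
    using vec.basis_exists[of "rep_proj x"] by (metis rep_proj_dim)
  then obtain v where v: "B = {v}" using card_1_singletonE by blast
  have "v \<noteq> 0" using B(2) v vec.dependent_zero by auto
  moreover have "rep_proj x = vec.span {v}"
    using B v vec.span_minimal[OF B(1) rep_proj_subspace] by auto
  moreover from this have "x = pt v" by (metis pt_def rep_proj_inverse)
  ultimately show ?thesis using that by (simp add: vec.span_singleton)
qed

lemma rep_pt:
  assumes "v \<noteq> 0" shows "rep_proj (pt v) = range (\<lambda>c. c *s v)"
proof -
  have "vec.dim {v} = 1" using assms by (simp add: vec.dim_eq_card_independent)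
  then have "vec.dim (vec.span {v}) = 1" by (simp add: vec.dim_span)
  then have "rep_proj (Abs_proj (vec.span {v})) = vec.span {v}" by (intro Abs_proj_inverse) simp
  then show ?thesis by (simp add: pt_def vec.span_singleton)
qed

lemma pt_eq_iff:
  assumes "v \<noteq> 0" "w \<noteq> 0" shows "pt v = pt w \<longleftrightarrow> (\<exists>c. w = c *s v)"
proof
  assume "pt v = pt w"
  then have "w \<in> rep_proj (pt v)" using rep_pt[OF assms(2)] by (metis rangeI vec.scale_one)
  then show "\<exists>c. w = c *s v" using rep_pt[OF assms(1)] by auto
next
  assume "\<exists>c. w = c *s v"
  then obtain c where c: "w = c *s v" "c \<noteq> 0" using assms by auto
  have "range (\<lambda>a. a *s w) = range (\<lambda>a. a *s v)"
  proof (intro subset_antisym subsetI)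
    fix x assume "x \<in> range (\<lambda>a. a *s v)"
    then obtain a where "x = a *s v" by auto
    then have "x = (a / c) *s w" using c by simp
    then show "x \<in> range (\<lambda>a. a *s w)" by blast
  qed (auto simp: c)
  then show "pt v = pt w" by (metis rep_pt assms rep_proj_inject)
qed

lemma pt_scale: "c \<noteq> 0 \<Longrightarrow> v \<noteq> 0 \<Longrightarrow> pt (c *s v) = pt v"
  by (subst pt_eq_iff) (auto intro!: exI[of _ "inverse c"])

lemma pt_in_projectivization:
  assumes "vec.subspace U" "v \<noteq> 0" shows "pt v \<in> projectivization U \<longleftrightarrow> v \<in> U"
proof
  assume "pt v \<in> projectivization U"
  then have "range (\<lambda>c. c *s v) \<subseteq> U" by (simp add: projectivization_def rep_pt[OF assms(2)])
  moreover have "v \<in> range (\<lambda>c. c *s v)" by (rule image_eqI[of _ _ 1]) auto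
  ultimately show "v \<in> U" by blast
qed (use assms in \<open>auto simp: projectivization_def rep_pt vec.subspace_scale\<close>)

lemma proj_set_eqI:
  fixes A B :: "('k::field, 'n::finite) proj set"
  assumes "\<And>v. v \<noteq> 0 \<Longrightarrow> pt v \<in> A \<longleftrightarrow> pt v \<in> B" shows "A = B"
proof (rule set_eqI)
  fix x :: "('k, 'n) proj"
  obtain v where "v \<noteq> 0" "x = pt v" by (rule proj_cases[of x])
  then show "x \<in> A \<longleftrightarrow> x \<in> B" using assms by simp
qed

lemma proj_subsetI:
  fixes A B :: "('k::field, 'n::finite) proj set"
  assumes "\<And>v. v \<noteq> 0 \<Longrightarrow> pt v \<in> A \<Longrightarrow> pt v \<in> B" shows "A \<subseteq> B"
proof
  fix x :: "('k, 'n) proj" assume "x \<in> A"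
  moreover obtain v where "v \<noteq> 0" "x = pt v" by (rule proj_cases[of x])
  ultimately show "x \<in> B" using assms by simp
qed

lemma vec_span_mono: "A \<subseteq> B \<Longrightarrow> vec_span A \<subseteq> vec_span B"
  unfolding vec_span_def by (rule vec.span_mono) auto

lemma vec_span_subspace [simp]: "vec.subspace (vec_span A)"
  by (simp add: vec_span_def)

lemma vec_span_pt: "v \<noteq> 0 \<Longrightarrow> pt v \<in> A \<Longrightarrow> v \<in> vec_span A"
  unfolding vec_span_def
  by (rule vec.span_base) (auto simp: rep_pt intro!: bexI[of _ "pt v"] image_eqI[of _ _ 1])

lemma vec_span_least:
  assumes "vec.subspace U" "\<And>v. v \<noteq> 0 \<Longrightarrow> pt v \<in> A \<Longrightarrow> v \<in> U" shows "vec_span A \<subseteq> U"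
  unfolding vec_span_def
proof (rule vec.span_minimal[OF _ assms(1)], safe)
  fix x v assume x: "x \<in> A" "v \<in> rep_proj x"
  obtain w where w: "w \<noteq> 0" "x = pt w" "rep_proj x = range (\<lambda>c. c *s w)" by (rule proj_cases)
  then show "v \<in> U" using assms x by (auto simp: vec.subspace_scale)
qed

lemma vec_span_projectivization:
  assumes "vec.subspace U" shows "vec_span (projectivization U) = U"
proof
  show "vec_span (projectivization U) \<subseteq> U"
    by (rule vec_span_least[OF assms]) (simp add: pt_in_projectivization assms)
  show "U \<subseteq> vec_span (projectivization U)"
  proof
    fix v assume "v \<in> U"
    then show "v \<in> vec_span (projectivization U)"
      by (cases "v = 0")
        (auto simp: vec.subspace_0 pt_in_projectivization assms intro: vec_span_pt)
  qed
qed

lemma projectivization_mono_iff: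
  assumes "vec.subspace U" "vec.subspace W"
  shows "projectivization U \<subseteq> projectivization W \<longleftrightarrow> U \<subseteq> W"
  using vec_span_mono[of "projectivization U" "projectivization W"]
  by (auto simp: vec_span_projectivization assms) (auto simp: projectivization_def)

lemma projectivization_eq_iff:
  "vec.subspace U \<Longrightarrow> vec.subspace W \<Longrightarrow> projectivization U = projectivization W \<longleftrightarrow> U = W"
  by (metis vec_span_projectivization)

lemma lin_span_eqI:
  assumes "vec.subspace U" "\<And>v. v \<noteq> 0 \<Longrightarrow> pt v \<in> A \<Longrightarrow> v \<in> U" "U \<subseteq> vec_span A"
  shows "lin_span A = projectivization U"
proof -
  have "vec_span A \<subseteq> U" by (rule vec_span_least) (use assms in auto)
  then show ?thesis using assms(3) by (simp add: lin_span_def subset_antisym)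
qed

lemma span_pair: "vec.span {v, w} = {a *s v + b *s w | a b. True}"
proof
  show "{a *s v + b *s w | a b. True} \<subseteq> vec.span {v, w}"
    by (auto intro!: vec.span_add vec.span_scale intro: vec.span_base)
  show "vec.span {v, w} \<subseteq> {a *s v + b *s w | a b. True}"
  proof
    fix x assume "x \<in> vec.span {v, w}"
    then obtain k where "x - k *s v \<in> vec.span {w}" by (auto simp: vec.span_insert)
    then obtain c where "x - k *s v = c *s w" by (auto simp: vec.span_singleton)
    then have "x = k *s v + c *s w" by (simp add: algebra_simps)
    then show "x \<in> {a *s v + b *s w | a b. True}" by blast
  qed
qed

lemma lin_span_pair:
  assumes "v \<noteq> 0" "w \<noteq> 0"
  shows "lin_span {pt v, pt w} = projectivization {a *s v + b *s w | a b. True}"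
proof -
  have "vec_span {pt v, pt w} = vec.span {v, w}"
  proof
    show "vec_span {pt v, pt w} \<subseteq> vec.span {v, w}"
    proof (rule vec_span_least)
      fix u assume "u \<noteq> 0" "pt u \<in> {pt v, pt w}"
      then obtain c where "u = c *s v \<or> u = c *s w" using assms pt_eq_iff by (metis empty_iff insert_iff)
      then show "u \<in> vec.span {v, w}" by (auto intro: vec.span_base vec.span_scale)
    qed simp
    show "vec.span {v, w} \<subseteq> vec_span {pt v, pt w}"
      using assms by (intro vec.span_minimal) (auto intro: vec_span_pt)
  qed
  then show ?thesis by (simp add: lin_span_def span_pair)
qed

lemma subspace_line: "vec.subspace {a *s v + b *s w | a b. True}"
  unfolding span_pair[symmetric] by (rule vec.subspace_span)

lemma dim_line:
  fixes v w :: "'k::field ^ 'n::finite"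
  assumes "v \<noteq> 0" "\<And>c. w \<noteq> c *s v" shows "vec.dim {a *s v + b *s w | a b. True} = 2"
proof -
  have "w \<notin> vec.span {v}" using assms(2) by (auto simp: vec.span_singleton)
  then have "vec.dim {w, v} = 2" using assms(1) by (simp add: vec.dim_insert)
  then show ?thesis unfolding span_pair[symmetric] by (simp add: vec.dim_span insert_commute)
qed

section \<open>Ideals and closed subschemes\<close>

definition is_ideal :: "'a::comm_ring_1 set \<Rightarrow> bool"
  where "is_ideal I \<longleftrightarrow> 0 \<in> I \<and> (\<forall>f\<in>I. \<forall>g\<in>I. f + g \<in> I) \<and> (\<forall>f\<in>I. \<forall>g. g * f \<in> I)"

lemma module_ring: "module ((*) :: 'a::comm_ring_1 \<Rightarrow> 'a \<Rightarrow> 'a)"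
  by unfold_locales (auto simp: algebra_simps)

lemma is_ideal_gen: "is_ideal (ideal_gen A)"
  unfolding is_ideal_def ideal_gen_def
  using module.span_zero[OF module_ring] module.span_add[OF module_ring] module.span_scale[OF module_ring]
  by blast

lemma ideal_gen_base: "f \<in> A \<Longrightarrow> f \<in> ideal_gen A"
  unfolding ideal_gen_def by (rule module.span_base[OF module_ring])

lemma ideal_gen_least:
  assumes "is_ideal I" "A \<subseteq> I" shows "ideal_gen A \<subseteq> I"
  unfolding ideal_gen_def
  by (rule module.span_minimal[OF module_ring assms(2)])
    (use assms(1) in \<open>auto simp: is_ideal_def module.subspace_def[OF module_ring]\<close>)

lemma is_idealD:
  assumes "is_ideal I"
  shows "0 \<in> I" "f \<in> I \<Longrightarrow> g \<in> I \<Longrightarrow> f + g \<in> I" "f \<in> I \<Longrightarrow> g * f \<in> I" "f \<in> I \<Longrightarrow> f * g \<in> I"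
    "f \<in> I \<Longrightarrow> g \<in> I \<Longrightarrow> f - g \<in> I"
proof -
  show "0 \<in> I" and a: "f \<in> I \<Longrightarrow> g \<in> I \<Longrightarrow> f + g \<in> I" and m: "f \<in> I \<Longrightarrow> g * f \<in> I" for f g
    using assms by (auto simp: is_ideal_def)
  show "f \<in> I \<Longrightarrow> f * g \<in> I" using m[of f g] by (simp add: mult.commute)
  show "f \<in> I \<Longrightarrow> g \<in> I \<Longrightarrow> f - g \<in> I" using a[of f "- 1 * g"] m[of g "- 1"] by simp
qed

lemma is_ideal_sum: "is_ideal I \<Longrightarrow> (\<And>a. a \<in> A \<Longrightarrow> g a \<in> I) \<Longrightarrow> sum g A \<in> I"
  by (induction A rule: infinite_finite_induct) (auto simp: is_idealD)

lemma saturation_mono: "I \<subseteq> J \<Longrightarrow> saturation I \<subseteq> saturation J"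
  unfolding saturation_def by blast

lemma ideal_subset_saturation: "is_ideal I \<Longrightarrow> I \<subseteq> saturation I"
  unfolding saturation_def by (auto simp: is_idealD)

lemma closed_subscheme_ideal: "closed_subscheme I \<Longrightarrow> is_ideal I"
  unfolding closed_subscheme_def homogeneous_ideal_def using is_ideal_gen by metis

lemma scheme_inter_least:
  assumes "closed_subscheme c" "I \<subseteq> c" "J \<subseteq> c" shows "scheme_inter I J \<subseteq> c"
proof -
  have "ideal_gen (I \<union> J) \<subseteq> c"
    using assms closed_subscheme_ideal by (intro ideal_gen_least) auto
  then show ?thesis
    using saturation_mono assms(1) unfolding scheme_inter_def closed_subscheme_def by metis
qed

definition homog_part :: "nat \<Rightarrow> ('k::field, 'n::finite) mpoly \<Rightarrow> ('k, 'n) mpoly"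
  where "homog_part d f =
    (\<Sum>m | m \<in> Poly_Mapping.keys f \<and> (\<Sum>i\<in>UNIV. Poly_Mapping.lookup m i) = d.
      Poly_Mapping.single m (Poly_Mapping.lookup f m))"

lemma homogeneous_homog_part: "homogeneous d (homog_part d f)"
  unfolding homog_part_def by (intro homogeneous_sum homogeneous_single) auto

lemma sum_homog_part:
  fixes f :: "('k::field, 'n::finite) mpoly"
  obtains N where "\<And>M. M \<ge> N \<Longrightarrow> f = (\<Sum>d\<le>M. homog_part d f)"
proof
  let ?deg = "\<lambda>m :: 'n \<Rightarrow>\<^sub>0 nat. \<Sum>i\<in>UNIV. Poly_Mapping.lookup m i"
  fix M assume M: "M \<ge> Max (insert 0 (?deg ` Poly_Mapping.keys f))"
  have "?deg m \<le> M" if "m \<in> Poly_Mapping.keys f" for m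
    by (rule order_trans[OF Max_ge M]) (use that in auto)
  then have "(\<Sum>d\<le>M. homog_part d f) =
      (\<Sum>m\<in>Poly_Mapping.keys f. Poly_Mapping.single m (Poly_Mapping.lookup f m))"
    unfolding homog_part_def by (intro sum.group) auto
  then show "f = (\<Sum>d\<le>M. homog_part d f)" by (rule trans[OF mpoly_monomials sym])
qed

text \<open>Vanishing on a set of points to first order, where a tangent direction is attached to each
  point; the direction \<open>0\<close> gives no condition on the derivative. In this way
  reduced subschemes and tangent vectors are treated at once.\<close>

definition tangent_ideal :: "(('k::field ^ 'n::finite) \<times> ('k ^ 'n)) set \<Rightarrow> ('k, 'n) mpoly set"
  where "tangent_ideal R =
    {f. \<forall>(q, p)\<in>R. \<forall>t. mpoly_eval f (t *s q) = 0 \<and> dderiv f (t *s q) (t *s p) = 0}"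

lemma is_ideal_tangent_ideal:
  fixes R :: "(('k::field ^ 'n::finite) \<times> ('k ^ 'n)) set"
  shows "is_ideal (tangent_ideal R)"
proof -
  have "dderiv 0 v u = 0" for v u :: "'k ^ 'n"
    by (simp add: dderiv_def mpoly_deriv_def)
  then show ?thesis
    unfolding is_ideal_def tangent_ideal_def by (fastforce simp: dderiv_hom)
qed

lemma poly_coeffs_zero:
  fixes c :: "nat \<Rightarrow> 'k::field"
  assumes "infinite (UNIV :: 'k set)" "\<And>t. (\<Sum>d\<le>N. t ^ d * c d) = 0" "d \<le> N"
  shows "c d = 0"
proof -
  define P where "P = (\<Sum>d\<le>N. monom (c d) d)"
  have "P = 0"
    by (rule infinite_field_poly_zero[OF assms(1)])
      (use assms(2) in \<open>simp add: P_def poly_sum poly_monom mult.commute\<close>)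
  moreover have "coeff P d = c d"
    using assms(3) by (simp add: P_def coeff_sum coeff_monom sum.delta)
  ultimately show ?thesis by simp
qed

lemma dderiv_scale_homogeneous:
  fixes f :: "('k::field, 'n::finite) mpoly"
  assumes inf: "infinite (UNIV :: 'k set)" and "homogeneous d f"
  shows "dderiv f (t *s q) (t *s p) = t ^ d * dderiv f q p"
proof -
  have "line_poly f (t *s q) (t *s p) = smult (t ^ d) (line_poly f q p)"
  proof -
    have "poly (line_poly f (t *s q) (t *s p) - smult (t ^ d) (line_poly f q p)) T = 0" for T
      using homogeneous_eval_scale[OF assms(2), of t "q + T *s p"]
      by (simp add: poly_line_poly vec.scale_right_distrib mult.commute)
    then show ?thesis using infinite_field_poly_zero[OF inf] by (metis eq_iff_diff_eq_0)
  qed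
  then show ?thesis by (metis line_poly_coeff_1 coeff_smult)
qed

text \<open>The conditions are imposed on whole lines through the origin, so over an infinite field they hold
  for each homogeneous part separately. For saturation, multiply by a power of a coordinate that does not
  vanish at the point.\<close>

lemma closed_subscheme_tangent_ideal:
  fixes R :: "(('k::field ^ 'n::finite) \<times> ('k ^ 'n)) set"
  assumes inf: "infinite (UNIV :: 'k set)" and R: "\<And>q p. (q, p) \<in> R \<Longrightarrow> q \<noteq> 0"
  shows "closed_subscheme (tangent_ideal R)"
proof -
  let ?I = "tangent_ideal R"
  have part: "homog_part d f \<in> ?I" if f: "f \<in> ?I" for d f
  proof -
    obtain N where N: "\<And>M. M \<ge> N \<Longrightarrow> f = (\<Sum>d\<le>M. homog_part d f)" by (rule sum_homog_part) blast
    \<comment> \<open>the given degree may exceed all degrees that occur in the polynomial\<close>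
    define M where "M = max N d"
    have fM: "f = (\<Sum>d\<le>M. homog_part d f)" by (rule N) (simp add: M_def)
    have dsum: "dderiv (sum g A) v u = (\<Sum>a\<in>A. dderiv (g a) v u)" if "finite A"
      for g :: "nat \<Rightarrow> ('k, 'n) mpoly" and A v u
      using that by induction (auto simp: dderiv_hom, simp add: dderiv_def mpoly_deriv_def)
    have "mpoly_eval (homog_part d f) (t *s q) = 0 \<and> dderiv (homog_part d f) (t *s q) (t *s p) = 0"
      if qp: "(q, p) \<in> R" for q p t
    proof -
      have "(\<Sum>d\<le>M. t ^ d * mpoly_eval (homog_part d f) q) = 0" for t
      proof -
        have "0 = mpoly_eval (\<Sum>d\<le>M. homog_part d f) (t *s q)"
          using f qp unfolding fM[symmetric] tangent_ideal_def by auto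
        then show ?thesis
          by (simp add: homogeneous_eval_scale[OF homogeneous_homog_part])
      qed
      then have 1: "mpoly_eval (homog_part d f) q = 0"
        by (rule poly_coeffs_zero[OF inf]) (simp add: M_def)
      have "(\<Sum>d\<le>M. t ^ d * dderiv (homog_part d f) q p) = 0" for t
      proof -
        have "0 = dderiv (\<Sum>d\<le>M. homog_part d f) (t *s q) (t *s p)"
          using f qp unfolding fM[symmetric] tangent_ideal_def by auto
        then show ?thesis
          by (simp add: dsum dderiv_scale_homogeneous[OF inf homogeneous_homog_part])
      qed
      then have "dderiv (homog_part d f) q p = 0"
        by (rule poly_coeffs_zero[OF inf]) (simp add: M_def)
      then show ?thesis
        using 1 by (simp add: dderiv_scale_homogeneous[OF inf homogeneous_homog_part]
          homogeneous_eval_scale[OF homogeneous_homog_part])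
    qed
    then show ?thesis unfolding tangent_ideal_def by auto
  qed
  have "f \<in> ideal_gen {f \<in> ?I. \<exists>d. homogeneous d f}" if "f \<in> ?I" for f
  proof -
    obtain N where "\<And>M. M \<ge> N \<Longrightarrow> f = (\<Sum>d\<le>M. homog_part d f)" by (rule sum_homog_part) blast
    then have N: "f = (\<Sum>d\<le>N. homog_part d f)" by blast
    have "homog_part d f \<in> ideal_gen {f \<in> ?I. \<exists>d. homogeneous d f}" for d
      using part[OF that] homogeneous_homog_part by (intro ideal_gen_base) blast
    then show ?thesis by (subst N) (intro is_ideal_sum is_ideal_gen)
  qed
  then have "homogeneous_ideal ?I"
    unfolding homogeneous_ideal_def
    using ideal_gen_least[OF is_ideal_tangent_ideal, of "{f \<in> ?I. \<exists>d. homogeneous d f}" R] by blast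
  moreover have "saturation ?I \<subseteq> ?I"
  proof
    fix f assume "f \<in> saturation ?I"
    then obtain d where d: "\<And>g. homogeneous d g \<Longrightarrow> g * f \<in> ?I" unfolding saturation_def by blast
    have "mpoly_eval f (t *s q) = 0 \<and> dderiv f (t *s q) (t *s p) = 0" if qp: "(q, p) \<in> R" for q p t
    proof -
      obtain i where i: "q $ i \<noteq> 0" using R[OF qp] by (auto simp: vec_eq_iff)
      define g :: "('k, 'n) mpoly" where "g = lform (\<lambda>v. v $ i) ^ d"
      have hom: "homogeneous d g"
        unfolding g_def
      proof (induction d)
        case 0 then show ?case using homogeneous_const[of 1] by simp
      next
        case (Suc d) then show ?case using homogeneous_mult[OF homogeneous_lform Suc] by simp
      qed
      have g: "mpoly_eval g (t *s q) = (t * q $ i) ^ d" for t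
        by (simp add: g_def lform_eval lfun_component)
      have gf: "mpoly_eval g (t *s q) * mpoly_eval f (t *s q) = 0"
        "mpoly_eval g (t *s q) * dderiv f (t *s q) (t *s p) + dderiv g (t *s q) (t *s p) * mpoly_eval f (t *s q) = 0" for t
        using d[OF hom] qp unfolding tangent_ideal_def by (auto simp: dderiv_hom)
      have nz: "mpoly_eval f (t *s q) = 0" "dderiv f (t *s q) (t *s p) = 0" if "t \<noteq> 0" for t
        using gf[of t] that i by (auto simp: g)
      have "[:0, 1:] * line_poly f 0 q = 0"
      proof (rule infinite_field_poly_zero[OF inf])
        show "poly ([:0, 1:] * line_poly f 0 q) t = 0" for t
          using nz(1)[of t] by (cases "t = 0") (auto simp: poly_line_poly)
      qed
      then have "line_poly f 0 q = 0" by simp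
      then have "mpoly_eval f 0 = 0" by (metis line_poly_coeff_0 coeff_0)
      moreover have "dderiv f v 0 = 0" for v by (simp add: dderiv_def)
      ultimately show ?thesis using nz by (cases "t = 0") auto
    qed
    then show "f \<in> ?I" unfolding tangent_ideal_def by auto
  qed
  ultimately show ?thesis
    unfolding closed_subscheme_def using ideal_subset_saturation[OF is_ideal_tangent_ideal, of R] by auto
qed

lemma vanishing_ideal_eq_tangent_ideal:
  fixes A :: "('k::field, 'n::finite) proj set"
  shows "vanishing_ideal A = tangent_ideal {(v, 0) | v. v \<noteq> 0 \<and> pt v \<in> A}"
proof -
  have z: "dderiv f v 0 = 0" for f :: "('k, 'n) mpoly" and v by (simp add: dderiv_def)
  have "(\<forall>v\<in>rep_proj x. mpoly_eval f v = 0) \<longleftrightarrow>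
      (\<forall>v. v \<noteq> 0 \<longrightarrow> x = pt v \<longrightarrow> (\<forall>t. mpoly_eval f (t *s v) = 0))" for x and f :: "('k, 'n) mpoly"
  proof -
    obtain w where w: "w \<noteq> 0" "x = pt w" "rep_proj x = range (\<lambda>c. c *s w)" by (rule proj_cases)
    show ?thesis
    proof
      assume l: "\<forall>v\<in>rep_proj x. mpoly_eval f v = 0"
      show "\<forall>v. v \<noteq> 0 \<longrightarrow> x = pt v \<longrightarrow> (\<forall>t. mpoly_eval f (t *s v) = 0)"
      proof (intro allI impI)
        fix v t assume "v \<noteq> 0" "x = pt v"
        then have "t *s v \<in> rep_proj x" by (simp add: rep_pt)
        then show "mpoly_eval f (t *s v) = 0" using l by blast
      qed
    qed (use w in auto)
  qed
  then have "f \<in> vanishing_ideal A \<longleftrightarrow>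
      (\<forall>x\<in>A. \<forall>v. v \<noteq> 0 \<longrightarrow> x = pt v \<longrightarrow> (\<forall>t. mpoly_eval f (t *s v) = 0))" for f
    by (simp add: vanishing_ideal_def)
  then show ?thesis
    unfolding tangent_ideal_def by (auto simp: z)
qed

lemma is_ideal_vanishing_ideal: "is_ideal (vanishing_ideal A)"
  by (simp add: vanishing_ideal_eq_tangent_ideal is_ideal_tangent_ideal)

lemma closed_subscheme_vanishing_ideal:
  fixes A :: "('k::field, 'n::finite) proj set"
  assumes "infinite (UNIV :: 'k set)" shows "closed_subscheme (vanishing_ideal A)"
  unfolding vanishing_ideal_eq_tangent_ideal
  by (rule closed_subscheme_tangent_ideal[OF assms]) auto

text \<open>The value at the zero vector is determined by the values on the rest of a line through it.\<close>

lemma vanishing_ideal_iff: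
  fixes A :: "('k::field, 'n::finite) proj set"
  assumes inf: "infinite (UNIV :: 'k set)"
  shows "f \<in> vanishing_ideal A \<longleftrightarrow> (\<forall>v. v \<noteq> 0 \<longrightarrow> pt v \<in> A \<longrightarrow> mpoly_eval f v = 0)"
proof
  assume "f \<in> vanishing_ideal A"
  then show "\<forall>v. v \<noteq> 0 \<longrightarrow> pt v \<in> A \<longrightarrow> mpoly_eval f v = 0"
    unfolding vanishing_ideal_eq_tangent_ideal tangent_ideal_def by clarsimp (metis vec.scale_one)
next
  assume v: "\<forall>v. v \<noteq> 0 \<longrightarrow> pt v \<in> A \<longrightarrow> mpoly_eval f v = 0"
  have "mpoly_eval f (t *s v) = 0" if "v \<noteq> 0" "pt v \<in> A" for v t
  proof -
    have nz: "mpoly_eval f (t *s v) = 0" if "t \<noteq> 0" for t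
      using v \<open>v \<noteq> 0\<close> \<open>pt v \<in> A\<close> that by (simp add: pt_scale)
    have "[:0, 1:] * line_poly f 0 v = 0"
    proof (rule infinite_field_poly_zero[OF inf])
      show "poly ([:0, 1:] * line_poly f 0 v) t = 0" for t
        using nz[of t] by (cases "t = 0") (auto simp: poly_line_poly)
    qed
    then have "line_poly f 0 v = 0" by simp
    then have "mpoly_eval f (0 + t *s v) = 0" by (metis poly_line_poly poly_0)
    then show ?thesis by simp
  qed
  moreover have "dderiv f v 0 = 0" for v by (simp add: dderiv_def)
  ultimately show "f \<in> vanishing_ideal A"
    unfolding vanishing_ideal_eq_tangent_ideal tangent_ideal_def by auto
qed

lemma vanishing_ideal_eval_0:
  assumes "f \<in> vanishing_ideal A" "A \<noteq> {}" shows "mpoly_eval f 0 = 0"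
proof -
  obtain x where "x \<in> A" using assms(2) by blast
  moreover have "0 \<in> rep_proj x" by (simp add: rep_proj_subspace vec.subspace_0)
  ultimately show ?thesis using assms(1) unfolding vanishing_ideal_def by blast
qed

lemma vanishing_ideal_subspace_iff:
  fixes U :: "('k::field ^ 'n::finite) set"
  assumes inf: "infinite (UNIV :: 'k set)" and U: "vec.subspace U" "e \<in> U" "e \<noteq> 0"
  shows "f \<in> vanishing_ideal (projectivization U) \<longleftrightarrow> (\<forall>v\<in>U. mpoly_eval f v = 0)"
proof
  assume f: "f \<in> vanishing_ideal (projectivization U)"
  have "pt e \<in> projectivization U" using U by (simp add: pt_in_projectivization)
  then have "mpoly_eval f 0 = 0" using vanishing_ideal_eval_0[OF f] by blast
  then show "\<forall>v\<in>U. mpoly_eval f v = 0"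
    using f U(1) unfolding vanishing_ideal_iff[OF inf] by (metis pt_in_projectivization)
qed (use U(1) in \<open>simp add: vanishing_ideal_iff[OF inf] pt_in_projectivization\<close>)

lemma vanishing_ideal_antimono: "A \<subseteq> B \<Longrightarrow> vanishing_ideal B \<subseteq> vanishing_ideal A"
  unfolding vanishing_ideal_def by auto


section \<open>Intersection with a linear space\<close>

lemma vanishing_ideal_diffI:
  fixes S :: "('k::field ^ 'n::finite) set"
  assumes "infinite (UNIV :: 'k set)" "vec.subspace S" "e \<in> S" "e \<noteq> 0"
    and "\<And>y. y \<in> S \<Longrightarrow> mpoly_eval f y = mpoly_eval g y"
  shows "f - g \<in> vanishing_ideal (projectivization S)"
  using assms by (simp add: vanishing_ideal_subspace_iff)

lemma ideal_mem_of_eq_on: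
  fixes S :: "('k::field ^ 'n::finite) set"
  assumes "infinite (UNIV :: 'k set)" "vec.subspace S" "e \<in> S" "e \<noteq> 0"
    and I: "is_ideal I" "vanishing_ideal (projectivization S) \<subseteq> I" "g \<in> I"
    and "\<And>y. y \<in> S \<Longrightarrow> mpoly_eval f y = mpoly_eval g y"
  shows "f \<in> I"
proof -
  have "f - g \<in> I" using vanishing_ideal_diffI[OF assms(1-4,8)] I(2) by blast
  then have "(f - g) + g \<in> I" using is_idealD(2)[OF I(1)] I(3) by blast
  then show ?thesis by simp
qed

lemma zeros_linear:
  assumes "homogeneous 1 m" "v \<noteq> 0" shows "pt v \<in> zeros {m} \<longleftrightarrow> mpoly_eval m v = 0"
proof -
  have "mpoly_eval m (c *s v) = c * mpoly_eval m v" for c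
    by (rule lfunD(2)[OF homogeneous_1_lfun[OF assms(1)]])
  then have "pt v \<in> zeros {m} \<longleftrightarrow> (\<forall>c. c * mpoly_eval m v = 0)"
    by (simp add: zeros_def rep_pt[OF assms(2)])
  then show ?thesis by (metis mult_1 mult_zero_right)
qed

lemma projectivization_Int_zeros_linear:
  assumes "vec.subspace S" "lfun l"
  shows "projectivization S \<inter> zeros {lform l} = projectivization {y \<in> S. l y = 0}"
proof (rule proj_set_eqI)
  fix v :: "'a ^ 'b" assume v: "v \<noteq> 0"
  have "vec.subspace {y \<in> S. l y = 0}"
    using assms(1) by (auto simp: vec.subspace_def lfunD[OF assms(2)])
  then show "pt v \<in> projectivization S \<inter> zeros {lform l} \<longleftrightarrow> pt v \<in> projectivization {y \<in> S. l y = 0}"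
    using v assms by (simp add: pt_in_projectivization zeros_linear homogeneous_lform lform_eval
      del: One_nat_def)
qed

lemma subspace_kernel: "vec.subspace S \<Longrightarrow> lfun l \<Longrightarrow> vec.subspace {y \<in> S. l y = 0}"
  by (auto simp: vec.subspace_def lfunD)

text \<open>Both ideals agree with \<open>I(S) + (l\<^sup>2)\<close> before saturation.\<close>

lemma scheme_inter_double_hyperplane:
  fixes X :: "('k::field, 'n::finite) proj set"
  assumes inf: "infinite (UNIV :: 'k set)"
    and S: "vec.subspace S" and e: "e \<in> S" and l: "lfun l" "l e = 1"
    and q: "q \<in> vanishing_ideal X" "\<kappa> \<noteq> 0" "\<And>y. y \<in> S \<Longrightarrow> mpoly_eval q y = \<kappa> * (l y)\<^sup>2"
    and X: "\<And>f y. f \<in> vanishing_ideal X \<Longrightarrow> y \<in> S \<Longrightarrow> l y = 0 \<Longrightarrow> mpoly_eval f y = 0 \<and> dderiv f y e = 0"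
  shows "scheme_inter (vanishing_ideal X) (vanishing_ideal (projectivization S)) =
    double_hyperplane (projectivization S) (projectivization {y \<in> S. l y = 0})"
proof -
  let ?IS = "vanishing_ideal (projectivization S)" and ?E = "projectivization {y \<in> S. l y = 0}"
  let ?sq = "{m\<^sup>2 | m. homogeneous 1 m \<and> projectivization S \<inter> zeros {m} = ?E}"
  have e0: "e \<noteq> 0" using l lfunD(4)[OF l(1)] by auto
  have "ideal_gen (vanishing_ideal X \<union> ?IS) = ideal_gen (?IS \<union> ?sq)"
  proof
    show "ideal_gen (vanishing_ideal X \<union> ?IS) \<subseteq> ideal_gen (?IS \<union> ?sq)" (is "_ \<subseteq> ?D")
    proof (rule ideal_gen_least[OF is_ideal_gen], rule Un_least)
      show IS: "?IS \<subseteq> ?D" by (auto intro: ideal_gen_base)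
      have l2: "(lform l)\<^sup>2 \<in> ?D"
        using homogeneous_lform[of l] projectivization_Int_zeros_linear[OF S l(1)]
        by (intro ideal_gen_base) blast
      show "vanishing_ideal X \<subseteq> ?D"
      proof
        fix f assume f: "f \<in> vanishing_ideal X"
        obtain K where K: "\<And>y. y \<in> S \<Longrightarrow> mpoly_eval f y = (l y)\<^sup>2 * mpoly_eval K y"
          by (rule div_square_on[OF S e l, of f]) (use X[OF f] in auto)
        show "f \<in> ?D"
        proof (rule ideal_mem_of_eq_on[OF inf S e e0 is_ideal_gen IS])
          show "(lform l)\<^sup>2 * K \<in> ?D" by (rule is_idealD(4)[OF is_ideal_gen l2])
        qed (simp add: K lform_eval l)
      qed
    qed
    show "ideal_gen (?IS \<union> ?sq) \<subseteq> ideal_gen (vanishing_ideal X \<union> ?IS)" (is "_ \<subseteq> ?D")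
    proof (rule ideal_gen_least[OF is_ideal_gen], rule Un_least)
      show IS: "?IS \<subseteq> ?D" by (auto intro: ideal_gen_base)
      have qD: "q \<in> ?D" using q(1) by (auto intro: ideal_gen_base)
      show "?sq \<subseteq> ?D"
      proof
        fix g assume "g \<in> ?sq"
        then obtain m where m: "g = m\<^sup>2" "homogeneous 1 m" "projectivization S \<inter> zeros {m} = ?E" by blast
        note M = homogeneous_1_lfun[OF m(2)]
        have ker: "mpoly_eval m y = 0" if y: "y \<in> S" "l y = 0" for y
        proof (cases "y = 0")
          case False
          then have "pt y \<in> ?E" using y by (simp add: pt_in_projectivization subspace_kernel S l)
          then have "pt y \<in> zeros {m}" using m(3) by blast
          then show ?thesis using zeros_linear[OF m(2) False] by simp
        qed (simp add: lfunD[OF M])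
        have on: "mpoly_eval m y = mpoly_eval m e * l y" if "y \<in> S" for y
        proof -
          have "mpoly_eval m (y - l y *s e) = 0"
            using that S e by (intro ker) (auto simp: vec.subspace_diff vec.subspace_scale lfunD l)
          then show ?thesis by (simp add: lfunD[OF M])
        qed
        show "g \<in> ?D"
        proof (rule ideal_mem_of_eq_on[OF inf S e e0 is_ideal_gen IS])
          show "Poly_Mapping.single 0 ((mpoly_eval m e)\<^sup>2 / \<kappa>) * q \<in> ?D"
            by (rule is_idealD(3)[OF is_ideal_gen qD])
        qed (use q(2) in \<open>simp add: m(1) on q(3) power_mult_distrib\<close>)
      qed
    qed
  qed
  then show ?thesis by (simp add: scheme_inter_def double_hyperplane_def)
qed

text \<open>The ideal of the intersection is generated by the equation \<open>q\<close> and the ideal of \<open>S\<close> even without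
  saturation.\<close>

lemma scheme_inter_reduced:
  fixes X :: "('k::field, 'n::finite) proj set"
  assumes inf: "infinite (UNIV :: 'k set)"
    and S: "vec.subspace S" "e \<in> S" "e \<noteq> 0"
    and q: "q \<in> vanishing_ideal X"
    and div: "\<And>f. f \<in> vanishing_ideal (X \<inter> projectivization S) \<Longrightarrow>
      \<exists>K. \<forall>y\<in>S. mpoly_eval f y = mpoly_eval q y * mpoly_eval K y"
  shows "scheme_inter (vanishing_ideal X) (vanishing_ideal (projectivization S)) =
    vanishing_ideal (X \<inter> projectivization S)"
proof
  show "scheme_inter (vanishing_ideal X) (vanishing_ideal (projectivization S)) \<subseteq>
      vanishing_ideal (X \<inter> projectivization S)"
    by (rule scheme_inter_least[OF closed_subscheme_vanishing_ideal[OF inf]])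
      (rule vanishing_ideal_antimono, blast)+
  let ?IS = "vanishing_ideal (projectivization S)"
  let ?D = "ideal_gen (vanishing_ideal X \<union> ?IS)"
  have "vanishing_ideal (X \<inter> projectivization S) \<subseteq> ?D"
  proof
    fix f assume "f \<in> vanishing_ideal (X \<inter> projectivization S)"
    then obtain K where K: "\<And>y. y \<in> S \<Longrightarrow> mpoly_eval f y = mpoly_eval q y * mpoly_eval K y"
      using div by blast
    have qD: "q \<in> ?D" using q by (auto intro: ideal_gen_base)
    show "f \<in> ?D"
    proof (rule ideal_mem_of_eq_on[OF inf S is_ideal_gen])
      show "?IS \<subseteq> ?D" by (auto intro: ideal_gen_base)
      show "q * K \<in> ?D" by (rule is_idealD(4)[OF is_ideal_gen qD])
    qed (simp add: K)
  qed
  then show "vanishing_ideal (X \<inter> projectivization S) \<subseteq>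
      scheme_inter (vanishing_ideal X) (vanishing_ideal (projectivization S))"
    unfolding scheme_inter_def using ideal_subset_saturation[OF is_ideal_gen] by blast
qed


section \<open>The length of the intersection with a line\<close>

lemma scheme_length_ge_2I:
  assumes "closed_subscheme c0" "closed_subscheme c1" "closed_subscheme c2"
    and "J \<subseteq> c0" "c0 \<subset> c1" "c1 \<subset> c2"
  shows "scheme_length J \<ge> 2"
proof -
  define c where "c i = (if i = 0 then c0 else if i = 1 then c1 else c2)" for i :: nat
  have "(\<forall>i\<le>2. closed_subscheme (c i) \<and> J \<subseteq> c i) \<and> (\<forall>i<2. c i \<subset> c (Suc i))"
    using assms by (auto simp: c_def less_2_cases_iff)
  then have "enat 2 \<le> scheme_length J"
    unfolding scheme_length_def by (intro Sup_upper) blast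
  then show ?thesis by (simp add: numeral_eq_enat)
qed

lemma scheme_length_ge_2D:
  fixes J :: "('k::field, 'n::finite) mpoly set"
  assumes "scheme_length J \<ge> 2"
  obtains c0 c1 c2 where "closed_subscheme c0" "closed_subscheme c1" "closed_subscheme c2"
    "J \<subseteq> c0" "c0 \<subset> c1" "c1 \<subset> c2"
proof -
  have "\<exists>n c. 2 \<le> n \<and> (\<forall>i\<le>n. closed_subscheme (c i) \<and> J \<subseteq> c i) \<and> (\<forall>i<n. c i \<subset> c (Suc i))"
  proof (rule ccontr)
    assume no: "\<not> ?thesis"
    have "scheme_length J \<le> enat 1"
      unfolding scheme_length_def
    proof (rule Sup_least, clarify)
      fix n and c :: "nat \<Rightarrow> ('k, 'n) mpoly set"
      assume "\<forall>i\<le>n. closed_subscheme (c i) \<and> J \<subseteq> c i" "\<forall>i<n. c i \<subset> c (Suc i)"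
      then have "\<not> 2 \<le> n" using no by blast
      then show "enat n \<le> enat 1" by simp
    qed
    with assms have "2 \<le> enat 1" by (rule order_trans)
    then show False by (simp add: numeral_eq_enat)
  qed
  then obtain n c where c: "2 \<le> n" "\<forall>i\<le>n. closed_subscheme (c i) \<and> J \<subseteq> c i" "\<forall>i<n. c i \<subset> c (Suc i)"
    by blast
  show ?thesis
    by (rule that[of "c 0" "c 1" "c 2"]) (use c in \<open>auto simp: numeral_2_eq_2\<close>)
qed

lemma mem_vanishing_ideal_pt:
  fixes q :: "'k::field ^ 'n::finite"
  assumes "infinite (UNIV :: 'k set)" "q \<noteq> 0"
  shows "f \<in> vanishing_ideal {pt q} \<longleftrightarrow> (\<forall>t. mpoly_eval f (t *s q) = 0)"
proof -
  have "rep_proj (pt q) = range (\<lambda>c. c *s q)" by (rule rep_pt[OF assms(2)])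
  then show ?thesis by (auto simp: vanishing_ideal_def)
qed

text \<open>Modulo the ideal of the point, a form of degree \<open>d\<close> that does not vanish there spans all forms of
  degree \<open>d\<close>. So a strictly larger homogeneous ideal contains all of them, and its saturation is the unit
  ideal.\<close>

lemma vanishing_ideal_pt_maximal:
  fixes q :: "'k::field ^ 'n::finite"
  assumes inf: "infinite (UNIV :: 'k set)" and q: "q \<noteq> 0"
    and c: "closed_subscheme c" "vanishing_ideal {pt q} \<subset> c"
  shows "c = UNIV"
proof -
  have id: "is_ideal c" by (rule closed_subscheme_ideal[OF c(1)])
  have "\<exists>f\<in>c. (\<exists>d. homogeneous d f) \<and> f \<notin> vanishing_ideal {pt q}"
  proof (rule ccontr)
    assume "\<not> ?thesis"
    then have "{f \<in> c. \<exists>d. homogeneous d f} \<subseteq> vanishing_ideal {pt q}" by blast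
    then have "ideal_gen {f \<in> c. \<exists>d. homogeneous d f} \<subseteq> vanishing_ideal {pt q}"
      by (rule ideal_gen_least[OF is_ideal_vanishing_ideal])
    then show False using c unfolding closed_subscheme_def homogeneous_ideal_def by auto
  qed
  then obtain f d where f: "f \<in> c" "homogeneous d f" "f \<notin> vanishing_ideal {pt q}" by blast
  have fq: "mpoly_eval f q \<noteq> 0"
    using f(3) homogeneous_eval_scale[OF f(2)] by (auto simp: mem_vanishing_ideal_pt[OF inf q])
  have "g * 1 \<in> c" if g: "homogeneous d g" for g
  proof -
    let ?s = "Poly_Mapping.single 0 (mpoly_eval g q / mpoly_eval f q) * f"
    have "g - ?s \<in> vanishing_ideal {pt q}"
      using fq homogeneous_eval_scale[OF f(2)] homogeneous_eval_scale[OF g]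
      by (simp add: mem_vanishing_ideal_pt[OF inf q])
    then have "g - ?s \<in> c" using c(2) by blast
    then have "(g - ?s) + ?s \<in> c" by (rule is_idealD(2)[OF id]) (rule is_idealD(3)[OF id f(1)])
    then show ?thesis by simp
  qed
  then have "1 \<in> saturation c" unfolding saturation_def by blast
  then have "1 \<in> c" using c(1) by (simp add: closed_subscheme_def)
  then have "g * 1 \<in> c" for g by (rule is_idealD(3)[OF id])
  then show ?thesis by auto
qed

lemma separating_form:
  fixes q p :: "'k::field ^ 'n::finite"
  assumes "\<And>c. p \<noteq> c *s q"
  shows "\<exists>l. lfun l \<and> l q = 0 \<and> l p = 1"
proof -
  have "p \<notin> vec.span {q}" using assms by (auto simp: vec.span_singleton)
  then obtain l where "lfun l" "\<And>y. y \<in> vec.span {q} \<Longrightarrow> l y = 0" "l p = 1"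
    using lfun_vanishing_on[OF vec.subspace_span, of p "{q}"] by metis
  then show ?thesis by (auto simp: vec.span_base)
qed

lemma closed_subscheme_UNIV:
  assumes "infinite (UNIV :: 'k::field set)"
  shows "closed_subscheme (UNIV :: ('k, 'n::finite) mpoly set)"
  using closed_subscheme_vanishing_ideal[OF assms, of "{} :: ('k, 'n) proj set"]
  by (simp add: vanishing_ideal_def)

lemma pt_in_line:
  assumes "p \<noteq> 0" "q \<noteq> 0" "a *s p + b *s q \<noteq> 0"
  shows "pt (a *s p + b *s q) \<in> lin_span {pt p, pt q}"
proof -
  have "a *s p + b *s q \<in> {a *s p + b *s q | a b. True}" by blast
  then show ?thesis
    unfolding lin_span_pair[OF assms(1,2)] by (simp only: pt_in_projectivization[OF subspace_line assms(3)])
qed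

lemma secant_length_two_points:
  fixes q p :: "'k::field ^ 'n::finite"
  assumes inf: "infinite (UNIV :: 'k set)" and q: "q \<noteq> 0" "p \<noteq> 0" "pt q \<in> X"
    and q': "q' = a *s p + b *s q" "\<And>c. q' \<noteq> c *s q" "pt q' \<in> X"
  shows "scheme_length (scheme_inter (vanishing_ideal X) (vanishing_ideal (lin_span {pt p, pt q}))) \<ge> 2"
proof (rule scheme_length_ge_2I)
  show "closed_subscheme (vanishing_ideal {pt q, pt q'})" "closed_subscheme (vanishing_ideal {pt q})"
    by (rule closed_subscheme_vanishing_ideal[OF inf])+
  show "closed_subscheme (UNIV :: ('k, 'n) mpoly set)" by (rule closed_subscheme_UNIV[OF inf])
  have q'0: "q' \<noteq> 0" using q'(2)[of 0] by simp
  have "pt q' \<in> lin_span {pt p, pt q}" using pt_in_line[OF q(2,1)] q'(1) q'0 by simp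
  moreover have "pt q \<in> lin_span {pt p, pt q}" using pt_in_line[OF q(2,1), of 0 1] q(1) by simp
  ultimately show "scheme_inter (vanishing_ideal X) (vanishing_ideal (lin_span {pt p, pt q}))
      \<subseteq> vanishing_ideal {pt q, pt q'}"
    using q(3) q'(3)
    by (intro scheme_inter_least closed_subscheme_vanishing_ideal[OF inf] vanishing_ideal_antimono) auto
  obtain l where l: "lfun l" "l q = 0" "l q' = 1" using separating_form[of q' q] q'(2) by blast
  have "lform l \<in> vanishing_ideal {pt q}"
    using l by (simp add: mem_vanishing_ideal_pt[OF inf q(1)] lform_eval lfunD)
  moreover have "lform l \<notin> vanishing_ideal {pt q, pt q'}"
  proof
    assume "lform l \<in> vanishing_ideal {pt q, pt q'}"
    then have "mpoly_eval (lform l) q' = 0" using q'0 by (simp add: vanishing_ideal_iff[OF inf])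
    then show False using l by (simp add: lform_eval)
  qed
  ultimately show "vanishing_ideal {pt q, pt q'} \<subset> vanishing_ideal {pt q}"
    using vanishing_ideal_antimono[of "{pt q}" "{pt q, pt q'}"] by blast
  have "1 \<notin> vanishing_ideal {pt q}" by (simp add: mem_vanishing_ideal_pt[OF inf q(1)])
  then show "vanishing_ideal {pt q} \<subset> UNIV" by blast
qed

text \<open>The tangent vector at \<open>q\<close> in the direction of \<open>p\<close> is a subscheme of length two of the intersection.\<close>

lemma secant_length_tangent:
  fixes q p :: "'k::field ^ 'n::finite"
  assumes inf: "infinite (UNIV :: 'k set)" and q: "q \<noteq> 0" "p \<noteq> 0" "pt q \<in> X" "\<And>c. p \<noteq> c *s q"
    and tan: "\<And>f t. f \<in> vanishing_ideal X \<Longrightarrow> dderiv f (t *s q) (t *s p) = 0"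
  shows "scheme_length (scheme_inter (vanishing_ideal X) (vanishing_ideal (lin_span {pt p, pt q}))) \<ge> 2"
proof (rule scheme_length_ge_2I)
  let ?T = "tangent_ideal {(q, p)}"
  show T: "closed_subscheme ?T" by (rule closed_subscheme_tangent_ideal[OF inf]) (use q(1) in auto)
  show "closed_subscheme (vanishing_ideal {pt q})" by (rule closed_subscheme_vanishing_ideal[OF inf])
  show "closed_subscheme (UNIV :: ('k, 'n) mpoly set)" by (rule closed_subscheme_UNIV[OF inf])
  have "vanishing_ideal X \<subseteq> vanishing_ideal {pt q}" by (rule vanishing_ideal_antimono) (use q(3) in auto)
  then have X: "vanishing_ideal X \<subseteq> ?T"
    using tan by (auto simp: tangent_ideal_def mem_vanishing_ideal_pt[OF inf q(1)])
  have L: "vanishing_ideal (lin_span {pt p, pt q}) \<subseteq> ?T"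
  proof
    fix f assume f: "f \<in> vanishing_ideal (lin_span {pt p, pt q})"
    have "q \<in> {a *s p + b *s q | a b. True}"
      by (rule CollectI, rule exI[of _ 0], rule exI[of _ 1]) simp
    then have v: "mpoly_eval f (a *s p + b *s q) = 0" for a b
      using f vanishing_ideal_subspace_iff[OF inf subspace_line _ q(1), of p q f]
      unfolding lin_span_pair[OF q(2,1)] by blast
    have "dderiv f (t *s q) (t *s p) = 0" for t
    proof (rule dderiv_zero_of_line[OF inf])
      show "mpoly_eval f (t *s q + s *s (t *s p)) = 0" for s
        using v[of "s * t" t] by (simp add: add.commute)
    qed
    moreover have "mpoly_eval f (t *s q) = 0" for t using v[of 0 t] by simp
    ultimately show "f \<in> ?T" by (auto simp: tangent_ideal_def)
  qed
  show "scheme_inter (vanishing_ideal X) (vanishing_ideal (lin_span {pt p, pt q})) \<subseteq> ?T"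
    by (rule scheme_inter_least[OF T X L])
  obtain l where l: "lfun l" "l q = 0" "l p = 1" using separating_form[of p q] q(4) by blast
  have "lform l \<in> vanishing_ideal {pt q}"
    using l by (simp add: mem_vanishing_ideal_pt[OF inf q(1)] lform_eval lfunD)
  moreover have "lform l \<notin> ?T"
    using l by (auto simp: tangent_ideal_def dderiv_lform lfunD intro!: exI[of _ 1])
  moreover have "?T \<subseteq> vanishing_ideal {pt q}"
    by (auto simp: tangent_ideal_def mem_vanishing_ideal_pt[OF inf q(1)])
  ultimately show "?T \<subset> vanishing_ideal {pt q}" by blast
  have "1 \<notin> vanishing_ideal {pt q}" by (simp add: mem_vanishing_ideal_pt[OF inf q(1)])
  then show "vanishing_ideal {pt q} \<subset> UNIV" by blast
qed

text \<open>The restrictions of \<open>f1\<close> and \<open>f2\<close> to the line are linearly independent multiples of the equation \<open>a\<close> of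
  the point \<open>q\<close>, so they generate all quadratic multiples of \<open>a\<close>. Hence the saturation contains \<open>a\<close>,
  and the intersection is the simple point \<open>q\<close>.\<close>

lemma secant_length_less:
  fixes q p :: "'k::field ^ 'n::finite"
  assumes inf: "infinite (UNIV :: 'k set)" and q: "q \<noteq> 0" "p \<noteq> 0" "\<And>c. p \<noteq> c *s q"
    and f1: "f1 \<in> vanishing_ideal X" "\<And>a b. mpoly_eval f1 (a *s p + b *s q) = a * (a * \<alpha>1 + b * \<beta>1)"
    and f2: "f2 \<in> vanishing_ideal X" "\<And>a b. mpoly_eval f2 (a *s p + b *s q) = a * (a * \<alpha>2 + b * \<beta>2)"
    and det: "\<alpha>1 * \<beta>2 \<noteq> \<alpha>2 * \<beta>1"
  shows "\<not> scheme_length (scheme_inter (vanishing_ideal X) (vanishing_ideal (lin_span {pt p, pt q}))) \<ge> 2"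
proof
  let ?J = "scheme_inter (vanishing_ideal X) (vanishing_ideal (lin_span {pt p, pt q}))"
  let ?L = "{a *s p + b *s q | a b. True}"
  let ?I = "ideal_gen (vanishing_ideal X \<union> vanishing_ideal (projectivization ?L))"
  have J: "?J = saturation ?I" unfolding scheme_inter_def lin_span_pair[OF q(2,1)] ..
  have qp: "q \<noteq> c *s p" for c
  proof
    assume "q = c *s p"
    then have "p = inverse c *s q" using q(1) by (cases "c = 0") auto
    then show False using q(3) by blast
  qed
  obtain l where l: "lfun l" "l q = 0" "l p = 1" using separating_form[of p q] q(3) by blast
  obtain m where m: "lfun m" "m p = 0" "m q = 1" using separating_form[of q p] qp by blast
  have pL: "p \<in> ?L" by (rule CollectI, rule exI[of _ 1], rule exI[of _ 0]) simp
  have L: "vanishing_ideal (projectivization ?L) \<subseteq> ?I" by (auto intro: ideal_gen_base)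
  have fI: "f1 \<in> ?I" "f2 \<in> ?I" using f1 f2 by (auto intro: ideal_gen_base)
  note memI = ideal_mem_of_eq_on[OF inf subspace_line pL q(2) is_ideal_gen L]
  define \<delta> where "\<delta> = \<alpha>1 * \<beta>2 - \<alpha>2 * \<beta>1"
  have \<delta>: "\<delta> \<noteq> 0" using det by (simp add: \<delta>_def)
  let ?sc = "\<lambda>c f. Poly_Mapping.single 0 c * f :: ('k, 'n) mpoly"
  \<comment> \<open>the combinations are given by Cramer's rule\<close>
  have ll: "(lform l)\<^sup>2 \<in> ?I"
  proof (rule memI)
    show "?sc (\<beta>2 / \<delta>) f1 - ?sc (\<beta>1 / \<delta>) f2 \<in> ?I"
      by (intro is_idealD(5)[OF is_ideal_gen] is_idealD(3)[OF is_ideal_gen] fI)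
    fix y assume "y \<in> ?L"
    then obtain a b where y: "y = a *s p + b *s q" by blast
    have "mpoly_eval (?sc (\<beta>2 / \<delta>) f1 - ?sc (\<beta>1 / \<delta>) f2) y =
        (\<beta>2 * (a * (a * \<alpha>1 + b * \<beta>1)) - \<beta>1 * (a * (a * \<alpha>2 + b * \<beta>2))) / \<delta>"
      by (simp add: y f1 f2 diff_divide_distrib)
    also have "\<dots> = a\<^sup>2 * \<delta> / \<delta>"
      unfolding \<delta>_def by (rule arg_cong2[where f = divide]) (simp_all add: power2_eq_square algebra_simps)
    finally show "mpoly_eval ((lform l)\<^sup>2) y = mpoly_eval (?sc (\<beta>2 / \<delta>) f1 - ?sc (\<beta>1 / \<delta>) f2) y"
      using \<delta> by (simp add: y lform_eval l lfunD)
  qed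
  have lm: "lform l * lform m \<in> ?I"
  proof (rule memI)
    show "?sc (\<alpha>1 / \<delta>) f2 - ?sc (\<alpha>2 / \<delta>) f1 \<in> ?I"
      by (intro is_idealD(5)[OF is_ideal_gen] is_idealD(3)[OF is_ideal_gen] fI)
    fix y assume "y \<in> ?L"
    then obtain a b where y: "y = a *s p + b *s q" by blast
    have "mpoly_eval (?sc (\<alpha>1 / \<delta>) f2 - ?sc (\<alpha>2 / \<delta>) f1) y =
        (\<alpha>1 * (a * (a * \<alpha>2 + b * \<beta>2)) - \<alpha>2 * (a * (a * \<alpha>1 + b * \<beta>1))) / \<delta>"
      by (simp add: y f1 f2 diff_divide_distrib)
    also have "\<dots> = a * b * \<delta> / \<delta>"
      unfolding \<delta>_def by (rule arg_cong2[where f = divide]) (simp_all add: algebra_simps)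
    finally show "mpoly_eval (lform l * lform m) y = mpoly_eval (?sc (\<alpha>1 / \<delta>) f2 - ?sc (\<alpha>2 / \<delta>) f1) y"
      using \<delta> by (simp add: y lform_eval l m lfunD)
  qed
  have "vanishing_ideal {pt q} \<subseteq> ?J"
  proof
    fix f assume f: "f \<in> vanishing_ideal {pt q}"
    obtain K where K: "\<And>y. y \<in> ?L \<Longrightarrow> mpoly_eval f y = l y * mpoly_eval K y"
    proof (rule div_linear_on[OF subspace_line pL l(1,3), of f])
      fix y assume y: "y \<in> ?L" "l y = 0"
      then obtain a b where ab: "y = a *s p + b *s q" by blast
      then have "a = 0" using y(2) l by (simp add: lfunD)
      then have "y = b *s q" using ab by simp
      then show "mpoly_eval f y = 0" using f by (simp add: mem_vanishing_ideal_pt[OF inf q(1)])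
    qed blast
    have "g * f \<in> ?I" if g: "homogeneous 1 g" for g
    proof (rule memI)
      let ?r = "(?sc (mpoly_eval g p) ((lform l)\<^sup>2) + ?sc (mpoly_eval g q) (lform l * lform m)) * K"
      show "?r \<in> ?I"
        by (intro is_idealD(4)[OF is_ideal_gen] is_idealD(2)[OF is_ideal_gen]
            is_idealD(3)[OF is_ideal_gen] ll lm)
      fix y assume yL: "y \<in> ?L"
      then obtain a b where y: "y = a *s p + b *s q" by blast
      have "mpoly_eval g y = a * mpoly_eval g p + b * mpoly_eval g q"
        by (simp add: y lfunD[OF homogeneous_1_lfun[OF g]])
      moreover have "l y = a" "m y = b" by (simp_all add: y l m lfunD)
      ultimately show "mpoly_eval (g * f) y = mpoly_eval ?r y"
        by (simp add: K[OF yL] lform_eval l m power2_eq_square algebra_simps)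
    qed
    then show "f \<in> ?J" unfolding J saturation_def by blast
  qed
  moreover assume "scheme_length ?J \<ge> 2"
  then obtain c0 c1 c2 where c: "closed_subscheme c1" "?J \<subseteq> c0" "c0 \<subset> c1" "c1 \<subset> c2"
    by (rule scheme_length_ge_2D) blast
  ultimately have "vanishing_ideal {pt q} \<subset> c1" by blast
  then have "c1 = UNIV" by (rule vanishing_ideal_pt_maximal[OF inf q(1) c(1)])
  then show False using c by blast
qed


section \<open>Cones\<close>

text \<open>The union of the lines is already the linear cone over \<open>W\<close> with vertex \<open>U\<close>, so it only remains to
  know that this cone is closed.\<close>

lemma embedded_join_eq:
  fixes U V :: "('k::field ^ 'n::finite) set"
  assumes U: "vec.subspace U" and V: "vec.subspace V"
    and UV: "U \<inter> V = {0}" "\<And>v. \<exists>u\<in>U. \<exists>w\<in>V. v = u + w"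
    and W: "W \<noteq> {}" "W \<subseteq> projectivization V" and Z: "zclosed Z"
    and mem: "\<And>u w. u \<in> U \<Longrightarrow> w \<in> V \<Longrightarrow> u + w \<noteq> 0 \<Longrightarrow> pt (u + w) \<in> Z \<longleftrightarrow> w = 0 \<or> pt w \<in> W"
  shows "embedded_join (projectivization U) W = Z"
proof (cases "projectivization U = {}")
  case True
  have U0: "u = 0" if "u \<in> U" for u
    using True that pt_in_projectivization[OF U] by (metis empty_iff)
  have "W = Z"
  proof (rule proj_set_eqI)
    fix v :: "'k ^ 'n" assume v: "v \<noteq> 0"
    obtain u w where "u \<in> U" "w \<in> V" "v = u + w" using UV(2) by blast
    moreover from this have "u = 0" using U0 by blast
    ultimately have "v \<in> V" by simp
    then show "pt v \<in> W \<longleftrightarrow> pt v \<in> Z"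
      using mem[of 0 v] vec.subspace_0[OF U] v by simp
  qed
  then show ?thesis using True by (simp add: embedded_join_def)
next
  case False
  let ?L = "\<Union>{lin_span {y, z} | y z. y \<in> projectivization U \<and> z \<in> W \<and> y \<noteq> z}"
  have WV: "w \<in> V" if "w \<noteq> 0" "pt w \<in> W" for w
  proof -
    have "pt w \<in> projectivization V" using that W(2) by blast
    then show ?thesis using pt_in_projectivization[OF V that(1)] by simp
  qed
  have ne: "pt u \<noteq> pt w" if uw: "u \<in> U" "w \<in> V" "u \<noteq> 0" "w \<noteq> 0" for u w
  proof
    assume "pt u = pt w"
    then obtain c where "w = c *s u" using uw pt_eq_iff[of u w] by auto
    then have "w \<in> U" using uw U by (simp add: vec.subspace_scale)
    then show False using uw UV(1) by blast
  qed
  have "?L = Z"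
  proof (rule proj_set_eqI)
    fix v :: "'k ^ 'n" assume v: "v \<noteq> 0"
    show "pt v \<in> ?L \<longleftrightarrow> pt v \<in> Z"
    proof
      assume "pt v \<in> ?L"
      then obtain y z where yz: "y \<in> projectivization U" "z \<in> W" "pt v \<in> lin_span {y, z}" by blast
      obtain u where u: "u \<noteq> 0" "y = pt u" by (rule proj_cases[of y])
      obtain w where w: "w \<noteq> 0" "z = pt w" by (rule proj_cases[of z])
      have uU: "u \<in> U" using yz(1) u pt_in_projectivization[OF U] by simp
      have wV: "w \<in> V" using yz(2) w WV by simp
      have "pt v \<in> projectivization {a *s u + b *s w | a b. True}"
        using yz(3) unfolding u(2) w(2) lin_span_pair[OF u(1) w(1)] .
      then have "v \<in> {a *s u + b *s w | a b. True}"
        using pt_in_projectivization[OF subspace_line v] by blast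
      then obtain a b where vab: "v = a *s u + b *s w" by blast
      have "b *s w = 0 \<or> pt (b *s w) \<in> W"
        using w yz(2) by (cases "b = 0") (auto simp: pt_scale)
      then show "pt v \<in> Z"
        using mem[of "a *s u" "b *s w"] v uU wV U V by (simp add: vab vec.subspace_scale)
    next
      assume vZ: "pt v \<in> Z"
      obtain u w where uw: "u \<in> U" "w \<in> V" "v = u + w" using UV(2) by blast
      obtain y where y: "y \<in> projectivization U" using False by blast
      obtain u0 where "u0 \<noteq> 0" "y = pt u0" by (rule proj_cases[of y])
      then have u0: "u0 \<noteq> 0" "u0 \<in> U" using y pt_in_projectivization[OF U] by auto
      obtain z where z: "z \<in> W" using W(1) by blast
      obtain w0 where "w0 \<noteq> 0" "z = pt w0" by (rule proj_cases[of z])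
      then have w0: "w0 \<noteq> 0" "pt w0 \<in> W" using z by auto
      \<comment> \<open>a point of the vertex or of the base lies on a line to an arbitrary point of the other\<close>
      define u1 where "u1 = (if u = 0 then u0 else u)"
      define w1 where "w1 = (if w = 0 then w0 else w)"
      have u1: "u1 \<noteq> 0" "u1 \<in> U" using u0 uw by (auto simp: u1_def)
      have "w = 0 \<or> pt w \<in> W" using mem uw v vZ by blast
      then have w1: "w1 \<noteq> 0" "pt w1 \<in> W" using w0 by (auto simp: w1_def)
      have "v = (if u = 0 then 0 else 1) *s u1 + (if w = 0 then 0 else 1) *s w1"
        using uw(3) by (auto simp: u1_def w1_def)
      then have "pt v \<in> lin_span {pt u1, pt w1}"
        using pt_in_line[OF u1(1) w1(1)] v by metis
      moreover have "pt u1 \<in> projectivization U" using u1 by (simp add: pt_in_projectivization[OF U])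
      moreover have "pt u1 \<noteq> pt w1" using ne u1 w1 WV by blast
      ultimately show "pt v \<in> ?L" using w1(2) by blast
    qed
  qed
  moreover have "zclosure Z = Z" using Z unfolding zclosure_def by blast
  ultimately show ?thesis using False by (simp add: embedded_join_def)
qed


section \<open>Matrices of linear forms with two rows\<close>

lemma subspace_zeros: "(\<And>c. lfun (f c)) \<Longrightarrow> vec.subspace {v. \<forall>c. f c v = 0}"
  by (auto simp: vec.subspace_def lfunD)

lemma rank_one:
  fixes a b :: "'c \<Rightarrow> 'k::field"
  assumes m: "\<And>c d. a c * b d = a d * b c"
  obtains s t w where "(s, t) \<noteq> (0, 0)" "\<And>c. a c = s * w c" "\<And>c. b c = t * w c"
proof (cases "\<forall>c. a c = 0 \<and> b c = 0")
  case True
  then show ?thesis by (intro that[of 1 0 "\<lambda>_. 0"]) auto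
next
  case False
  then obtain c where c: "a c \<noteq> 0 \<or> b c \<noteq> 0" by blast
  show ?thesis
  proof (rule that[of "a c" "b c" "\<lambda>d. if a c = 0 then b d / b c else a d / a c"])
    show "(a c, b c) \<noteq> (0, 0)" using c by auto
    show "a d = a c * (if a c = 0 then b d / b c else a d / a c)" for d
      using c m[of c d] by auto
    show "b d = b c * (if a c = 0 then b d / b c else a d / a c)" for d
      using c m[of c d] by (auto simp: field_simps)
  qed
qed

text \<open>The matrix of a vector \<open>v\<close> has the columns \<open>(\<alpha> c v, \<beta> c v)\<close>. The set \<open>X\<close> is the locus of rank at most one, a
  cone with vertex \<open>U\<close>, and \<open>V\<close> is a complement of \<open>U\<close>. The assumption \<open>tangent\<close> says that the
  differentials of the minors cut out the Zariski tangent spaces of \<open>X\<close>; it replaces the fact that the minors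
  generate the ideal of \<open>X\<close>.\<close>

locale pencil =
  fixes \<alpha> \<beta> :: "'c \<Rightarrow> 'k::alg_closed_field ^ 'n::finite \<Rightarrow> 'k"
    and U V :: "('k ^ 'n) set" and X :: "('k, 'n) proj set"
  assumes lin_\<alpha>: "lfun (\<alpha> c)" and lin_\<beta>: "lfun (\<beta> c)"
    and U_eq: "U = {v. \<forall>c. \<alpha> c v = 0 \<and> \<beta> c v = 0}"
    and V: "vec.subspace V" and UV: "U \<inter> V = {0}" and UV_sum: "\<exists>u\<in>U. \<exists>w\<in>V. v = u + w"
    and X_nonempty: "X \<noteq> {}"
    and X_iff: "v \<noteq> 0 \<Longrightarrow> pt v \<in> X \<longleftrightarrow> (\<forall>c d. \<alpha> c v * \<beta> d v = \<alpha> d v * \<beta> c v)"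
    and tangent: "\<lbrakk>\<forall>c d. \<alpha> c q * \<beta> d q = \<alpha> d q * \<beta> c q;
      \<forall>c d. \<alpha> c q * \<beta> d p + \<alpha> c p * \<beta> d q - \<alpha> d q * \<beta> c p - \<alpha> d p * \<beta> c q = 0;
      f \<in> vanishing_ideal X\<rbrakk> \<Longrightarrow> dderiv f q p = 0"
begin

lemmas lin_simps = lfunD[OF lin_\<alpha>] lfunD[OF lin_\<beta>]

definition minor :: "'c \<Rightarrow> 'c \<Rightarrow> 'k ^ 'n \<Rightarrow> 'k"
  where "minor c d v = \<alpha> c v * \<beta> d v - \<alpha> d v * \<beta> c v"

definition polar :: "'c \<Rightarrow> 'c \<Rightarrow> 'k ^ 'n \<Rightarrow> 'k ^ 'n \<Rightarrow> 'k"
  where "polar c d v w = \<alpha> c v * \<beta> d w + \<alpha> c w * \<beta> d v - \<alpha> d v * \<beta> c w - \<alpha> d w * \<beta> c v"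

abbreviation minor_form :: "'c \<Rightarrow> 'c \<Rightarrow> ('k, 'n) mpoly"
  where "minor_form c d \<equiv> det_form (\<alpha> c) (\<alpha> d) (\<beta> c) (\<beta> d)"

lemma inf: "infinite (UNIV :: 'k set)" by (rule infinite_alg_closed)

lemma eval_minor_form: "mpoly_eval (minor_form c d) v = minor c d v"
  by (simp add: det_form_def minor_def lform_eval lin_\<alpha> lin_\<beta>)

lemma dderiv_minor_form: "dderiv (minor_form c d) v w = polar c d v w"
  by (simp add: det_form_def polar_def dderiv_hom dderiv_lform lform_eval lin_\<alpha> lin_\<beta>)

lemma homogeneous_minor_form: "homogeneous 2 (minor_form c d)"
  using homogeneous_mult[OF homogeneous_lform homogeneous_lform]
  by (auto simp: det_form_def one_add_one[symmetric] simp del: one_add_one intro!: homogeneous_diff)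

lemma minor_combine: "minor c d (a *s v + b *s w) = a\<^sup>2 * minor c d v + a * b * polar c d v w + b\<^sup>2 * minor c d w"
  by (simp add: minor_def polar_def lin_simps power2_eq_square algebra_simps)

lemma polar_sym: "polar c d v w = polar c d w v"
  by (simp add: polar_def algebra_simps)

lemma X_iff_minor: "v \<noteq> 0 \<Longrightarrow> pt v \<in> X \<longleftrightarrow> (\<forall>c d. minor c d v = 0)"
  by (simp add: X_iff minor_def)

lemma tangent_minor:
  "\<forall>c d. minor c d q = 0 \<Longrightarrow> \<forall>c d. polar c d q p = 0 \<Longrightarrow> f \<in> vanishing_ideal X \<Longrightarrow> dderiv f q p = 0"
  by (rule tangent) (simp_all add: minor_def polar_def)

lemma minor_form_vanishing: "minor_form c d \<in> vanishing_ideal X"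
  by (simp add: vanishing_ideal_iff[OF inf] eval_minor_form X_iff_minor)

lemma X_eq_zeros: "X = zeros (range (\<lambda>(c, d). minor_form c d))"
proof (rule proj_set_eqI)
  fix v :: "'k ^ 'n" assume v: "v \<noteq> 0"
  have "minor c d (t *s v) = t\<^sup>2 * minor c d v" for c d t
    using minor_combine[of c d t v 0 0] by simp
  then have "pt v \<in> zeros (range (\<lambda>(c, d). minor_form c d)) \<longleftrightarrow>
      (\<forall>c d. \<forall>t. t\<^sup>2 * minor c d v = 0)"
    by (simp add: zeros_def rep_pt[OF v] eval_minor_form)
  also have "\<dots> \<longleftrightarrow> (\<forall>c d. minor c d v = 0)" by (metis mult_1 mult_zero_right one_power2)
  finally show "pt v \<in> X \<longleftrightarrow> pt v \<in> zeros (range (\<lambda>(c, d). minor_form c d))"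
    by (simp add: X_iff_minor[OF v])
qed

lemma vanishing_eval:
  assumes "f \<in> vanishing_ideal X" "\<forall>c d. minor c d v = 0" shows "mpoly_eval f v = 0"
  using assms vanishing_ideal_eval_0[OF assms(1) X_nonempty]
  by (cases "v = 0") (simp_all add: vanishing_ideal_iff[OF inf] X_iff_minor)

lemma subspace_U: "vec.subspace U"
proof -
  have "vec.subspace ({v. \<forall>c. \<alpha> c v = 0} \<inter> {v. \<forall>c. \<beta> c v = 0})"
    by (intro vec.subspace_inter subspace_zeros lin_\<alpha> lin_\<beta>)
  also have "\<dots> = U" by (auto simp: U_eq)
  finally show ?thesis .
qed

end


section \<open>The linear space of the secant cone\<close>

locale pencil_point = pencil +
  fixes p :: "'b ^ 'c" and j k :: 'a
  assumes p_minor: "minor j k p \<noteq> 0"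
begin

definition \<Delta> where "\<Delta> = minor j k p"

lemma \<Delta>: "\<Delta> \<noteq> 0" using p_minor by (simp add: \<Delta>_def)

lemma p0: "p \<noteq> 0" using p_minor by (auto simp: minor_def lin_simps)

text \<open>The coefficients that express the column \<open>c\<close> of the matrix of \<open>p\<close> by the columns \<open>j\<close> and \<open>k\<close>.\<close>

definition \<gamma> where "\<gamma> c = minor c k p / \<Delta>"
definition \<delta> where "\<delta> c = minor j c p / \<Delta>"

text \<open>The vectors whose matrix has both rows in the row space of the matrix of \<open>p\<close>.\<close>

definition S :: "('b ^ 'c) set"
  where "S = {v. \<forall>c. \<alpha> c v = \<gamma> c * \<alpha> j v + \<delta> c * \<alpha> k v \<and> \<beta> c v = \<gamma> c * \<beta> j v + \<delta> c * \<beta> k v}"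

lemma coeffs: "\<gamma> j = 1" "\<delta> j = 0" "\<gamma> k = 0" "\<delta> k = 1"
  using \<Delta> by (auto simp: \<gamma>_def \<delta>_def \<Delta>_def minor_def)

lemma p_S: "p \<in> S"
proof -
  have "\<Delta> * \<alpha> c p = minor c k p * \<alpha> j p + minor j c p * \<alpha> k p"
    "\<Delta> * \<beta> c p = minor c k p * \<beta> j p + minor j c p * \<beta> k p" for c
    by (simp_all add: \<Delta>_def minor_def algebra_simps)
  note e = this
  have "\<gamma> c * \<alpha> j p + \<delta> c * \<alpha> k p = (minor c k p * \<alpha> j p + minor j c p * \<alpha> k p) / \<Delta>"
    "\<gamma> c * \<beta> j p + \<delta> c * \<beta> k p = (minor c k p * \<beta> j p + minor j c p * \<beta> k p) / \<Delta>" for c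
    by (simp_all add: \<gamma>_def \<delta>_def add_divide_distrib)
  then show ?thesis unfolding S_def using \<Delta> by (simp add: e[symmetric])
qed

lemma subspace_S: "vec.subspace S"
proof -
  have "lfun (\<lambda>v. \<alpha> c v - (\<gamma> c * \<alpha> j v + \<delta> c * \<alpha> k v))"
    "lfun (\<lambda>v. \<beta> c v - (\<gamma> c * \<beta> j v + \<delta> c * \<beta> k v))" for c
    by (simp_all add: lfun_iff lin_simps algebra_simps)
  then have "vec.subspace ({v. \<forall>c. \<alpha> c v - (\<gamma> c * \<alpha> j v + \<delta> c * \<alpha> k v) = 0} \<inter>
      {v. \<forall>c. \<beta> c v - (\<gamma> c * \<beta> j v + \<delta> c * \<beta> k v) = 0})"
    by (intro vec.subspace_inter subspace_zeros)
  also have "\<dots> = S" by (auto simp only: S_def right_minus_eq)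
  finally show ?thesis .
qed

lemma U_S: "U \<subseteq> S"
  by (auto simp: U_eq S_def)

lemma polar_S:
  assumes "v \<in> S" "w \<in> S" shows "polar c d v w = (\<gamma> c * \<delta> d - \<gamma> d * \<delta> c) * polar j k v w"
proof -
  have v: "\<alpha> c v = \<gamma> c * \<alpha> j v + \<delta> c * \<alpha> k v" "\<beta> c v = \<gamma> c * \<beta> j v + \<delta> c * \<beta> k v" for c
    using assms(1) unfolding S_def by blast+
  have w: "\<alpha> c w = \<gamma> c * \<alpha> j w + \<delta> c * \<alpha> k w" "\<beta> c w = \<gamma> c * \<beta> j w + \<delta> c * \<beta> k w" for c
    using assms(2) unfolding S_def by blast+
  show ?thesis
    unfolding polar_def v[of c] v[of d] w[of c] w[of d] by (simp add: algebra_simps)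
qed

lemma minor_S:
  assumes "v \<in> S" shows "minor c d v = (\<gamma> c * \<delta> d - \<gamma> d * \<delta> c) * minor j k v"
proof -
  have v: "\<alpha> c v = \<gamma> c * \<alpha> j v + \<delta> c * \<alpha> k v" "\<beta> c v = \<gamma> c * \<beta> j v + \<delta> c * \<beta> k v" for c
    using assms(1) unfolding S_def by blast+
  show ?thesis
    unfolding minor_def v[of c] v[of d] by (simp add: algebra_simps)
qed

lemma minors_S: "v \<in> S \<Longrightarrow> (\<forall>c d. minor c d v = 0) \<longleftrightarrow> minor j k v = 0"
  using minor_S by (metis mult_zero_right)

lemma X_iff_S: "v \<in> S \<Longrightarrow> v \<noteq> 0 \<Longrightarrow> pt v \<in> X \<longleftrightarrow> minor j k v = 0"
  by (simp add: X_iff_minor minors_S)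

lemma tangent_S:
  assumes "q \<in> S" "minor j k q = 0" "polar j k q p = 0" "f \<in> vanishing_ideal X"
  shows "mpoly_eval f q = 0 \<and> dderiv f (t *s q) (t *s p) = 0"
proof
  show "mpoly_eval f q = 0" using assms minors_S vanishing_eval by blast
  have tS: "t *s q \<in> S" "t *s p \<in> S" using assms(1) p_S subspace_S by (auto simp: vec.subspace_scale)
  have "polar j k (t *s q) (t *s p) = t\<^sup>2 * polar j k q p"
    by (simp add: polar_def lin_simps power2_eq_square algebra_simps)
  then have pol0: "polar j k (t *s q) (t *s p) = 0" using assms(3) by simp
  have "\<forall>c d. polar c d (t *s q) (t *s p) = 0"
  proof (intro allI)
    fix c d show "polar c d (t *s q) (t *s p) = 0" by (subst polar_S[OF tS], subst pol0) simp
  qed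
  moreover have "minor j k (t *s q) = 0" using minor_combine[of j k t q 0 0] assms(2) by simp
  then have "\<forall>c d. minor c d (t *s q) = 0" using minors_S[OF tS(1)] by blast
  ultimately show "dderiv f (t *s q) (t *s p) = 0" using tangent_minor assms(4) by blast
qed

lemma p_not_multiple:
  assumes "minor j k q = 0" shows "p \<noteq> c *s q"
proof
  assume "p = c *s q"
  then have "minor j k p = 0" using minor_combine[of j k c q 0 0] assms by simp
  then show False using p_minor by simp
qed

abbreviation secant_length :: "('b, 'c) proj \<Rightarrow> enat"
  where "secant_length q \<equiv>
    scheme_length (scheme_inter (vanishing_ideal X) (vanishing_ideal (lin_span {pt p, q})))"

text \<open>On the line through \<open>p\<close> and \<open>q\<close> the form \<open>minor j k\<close> is a binary quadric with the root \<open>q\<close>. If its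
  other root is different, it is a second point of \<open>X\<close>; otherwise the line is tangent to \<open>X\<close>.\<close>

lemma secant_in_S:
  assumes q: "q \<noteq> 0" "q \<in> S" "minor j k q = 0" shows "secant_length (pt q) \<ge> 2"
proof (cases "polar j k q p = 0")
  case True
  show ?thesis
  proof (rule secant_length_tangent[OF inf q(1) p0])
    show "pt q \<in> X" using q X_iff_S by blast
    show "p \<noteq> c *s q" for c using p_not_multiple[OF q(3)] .
    show "dderiv f (t *s q) (t *s p) = 0" if "f \<in> vanishing_ideal X" for f t
      using tangent_S[OF q(2,3) True that] by blast
  qed
next
  case False
  define a where "a = polar j k q p"
  \<comment> \<open>the second root of the quadric\<close>
  define q' where "q' = a *s p + (- \<Delta>) *s q"
  have "minor j k q' = 0"
    unfolding q'_def minor_combine using q(3)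
    by (simp add: a_def \<Delta>_def polar_sym power2_eq_square)
  moreover have q'S: "q' \<in> S"
    using p_S q(2) subspace_S unfolding q'_def by (intro vec.subspace_add vec.subspace_scale) auto
  moreover have q'c: "q' \<noteq> c *s q" for c
  proof
    assume "q' = c *s q"
    then have "a *s p = (c + \<Delta>) *s q" by (simp add: q'_def vec.scale_left_distrib algebra_simps)
    then have "inverse a *s (a *s p) = (inverse a * (c + \<Delta>)) *s q" by (simp only: vec.scale_scale)
    moreover have "inverse a *s (a *s p) = p" using False by (simp add: a_def)
    ultimately have "p = (inverse a * (c + \<Delta>)) *s q" by (simp only:)
    then show False using p_not_multiple[OF q(3)] by blast
  qed
  moreover from this have "q' \<noteq> 0" by (metis vec.scale_zero_left)
  ultimately have "pt q' \<in> X" using X_iff_S by blast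
  moreover have "pt q \<in> X" using q X_iff_S by blast
  ultimately show ?thesis using secant_length_two_points[OF inf q(1) p0 _ q'_def q'c] by blast
qed

text \<open>Let \<open>w\<close> be the row of the matrix of \<open>q\<close>, which has rank at most one, and \<open>(s, t)\<close> its column. With \<open>A\<close> and \<open>B\<close> the
  rows of the matrix of \<open>p\<close> and \<open>z = t A - s B\<close>, the assumption says that \<open>z \<and> w\<close> is a multiple of \<open>A \<and> B\<close>.
  If the multiple is non-zero, taking the product with \<open>w\<close> gives \<open>w \<and> A \<and> B = 0\<close>; if it is
  zero, \<open>w\<close> is a multiple of \<open>z\<close>. In both cases \<open>w\<close> is a combination of \<open>A\<close> and \<open>B\<close>.\<close>

lemma proportional_in_S:
  assumes q: "\<forall>c d. minor c d q = 0"
    and dep: "\<And>c d. \<Delta> * polar c d p q = minor c d p * polar j k p q"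
  shows "q \<in> S"
proof -
  have "\<alpha> c q * \<beta> d q = \<alpha> d q * \<beta> c q" for c d using q by (simp add: minor_def)
  then obtain s t w where st: "(s, t) \<noteq> (0, 0)" and w: "\<And>c. \<alpha> c q = s * w c" "\<And>c. \<beta> c q = t * w c"
    by (rule rank_one[of "\<lambda>c. \<alpha> c q" "\<lambda>c. \<beta> c q"]) blast
  define \<pi> where "\<pi> = polar j k p q"
  define z where "z c = t * \<alpha> c p - s * \<beta> c p" for c
  have pol: "polar c d p q = z c * w d - z d * w c" for c d
    by (simp add: polar_def w z_def algebra_simps)
  have zS: "\<Delta> * z c = minor c k p * z j + minor j c p * z k" for c
    by (simp add: z_def \<Delta>_def minor_def algebra_simps)
  have "\<Delta> * w c = minor c k p * w j + minor j c p * w k" for c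
  proof (cases "\<pi> = 0")
    case False
    have "\<pi> * (minor c k p * w j + minor j c p * w k) =
        (minor c k p * \<pi>) * w j + (minor j c p * \<pi>) * w k" by (simp add: algebra_simps)
    also have "\<dots> = \<Delta> * (polar c k p q * w j + polar j c p q * w k)"
      unfolding \<pi>_def dep[symmetric] by (simp add: algebra_simps)
    also have "\<dots> = \<Delta> * (\<pi> * w c)" unfolding \<pi>_def pol by (simp add: algebra_simps)
    finally have "\<pi> * (minor c k p * w j + minor j c p * w k) = \<pi> * (\<Delta> * w c)"
      by (simp add: algebra_simps)
    then show ?thesis using False by simp
  next
    case True
    have zw: "z c * w d = z d * w c" for c d
    proof -
      have "\<Delta> * polar c d p q = 0" using dep True by (simp add: \<pi>_def)
      then show ?thesis using \<Delta> pol by simp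
    qed
    have "z j \<noteq> 0 \<or> z k \<noteq> 0"
    proof (rule ccontr)
      assume "\<not> ?thesis"
      then have "t * \<alpha> j p = s * \<beta> j p" "t * \<alpha> k p = s * \<beta> k p" by (auto simp: z_def)
      note e = this
      have "t * \<Delta> = (t * \<alpha> j p) * \<beta> k p - (t * \<alpha> k p) * \<beta> j p"
        "s * \<Delta> = \<alpha> j p * (s * \<beta> k p) - \<alpha> k p * (s * \<beta> j p)"
        by (simp_all add: \<Delta>_def minor_def algebra_simps)
      then have "t * \<Delta> = 0" unfolding e by (simp add: algebra_simps)
      moreover have "s * \<Delta> = 0"
        using \<open>s * \<Delta> = _\<close> unfolding e[symmetric] by (simp add: algebra_simps)
      ultimately show False using st \<Delta> by auto
    qed
    then obtain i where i: "z i \<noteq> 0" by blast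
    have "z i * (\<Delta> * w c) = (\<Delta> * z c) * w i" using zw[of i c] by (simp add: algebra_simps)
    also have "\<dots> = minor c k p * (z j * w i) + minor j c p * (z k * w i)"
      unfolding zS by (simp add: algebra_simps)
    also have "\<dots> = z i * (minor c k p * w j + minor j c p * w k)"
      unfolding zw[of j i] zw[of k i] by (simp add: algebra_simps)
    finally show ?thesis using i by simp
  qed
  note e = this
  have wS: "\<gamma> c * w j + \<delta> c * w k = w c" for c
  proof -
    have "\<gamma> c * w j + \<delta> c * w k = (minor c k p * w j + minor j c p * w k) / \<Delta>"
      by (simp add: \<gamma>_def \<delta>_def add_divide_distrib)
    then show ?thesis using \<Delta> by (simp add: e[symmetric])
  qed
  show ?thesis
    unfolding S_def
  proof (rule CollectI, rule allI)
    show "\<alpha> c q = \<gamma> c * \<alpha> j q + \<delta> c * \<alpha> k q \<and> \<beta> c q = \<gamma> c * \<beta> j q + \<delta> c * \<beta> k q" for c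
      unfolding w wS[of c, symmetric] by (simp add: algebra_simps)
  qed
qed

lemma secant_not_in_S:
  assumes q: "q \<noteq> 0" "\<forall>c d. minor c d q = 0" "q \<notin> S" shows "\<not> secant_length (pt q) \<ge> 2"
proof -
  obtain c d where cd: "\<Delta> * polar c d p q \<noteq> minor c d p * polar j k p q"
    using proportional_in_S[OF q(2)] q(3) by blast
  show ?thesis
  proof (rule secant_length_less[OF inf q(1) p0])
    show "p \<noteq> a *s q" for a using p_not_multiple q(2) by blast
    show "minor_form j k \<in> vanishing_ideal X" "minor_form c d \<in> vanishing_ideal X"
      by (rule minor_form_vanishing)+
    show "mpoly_eval (minor_form j k) (a *s p + b *s q) = a * (a * \<Delta> + b * polar j k p q)" for a b
      unfolding eval_minor_form minor_combine using q(2)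
      by (simp add: \<Delta>_def power2_eq_square algebra_simps)
    show "mpoly_eval (minor_form c d) (a *s p + b *s q) = a * (a * minor c d p + b * polar c d p q)" for a b
      unfolding eval_minor_form minor_combine using q(2)
      by (simp add: power2_eq_square algebra_simps)
    show "\<Delta> * polar c d p q \<noteq> minor c d p * polar j k p q" by (rule cd)
  qed
qed

lemma line_meets_quadric:
  obtains x where "minor j k (x *s p + v) = 0"
proof -
  have "degree [:minor j k v, polar j k p v, \<Delta>:] = 2" using \<Delta> by simp
  then obtain x where x: "poly [:minor j k v, polar j k p v, \<Delta>:] x = 0"
    using alg_closed_imp_poly_has_root by (metis zero_less_numeral)
  have "minor j k (x *s p + v) = poly [:minor j k v, polar j k p v, \<Delta>:] x"
    using minor_combine[of j k x p 1 v] by (simp add: \<Delta>_def power2_eq_square algebra_simps)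
  then show ?thesis using that x by simp
qed

text \<open>Every line through \<open>p\<close> in \<open>S\<close> meets the quadric. If the quadric is empty, \<open>S\<close> is therefore the point
  \<open>p\<close>, in accordance with the convention for the secant cone.\<close>

lemma secant_cone_eq: "secant_cone (pt p) X = projectivization S"
proof -
  define Q where "Q = {q \<in> X. secant_length q \<ge> 2}"
  have Q: "pt q \<in> Q \<longleftrightarrow> q \<in> S \<and> minor j k q = 0" if "q \<noteq> 0" for q
    unfolding Q_def using that secant_in_S[OF that] secant_not_in_S[OF that] X_iff_S X_iff_minor[OF that] by auto
  have cone: "secant_cone (pt p) X = (if Q = {} then {pt p} else (\<Union>q\<in>Q. lin_span {pt p, q}))"
    unfolding secant_cone_def Q_def Let_def ..
  have pp: "pt p \<in> projectivization S" using p_S p0 by (simp add: pt_in_projectivization[OF subspace_S])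
  show ?thesis
  proof
    have "lin_span {pt p, q} \<subseteq> projectivization S" if "q \<in> Q" for q
    proof -
      obtain v where v: "v \<noteq> 0" "q = pt v" by (rule proj_cases[of q])
      then have "v \<in> S" using Q that by blast
      then have "{a *s p + b *s v | a b. True} \<subseteq> S"
        using p_S subspace_S by (auto intro!: vec.subspace_add vec.subspace_scale)
      then show ?thesis
        unfolding v(2) lin_span_pair[OF p0 v(1)] by (rule projectivization_mono_iff[OF subspace_line subspace_S, THEN iffD2])
    qed
    then show "secant_cone (pt p) X \<subseteq> projectivization S" unfolding cone using pp by auto
    show "projectivization S \<subseteq> secant_cone (pt p) X"
    proof (rule proj_subsetI)
      fix v :: "'b ^ 'c" assume v: "v \<noteq> 0" "pt v \<in> projectivization S"
      then have vS: "v \<in> S" using pt_in_projectivization[OF subspace_S] by blast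
      show "pt v \<in> secant_cone (pt p) X"
      proof (cases "\<exists>c. v = c *s p")
        case True
        then have pv: "pt v = pt p" using v(1) p0 pt_scale by (metis vec.scale_zero_left)
        have "pt p \<in> lin_span {pt p, q}" for q
        proof -
          obtain w where w: "w \<noteq> 0" "q = pt w" by (rule proj_cases[of q])
          show ?thesis using pt_in_line[OF p0 w(1), of 1 0] p0 by (simp add: w(2))
        qed
        then show ?thesis unfolding cone pv by auto
      next
        case False
        obtain x where x: "minor j k (x *s p + v) = 0" by (rule line_meets_quadric)
        define q where "q = x *s p + v"
        have q0: "q \<noteq> 0"
        proof
          assume "q = 0"
          then have "v = (- x) *s p" by (simp add: q_def add_eq_0_iff)
          then show False using False by blast
        qed
        have "q \<in> S" unfolding q_def using p_S vS subspace_S by (intro vec.subspace_add vec.subspace_scale) auto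
        then have qQ: "pt q \<in> Q" using Q[OF q0] x by (simp add: q_def)
        have "v = (- x) *s p + 1 *s q" by (simp add: q_def)
        then have "pt v \<in> lin_span {pt p, pt q}" using pt_in_line[OF p0 q0] v(1) by metis
        then show ?thesis unfolding cone using qQ by auto
      qed
    qed
  qed
qed

lemma secant_locus_eq:
  "secant_locus (pt p) X = scheme_inter (vanishing_ideal X) (vanishing_ideal (projectivization S))"
  by (simp add: secant_locus_def secant_cone_eq)

text \<open>The line through \<open>y1\<close> and \<open>y2\<close> meets the quadric in these two points only.\<close>

lemma secant_locus_reduced:
  assumes y: "y1 \<in> S" "y2 \<in> S" "minor j k y1 = 0" "minor j k y2 = 0" "minor j k (y1 + y2) \<noteq> 0"
  shows "secant_locus (pt p) X = vanishing_ideal (X \<inter> projectivization S)"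
  unfolding secant_locus_eq
proof (rule scheme_inter_reduced[OF inf subspace_S p_S p0 minor_form_vanishing[of j k]])
  fix f assume f: "f \<in> vanishing_ideal (X \<inter> projectivization S)"
  have "mpoly_eval f v = 0" if v: "v \<in> S" "mpoly_eval (minor_form j k) v = 0" for v
  proof (cases "v = 0")
    case False
    then have "pt v \<in> X \<inter> projectivization S"
      using v by (simp add: X_iff_S eval_minor_form pt_in_projectivization[OF subspace_S])
    then show ?thesis using f False by (simp add: vanishing_ideal_iff[OF inf])
  next
    case True
    have "y1 \<noteq> 0" using y(4,5) by auto
    then have "pt y1 \<in> X \<inter> projectivization S"
      using y by (simp add: X_iff_S pt_in_projectivization[OF subspace_S])
    then show ?thesis using vanishing_ideal_eval_0[OF f] True by auto
  qed
  then show "\<exists>K. \<forall>y\<in>S. mpoly_eval f y = mpoly_eval (minor_form j k) y * mpoly_eval K y"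
    using div_det_on[OF subspace_S lin_\<alpha> lin_\<alpha> lin_\<beta> lin_\<beta> y(1,2), of j k j k f] y(3-5)
    unfolding eval_minor_form by metis
qed

text \<open>Here the quadric is a double hyperplane of \<open>S\<close>: every line through \<open>p\<close> in \<open>S\<close> meets it in a
  single point, which lies in \<open>E\<close>. So \<open>p\<close> is tangent to the scroll along \<open>E\<close>, and the whole ideal of the
  scroll vanishes doubly there.\<close>

lemma secant_locus_double:
  assumes E: "vec.subspace E" "E \<subseteq> S" and S: "\<And>y. y \<in> S \<Longrightarrow> \<exists>x\<in>E. \<exists>c. y = x + c *s p"
    and q: "\<And>x c. x \<in> E \<Longrightarrow> minor j k (x + c *s p) = c\<^sup>2 * \<Delta>"
  shows "secant_locus (pt p) X = double_hyperplane (projectivization S) (projectivization E)"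
proof -
  have "p \<notin> E" using q[of p 0] p_minor by auto
  then obtain l where l: "lfun l" "\<And>y. y \<in> E \<Longrightarrow> l y = 0" "l p = 1"
    using lfun_vanishing_on[OF E(1)] by metis
  have lE: "l (x + c *s p) = c" if "x \<in> E" for x c
    using l(2)[OF that] l(3) by (simp add: lfunD(1,2)[OF l(1)])
  have ker: "{y \<in> S. l y = 0} = E"
  proof (intro equalityI subsetI)
    fix y assume y: "y \<in> {y \<in> S. l y = 0}"
    then obtain x c where xc: "x \<in> E" "y = x + c *s p" using S by blast
    then have "c = 0" using lE[OF xc(1)] y by simp
    then show "y \<in> E" using xc by simp
  qed (use E(2) l(2) in auto)
  have "scheme_inter (vanishing_ideal X) (vanishing_ideal (projectivization S)) =
      double_hyperplane (projectivization S) (projectivization {y \<in> S. l y = 0})"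
  proof (rule scheme_inter_double_hyperplane[OF inf subspace_S p_S l(1,3) minor_form_vanishing[of j k] \<Delta>])
    fix y assume "y \<in> S"
    then obtain x c where xc: "x \<in> E" "y = x + c *s p" using S by blast
    then show "mpoly_eval (minor_form j k) y = \<Delta> * (l y)\<^sup>2"
      by (simp only: eval_minor_form q lE mult.commute)
  next
    fix f y assume f: "f \<in> vanishing_ideal X" and "y \<in> S" "l y = 0"
    then have y: "y \<in> S" "y \<in> E" using ker by blast+
    have "minor j k y = 0" "minor j k (1 *s y + 1 *s p) = \<Delta>" using q[OF y(2), of 0] q[OF y(2), of 1] by simp_all
    then have y0: "minor j k y = 0" "polar j k y p = 0" unfolding minor_combine by (simp_all add: \<Delta>_def)
    then show "mpoly_eval f y = 0 \<and> dderiv f y p = 0" using tangent_S[OF y(1) y0 f, of 1] by simp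
  qed
  then show ?thesis unfolding secant_locus_eq ker .
qed

end


section \<open>Classification by the dimension of the secant cone\<close>

lemma zeros_Un: "zeros (F \<union> G) = zeros F \<inter> zeros G"
  by (auto simp: zeros_def ball_Un)

lemma subspace_le_vec_span:
  assumes "vec.subspace U" "projectivization U \<subseteq> A" shows "U \<subseteq> vec_span A"
  using vec_span_mono[OF assms(2)] by (simp add: vec_span_projectivization[OF assms(1)])

lemma subspace_insert:
  assumes "vec.subspace U" shows "vec.subspace {u + c *s y | u c. u \<in> U}"
proof -
  have "{u + c *s y | u c. u \<in> U} = {u + w | u w. u \<in> U \<and> w \<in> vec.span {y}}"
    by (auto simp: vec.span_singleton)
  then show ?thesis using vec.subspace_sums[OF assms vec.subspace_span] by simp
qed

lemma lin_span_insert: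
  assumes U: "vec.subspace U" and y: "y \<noteq> 0"
  shows "lin_span (projectivization U \<union> {pt y}) = projectivization {u + c *s y | u c. u \<in> U}"
proof (rule lin_span_eqI[OF subspace_insert[OF U]])
  fix v assume v: "v \<noteq> 0" "pt v \<in> projectivization U \<union> {pt y}"
  show "v \<in> {u + c *s y | u c. u \<in> U}"
  proof (cases "pt v = pt y")
    case True
    then obtain c where "v = 0 + c *s y" using v(1) y pt_eq_iff by (metis add_0)
    then show ?thesis using vec.subspace_0[OF U] by blast
  next
    case False
    then have "v \<in> U" using v by (simp add: pt_in_projectivization U)
    moreover have "v = v + 0 *s y" by simp
    ultimately show ?thesis by blast
  qed
next
  let ?A = "projectivization U \<union> {pt y}"
  have UA: "U \<subseteq> vec_span ?A" by (rule subspace_le_vec_span[OF U]) blast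
  have yA: "y \<in> vec_span ?A" using y by (intro vec_span_pt) auto
  show "{u + c *s y | u c. u \<in> U} \<subseteq> vec_span ?A"
  proof clarify
    fix u c assume "u \<in> U"
    then show "u + c *s y \<in> vec_span ?A"
      using UA by (intro vec.subspace_add[OF vec_span_subspace] vec.subspace_scale[OF vec_span_subspace] yA) blast
  qed
qed

lemma dim_1_multiple:
  fixes S :: "('k::field ^ 'n::finite) set"
  assumes "vec.subspace S" "vec.dim S = 1" "v \<in> S" "v \<noteq> 0" "w \<in> S"
  shows "\<exists>c. w = c *s v"
proof -
  have "vec.span {v} \<subseteq> S" using assms(1,3) by (intro vec.span_minimal) auto
  then have "vec.span {v} = S"
    using assms(1,2,4) by (intro vec.subspace_dim_equal) auto
  then show ?thesis using assms(5) by (auto simp: vec.span_singleton)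
qed

lemma dim_2_combination:
  fixes S :: "('k::field ^ 'n::finite) set"
  assumes "vec.subspace S" "vec.dim S = 2" "v \<in> S" "w \<in> S" "v \<noteq> 0" "\<And>c. w \<noteq> c *s v"
  shows "S = {a *s v + b *s w | a b. True}"
proof -
  have sub: "{a *s v + b *s w | a b. True} \<subseteq> S"
    unfolding span_pair[symmetric] using assms(1,3,4) by (intro vec.span_minimal) auto
  have "vec.dim {a *s v + b *s w | a b. True} = 2" by (rule dim_line[OF assms(5,6)])
  with assms(2) have "vec.dim S \<le> vec.dim {a *s v + b *s w | a b. True}" by simp
  from vec.subspace_dim_equal[OF subspace_line assms(1) sub this] show ?thesis by (rule sym)
qed

lemma linear_space_line:
  assumes "v \<noteq> 0" "\<And>c. w \<noteq> c *s v"
  shows "linear_space 1 (projectivization {a *s v + b *s w | a b. True})"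
  unfolding linear_space_def using subspace_line dim_line[OF assms]
  by (intro exI[of _ "{a *s v + b *s w | a b. True}"]) simp

lemma rank_one_factor:
  fixes g1 g2 g3 g4 :: "'k::field"
  assumes "g1 * g4 = g2 * g3"
  shows "\<exists>m1 m2 h1 h2. g1 = m1 * h1 \<and> g2 = m1 * h2 \<and> g3 = m2 * h1 \<and> g4 = m2 * h2"
proof (cases "g1 = 0 \<and> g2 = 0")
  case True
  then show ?thesis by (intro exI[of _ 0] exI[of _ 1] exI[of _ g3] exI[of _ g4]) auto
next
  case False
  define m where "m = (if g1 = 0 then g4 / g2 else g3 / g1)"
  have "g3 = m * g1" "g4 = m * g2"
    using False assms by (auto simp: m_def field_simps)
  then show ?thesis by (intro exI[of _ 1] exI[of _ m] exI[of _ g1] exI[of _ g2]) auto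
qed

lemma orthogonal_2:
  fixes m1 m2 :: "'k::field"
  assumes "m1 \<noteq> 0 \<or> m2 \<noteq> 0" "m1 * s + m2 * t = 0"
  shows "\<exists>\<rho>. s = - (\<rho> * m2) \<and> t = \<rho> * m1"
proof (cases "m1 = 0")
  case True
  then show ?thesis using assms by (intro exI[of _ "- s / m2"]) auto
next
  case False
  have "m1 * s = - (m2 * t)" using assms(2) by (simp add: eq_neg_iff_add_eq_0)
  then show ?thesis using False by (intro exI[of _ "t / m1"]) (simp add: field_simps)
qed

lemma lfun_4:
  fixes l :: "'k::field ^ 4 \<Rightarrow> 'k"
  assumes "lfun l"
  obtains g1 g2 g3 g4 where "\<And>x. l x = g1 * x $ 1 + g2 * x $ 2 + g3 * x $ 3 + g4 * x $ 4"
proof -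
  have e: "x = x $ 1 *s axis 1 1 + x $ 2 *s axis 2 1 + x $ 3 *s axis 3 1 + x $ 4 *s axis 4 1" for x :: "'k ^ 4"
    by (simp add: vec_eq_iff forall_4 axis_def)
  have "l x = l (axis 1 1) * x $ 1 + l (axis 2 1) * x $ 2 + l (axis 3 1) * x $ 3 + l (axis 4 1) * x $ 4" for x
  proof -
    have "l x = l (x $ 1 *s axis 1 1 + x $ 2 *s axis 2 1 + x $ 3 *s axis 3 1 + x $ 4 *s axis 4 1)"
      by (rule arg_cong[OF e])
    then show ?thesis by (simp only: lfunD[OF assms] mult.commute)
  qed
  then show ?thesis by (rule that)
qed

context pencil_point
begin

definition S0 where "S0 = S \<inter> V"

lemma subspace_S0: "vec.subspace S0"
  by (simp add: S0_def vec.subspace_inter subspace_S V)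

lemma S0_S: "v \<in> S0 \<Longrightarrow> v \<in> S" by (simp add: S0_def)

lemma U_S0: "U \<inter> S0 = {0}"
  using UV vec.subspace_0[OF subspace_S0] by (auto simp: S0_def)

lemma S_split:
  assumes "v \<in> S" obtains u w where "u \<in> U" "w \<in> S0" "v = u + w"
proof -
  obtain u w where uw: "u \<in> U" "w \<in> V" "v = u + w" using UV_sum by blast
  have "u \<in> S" using uw(1) U_S by blast
  with assms have "v - u \<in> S" by (rule vec.subspace_diff[OF subspace_S])
  then have "w \<in> S" by (simp add: uw(3))
  then show ?thesis using that uw by (simp add: S0_def)
qed

lemma S_eq_sum: "S = {u + w | u w. u \<in> U \<and> w \<in> S0}"
proof (intro equalityI subsetI)
  fix v assume "v \<in> S"
  then obtain u w where "u \<in> U" "w \<in> S0" "v = u + w" by (rule S_split)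
  then show "v \<in> {u + w | u w. u \<in> U \<and> w \<in> S0}" by blast
next
  fix v assume "v \<in> {u + w | u w. u \<in> U \<and> w \<in> S0}"
  then obtain u w where "u \<in> S" "w \<in> S" "v = u + w" using U_S S0_S by blast
  then show "v \<in> S" by (simp add: vec.subspace_add[OF subspace_S])
qed

lemma dim_S: "vec.dim S = vec.dim U + vec.dim S0"
  using vec.dim_sums_Int[OF subspace_U subspace_S0] unfolding U_S0 S_eq_sum[symmetric] by simp

lemma minor_U: "u \<in> U \<Longrightarrow> minor c d (u + w) = minor c d w"
  by (simp add: U_eq minor_def lin_simps)

lemma lin_span_S: "lin_span (projectivization U \<union> projectivization S0) = projectivization S"
proof (rule lin_span_eqI[OF subspace_S])
  fix v :: "'b ^ 'c" assume v: "v \<noteq> 0" "pt v \<in> projectivization U \<union> projectivization S0"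
  then have "v \<in> U \<or> v \<in> S0" by (simp add: pt_in_projectivization subspace_U subspace_S0)
  then show "v \<in> S" using U_S S0_S by blast
next
  let ?A = "projectivization U \<union> projectivization S0"
  show "S \<subseteq> vec_span ?A"
  proof
    fix v assume "v \<in> S"
    then obtain u w where uw: "u \<in> U" "w \<in> S0" "v = u + w" by (rule S_split)
    have "u \<in> vec_span ?A" "w \<in> vec_span ?A"
      using uw subspace_le_vec_span[OF subspace_U, of ?A] subspace_le_vec_span[OF subspace_S0, of ?A] by blast+
    then show "v \<in> vec_span ?A" unfolding uw(3) by (rule vec.subspace_add[OF vec_span_subspace])
  qed
qed

lemma zclosed_X_S: "zclosed (X \<inter> projectivization S)"
proof -
  let ?F = "range (\<lambda>(c, d). minor_form c d)"
  let ?G = "range (\<lambda>c. lform (\<lambda>v. \<alpha> c v - (\<gamma> c * \<alpha> j v + \<delta> c * \<alpha> k v))) \<union>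
      range (\<lambda>c. lform (\<lambda>v. \<beta> c v - (\<gamma> c * \<beta> j v + \<delta> c * \<beta> k v)))"
  have l: "lfun (\<lambda>v. \<alpha> c v - (\<gamma> c * \<alpha> j v + \<delta> c * \<alpha> k v))"
    "lfun (\<lambda>v. \<beta> c v - (\<gamma> c * \<beta> j v + \<delta> c * \<beta> k v))" for c
    by (simp_all add: lfun_iff lin_simps algebra_simps)
  have PS: "projectivization S = zeros ?G"
    unfolding projectivization_def zeros_def
    by (auto simp: lform_eval[OF l(1)] lform_eval[OF l(2)] subset_iff S_def ball_Un)
  have "X \<inter> projectivization S = zeros (?F \<union> ?G)"
    unfolding zeros_Un PS X_eq_zeros[symmetric] ..
  then show ?thesis unfolding zclosed_def by blast
qed

lemma join_S:
  assumes "X \<inter> projectivization S0 \<noteq> {}"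
  shows "embedded_join (projectivization U) (X \<inter> projectivization S0) = X \<inter> projectivization S"
proof (rule embedded_join_eq[OF subspace_U V UV UV_sum assms _ zclosed_X_S])
  have "projectivization S0 \<subseteq> projectivization V"
    by (rule projectivization_mono_iff[OF subspace_S0 V, THEN iffD2]) (simp add: S0_def)
  then show "X \<inter> projectivization S0 \<subseteq> projectivization V" by blast
  fix u w assume uw: "u \<in> U" "w \<in> V" "u + w \<noteq> 0"
  have mem: "u + w \<in> S \<longleftrightarrow> w \<in> S"
  proof
    have u: "u \<in> S" using uw(1) U_S by blast
    show "w \<in> S" if "u + w \<in> S" using vec.subspace_diff[OF subspace_S that u] by simp
    show "u + w \<in> S" if "w \<in> S" by (rule vec.subspace_add[OF subspace_S u that])
  qed
  show "pt (u + w) \<in> X \<inter> projectivization S \<longleftrightarrow> w = 0 \<or> pt w \<in> X \<inter> projectivization S0"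
  proof (cases "w = 0")
    case True
    then have "u \<noteq> 0" "u \<in> S" using uw U_S by auto
    moreover have "minor c d u = 0" for c d using uw(1) by (simp add: minor_def U_eq)
    ultimately show ?thesis using True by (simp add: X_iff_minor pt_in_projectivization[OF subspace_S])
  next
    case False
    then show ?thesis
      using uw mem unfolding S0_def
      by (simp add: X_iff_minor minor_U pt_in_projectivization subspace_S vec.subspace_inter V)
  qed
qed

text \<open>The four entries of the columns \<open>j\<close> and \<open>k\<close>, row by row. They determine a vector of \<open>S\<close> up to \<open>U\<close>.\<close>

definition N :: "'b ^ 'c \<Rightarrow> 'b ^ 4"
  where "N v = (\<chi> i. if i = 1 then \<alpha> j v else if i = 2 then \<alpha> k v else if i = 3 then \<beta> j v else \<beta> k v)"

lemma N_nth [simp]: "N v $ 1 = \<alpha> j v" "N v $ 2 = \<alpha> k v" "N v $ 3 = \<beta> j v" "N v $ 4 = \<beta> k v"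
  by (simp_all add: N_def)

lemma linear_N: "Vector_Spaces.linear (*s) (*s) N"
  by (auto simp: Vector_Spaces.linear_iff vec.vector_space_axioms N_def vec_eq_iff lin_simps)

lemma N_zero: assumes "v \<in> S0" "N v = 0" shows "v = 0"
proof -
  have z: "\<alpha> j v = 0" "\<alpha> k v = 0" "\<beta> j v = 0" "\<beta> k v = 0"
    using N_nth[of v] unfolding assms(2) by simp_all
  have e: "\<alpha> c v = \<gamma> c * \<alpha> j v + \<delta> c * \<alpha> k v" "\<beta> c v = \<gamma> c * \<beta> j v + \<delta> c * \<beta> k v" for c
    using S0_S[OF assms(1)] unfolding S_def by blast+
  have "\<alpha> c v = 0" "\<beta> c v = 0" for c
    unfolding e[of c] z by simp_all
  then have "v \<in> U" unfolding U_eq by simp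
  then show ?thesis using U_S0 assms(1) by blast
qed

lemma inj_N: "inj_on N S0"
proof (rule inj_onI)
  fix x y assume xy: "x \<in> S0" "y \<in> S0" "N x = N y"
  have "N (x - y) = N x - N y"
    using linear_N by (rule module_hom.diff[OF Vector_Spaces.linear.axioms(3)])
  then have "x - y = 0" using xy by (intro N_zero) (auto intro: vec.subspace_diff[OF subspace_S0])
  then show "x = y" by simp
qed

lemma dim_N: "vec.dim (N ` S0) = vec.dim S0"
  by (rule vec.dim_image_eq[OF linear_N]) (simp add: inj_N vec.span_eq_iff[THEN iffD2, OF subspace_S0])

lemma subspace_N: "vec.subspace (N ` S0)"
  by (rule module_hom.subspace_image[OF Vector_Spaces.linear.axioms(3)[OF linear_N] subspace_S0])

lemma dim_S0_le: "vec.dim S0 \<le> 4"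
  using dim_subset_UNIV_cart_gen[of "N ` S0"] by (simp add: dim_N)

lemma p_split: obtains u0 p' where "u0 \<in> U" "p' \<in> S0" "p = u0 + p'" "minor j k p' = \<Delta>" "p' \<noteq> 0"
proof -
  obtain u0 p' where up: "u0 \<in> U" "p' \<in> S0" "p = u0 + p'" by (rule S_split[OF p_S])
  have "minor j k p' = \<Delta>"
    using minor_U[OF up(1), of j k p'] unfolding up(3)[symmetric] \<Delta>_def by simp
  moreover from this have "p' \<noteq> 0" using \<Delta> by (auto simp: minor_def lin_simps)
  ultimately show ?thesis using that up by blast
qed

lemma dim_S0_pos: "vec.dim S0 \<ge> 1"
proof -
  obtain u0 p' where "p' \<in> S0" "p' \<noteq> 0" by (rule p_split)
  then have "\<not> S0 \<subseteq> {0}" by blast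
  then have "vec.dim S0 \<noteq> 0" by (simp only: vec.dim_eq_0 not_False_eq_True)
  then show ?thesis by linarith
qed

text \<open>In dimension at least two there is a line through \<open>p'\<close> in the projectivization of \<open>S0\<close>, and it meets
  the quadric, which does not contain \<open>p'\<close>.\<close>

lemma singular_vector:
  assumes "vec.dim S0 \<ge> 2" "p' \<in> S0" "minor j k p' = \<Delta>"
  obtains y where "y \<in> S0" "y \<noteq> 0" "minor j k y = 0"
proof -
  have "\<not> S0 \<subseteq> vec.span {p'}"
  proof
    assume "S0 \<subseteq> vec.span {p'}"
    then have "vec.dim S0 \<le> vec.dim {p'}" by (metis vec.dim_span vec.dim_subset)
    then show False using assms(1) by (auto split: if_splits)
  qed
  then obtain v where v: "v \<in> S0" "\<And>c. v \<noteq> c *s p'" by (auto simp: vec.span_singleton)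
  have "degree [:minor j k v, polar j k p' v, \<Delta>:] = 2" using \<Delta> by simp
  then obtain x where x: "poly [:minor j k v, polar j k p' v, \<Delta>:] x = 0"
    using alg_closed_imp_poly_has_root by (metis zero_less_numeral)
  have "minor j k (x *s p' + v) = poly [:minor j k v, polar j k p' v, \<Delta>:] x"
    using minor_combine[of j k x p' 1 v] by (simp add: assms(3) power2_eq_square algebra_simps)
  moreover have "x *s p' + v \<in> S0"
    using assms(2) v(1) subspace_S0 by (intro vec.subspace_add vec.subspace_scale) auto
  moreover have "x *s p' + v \<noteq> 0"
  proof
    assume "x *s p' + v = 0"
    then have "v = (- x) *s p'" by (simp add: add_eq_0_iff)
    then show False using v(2) by blast
  qed
  ultimately show ?thesis using that x by simp
qed

text \<open>The line through \<open>y\<close> and \<open>u\<close> is not tangent to the quadric at \<open>y\<close>, so it meets the quadric in a second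
  point.\<close>

lemma reduced_of_polar:
  assumes y: "y \<in> S" "minor j k y = 0" and u: "u \<in> S" "polar j k y u \<noteq> 0"
  shows "secant_locus (pt p) X = vanishing_ideal (X \<inter> projectivization S)"
proof (rule secant_locus_reduced)
  define s where "s = - minor j k u / polar j k y u"
  define y2 where "y2 = s *s y + 1 *s u"
  show "y \<in> S" "minor j k y = 0" by fact+
  show "y2 \<in> S" unfolding y2_def using y(1) u(1) subspace_S by (intro vec.subspace_add vec.subspace_scale) auto
  show y20: "minor j k y2 = 0" unfolding y2_def minor_combine using y(2) u(2) by (simp add: s_def)
  have "polar j k y y2 = s * (2 * minor j k y) + polar j k y u"
    by (simp add: y2_def polar_def minor_def lin_simps algebra_simps)
  then have "polar j k y y2 \<noteq> 0" using y(2) u(2) by simp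
  then show "minor j k (y + y2) \<noteq> 0"
    using minor_combine[of j k 1 y 1 y2] y(2) y20 by simp
qed

lemma X_S0_iff: "v \<noteq> 0 \<Longrightarrow> pt v \<in> X \<inter> projectivization S0 \<longleftrightarrow> v \<in> S0 \<and> minor j k v = 0"
  by (auto simp: pt_in_projectivization[OF subspace_S0] X_iff_S S0_S)

lemma smooth_of_polar:
  assumes "\<And>v. v \<in> S0 \<Longrightarrow> v \<noteq> 0 \<Longrightarrow> minor j k v = 0 \<Longrightarrow> \<exists>u\<in>S0. polar j k v u \<noteq> 0"
  shows "smooth_quadric (projectivization S0) (X \<inter> projectivization S0)"
  unfolding smooth_quadric_def
proof (intro exI[of _ "minor_form j k"] conjI ballI)
  show "homogeneous 2 (minor_form j k)" by (rule homogeneous_minor_form)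
  show "X \<inter> projectivization S0 = projectivization S0 \<inter> zeros {minor_form j k}"
  proof (rule proj_set_eqI)
    fix v :: "'b ^ 'c" assume v: "v \<noteq> 0"
    have "minor j k (t *s v) = t\<^sup>2 * minor j k v" for t
      using minor_combine[of j k t v 0 0] by simp
    then have "pt v \<in> zeros {minor_form j k} \<longleftrightarrow> (\<forall>t. t\<^sup>2 * minor j k v = 0)"
      by (simp add: zeros_def rep_pt[OF v] eval_minor_form)
    also have "\<dots> \<longleftrightarrow> minor j k v = 0" by (metis mult_1 mult_zero_right one_power2)
    finally show "pt v \<in> X \<inter> projectivization S0 \<longleftrightarrow> pt v \<in> projectivization S0 \<inter> zeros {minor_form j k}"
      unfolding X_S0_iff[OF v] by (simp add: pt_in_projectivization[OF subspace_S0 v])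
  qed
  fix x v assume x: "x \<in> X \<inter> projectivization S0" and v: "v \<in> rep_proj x - {0}"
  obtain w where w: "w \<noteq> 0" "x = pt w" "rep_proj x = range (\<lambda>c. c *s w)" by (rule proj_cases)
  obtain c where c: "v = c *s w" "c \<noteq> 0" using v w(3) by auto
  have "pt v = x" using c w by (simp add: pt_scale)
  then have "v \<in> S0 \<and> minor j k v = 0" using x v X_S0_iff[of v] by auto
  then obtain u where "u \<in> S0" "polar j k v u \<noteq> 0" using assms v by blast
  then show "\<exists>u\<in>vec_span (projectivization S0).
      (\<Sum>i\<in>UNIV. mpoly_eval (mpoly_deriv i (minor_form j k)) v * u $ i) \<noteq> 0"
    unfolding vec_span_projectivization[OF subspace_S0] dderiv_def[symmetric] dderiv_minor_form by blast
qed

lemma linear_space_S0: "linear_space (int (vec.dim S0) - 1) (projectivization S0)"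
  unfolding linear_space_def using subspace_S0 by auto

lemma linear_space_S: "linear_space (int (vec.dim U) - 1 + int (vec.dim S0)) (projectivization S)"
  unfolding linear_space_def using subspace_S dim_S by auto

lemma classification_1:
  assumes "vec.dim S0 = 1"
  shows "lin_span (projectivization U \<union> {pt p}) = projectivization S"
    and "secant_locus (pt p) X = double_hyperplane (projectivization S) (projectivization U)"
proof -
  obtain u0 p' where p': "u0 \<in> U" "p' \<in> S0" "p = u0 + p'" "minor j k p' = \<Delta>" "p' \<noteq> 0" by (rule p_split)
  have S: "\<exists>u\<in>U. \<exists>c. y = u + c *s p" if y: "y \<in> S" for y
  proof -
    obtain u w where uw: "u \<in> U" "w \<in> S0" "y = u + w" by (rule S_split[OF y])
    obtain c where c: "w = c *s p'" using dim_1_multiple[OF subspace_S0 assms p'(2,5) uw(2)] by blast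
    have "y = (u - c *s u0) + c *s p" using uw(3) c p'(3) by (simp add: vec.scale_right_distrib)
    moreover have "u - c *s u0 \<in> U" using uw(1) p'(1) subspace_U by (intro vec.subspace_diff vec.subspace_scale) auto
    ultimately show ?thesis by blast
  qed
  have eq: "S = {u + c *s p | u c. u \<in> U}"
  proof (intro equalityI subsetI)
    show "y \<in> {u + c *s p | u c. u \<in> U}" if "y \<in> S" for y using S[OF that] by blast
    fix y assume "y \<in> {u + c *s p | u c. u \<in> U}"
    then obtain u c where uc: "u \<in> U" "y = u + c *s p" by blast
    show "y \<in> S" unfolding uc(2)
      by (intro vec.subspace_add[OF subspace_S] vec.subspace_scale[OF subspace_S] p_S) (use uc(1) U_S in blast)
  qed
  show "lin_span (projectivization U \<union> {pt p}) = projectivization S"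
    unfolding lin_span_insert[OF subspace_U p0] eq[symmetric] ..
  show "secant_locus (pt p) X = double_hyperplane (projectivization S) (projectivization U)"
  proof (rule secant_locus_double[OF subspace_U U_S S])
    show "minor j k (u + c *s p) = c\<^sup>2 * \<Delta>" if "u \<in> U" for u c
      using minor_combine[of j k c p 0 0] by (simp add: minor_U[OF that] \<Delta>_def)
  qed
qed

lemma classification_2:
  assumes dim: "vec.dim S0 = 2"
  shows "(\<exists>z z'. z \<noteq> z' \<and> X \<inter> projectivization S0 = {z, z'} \<and>
      secant_locus (pt p) X = vanishing_ideal (X \<inter> projectivization S)) \<or>
    (\<exists>z\<in>projectivization S0. secant_locus (pt p) X =
      double_hyperplane (projectivization S) (lin_span (projectivization U \<union> {z})))"
proof -
  obtain u0 p' where p': "u0 \<in> U" "p' \<in> S0" "p = u0 + p'" "minor j k p' = \<Delta>" "p' \<noteq> 0" by (rule p_split)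
  have "vec.dim S0 \<ge> 2" using dim by simp
  then obtain y where y: "y \<in> S0" "y \<noteq> 0" "minor j k y = 0"
    by (rule singular_vector[OF _ p'(2,4)]) blast
  have p'y: "p' \<noteq> c *s y" for c
  proof
    assume "p' = c *s y"
    then have "minor j k p' = 0" using minor_combine[of j k c y 0 0] y(3) by simp
    then show False using p'(4) \<Delta> by simp
  qed
  have S0: "S0 = {a *s y + b *s p' | a b. True}"
    by (rule dim_2_combination[OF subspace_S0 dim y(1) p'(2) y(2) p'y])
  define b0 where "b0 = polar j k y p'"
  have mc: "minor j k (a *s y + b *s p') = b * (a * b0 + b * \<Delta>)" for a b
    unfolding minor_combine using y(3) p'(4) by (simp add: b0_def power2_eq_square algebra_simps)
  show ?thesis
  proof (cases "b0 = 0")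
    case False
    \<comment> \<open>the second root of the binary form of the quadric, the first one being the vector y\<close>
    define y2 where "y2 = (- \<Delta>) *s y + b0 *s p'"
    have y2c: "y2 \<noteq> c *s y" for c
    proof
      assume "y2 = c *s y"
      then have "b0 *s p' = (c + \<Delta>) *s y"
        by (simp add: y2_def vec.scale_left_distrib algebra_simps)
      then have "inverse b0 *s (b0 *s p') = (inverse b0 * (c + \<Delta>)) *s y" by (simp only: vec.scale_scale)
      moreover have "inverse b0 *s (b0 *s p') = p'" using False by simp
      ultimately have "p' = (inverse b0 * (c + \<Delta>)) *s y" by (simp only:)
      then show False using p'y by blast
    qed
    then have y20: "y2 \<noteq> 0" by (metis vec.scale_zero_left)
    have y2S: "y2 \<in> S0" unfolding S0 y2_def by blast
    have "X \<inter> projectivization S0 = {pt y, pt y2}"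
    proof (rule proj_set_eqI)
      fix v :: "'b ^ 'c" assume v: "v \<noteq> 0"
      show "pt v \<in> X \<inter> projectivization S0 \<longleftrightarrow> pt v \<in> {pt y, pt y2}"
      proof
        assume "pt v \<in> X \<inter> projectivization S0"
        then have vS: "v \<in> S0" "minor j k v = 0" using X_S0_iff[OF v] by blast+
        then obtain a b where ab: "v = a *s y + b *s p'" unfolding S0 by blast
        show "pt v \<in> {pt y, pt y2}"
        proof (cases "b = 0")
          case True
          then have "v = a *s y" "a \<noteq> 0" using ab v by auto
          then show ?thesis using y(2) by (simp add: pt_scale)
        next
          case b: False
          then have e: "a * b0 + b * \<Delta> = 0" using vS(2) mc[of a b] by (simp add: ab)
          then have "a * b0 = - (b * \<Delta>)" by (simp add: eq_neg_iff_add_eq_0)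
          then have "a = (b / b0) * (- \<Delta>)" using False by (simp add: field_simps)
          then have "v = (b / b0) *s y2" using False by (simp add: ab y2_def vec.scale_right_distrib)
          then show ?thesis using b False y20 by (simp add: pt_scale)
        qed
      next
        assume "pt v \<in> {pt y, pt y2}"
        moreover have "minor j k y2 = 0" unfolding y2_def mc by (simp add: algebra_simps)
        ultimately show "pt v \<in> X \<inter> projectivization S0"
          using X_S0_iff[OF y(2)] X_S0_iff[OF y20] y y2S by (elim insertE emptyE) simp_all
      qed
    qed
    moreover have "pt y \<noteq> pt y2" using y2c pt_eq_iff[OF y(2) y20] by blast
    moreover have "secant_locus (pt p) X = vanishing_ideal (X \<inter> projectivization S)"
      by (rule reduced_of_polar[OF S0_S[OF y(1)] y(3) S0_S[OF p'(2)]]) (use False in \<open>simp add: b0_def\<close>)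
    ultimately show ?thesis by blast
  next
    case True
    define E where "E = {u + a *s y | u a. u \<in> U}"
    have "secant_locus (pt p) X = double_hyperplane (projectivization S) (projectivization E)"
    proof (rule secant_locus_double)
      show "vec.subspace E" unfolding E_def by (rule subspace_insert[OF subspace_U])
      show "E \<subseteq> S"
      proof
        fix x assume "x \<in> E"
        then obtain u a where ua: "u \<in> U" "x = u + a *s y" unfolding E_def by blast
        show "x \<in> S" unfolding ua(2)
          by (intro vec.subspace_add[OF subspace_S] vec.subspace_scale[OF subspace_S] S0_S[OF y(1)])
            (use ua(1) U_S in blast)
      qed
      show "\<exists>z\<in>E. \<exists>c. x = z + c *s p" if x: "x \<in> S" for x
      proof -
        obtain u w where uw: "u \<in> U" "w \<in> S0" "x = u + w" by (rule S_split[OF x])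
        obtain a b where ab: "w = a *s y + b *s p'" using uw(2) unfolding S0 by blast
        have "x = ((u - b *s u0) + a *s y) + b *s p"
          using uw(3) ab p'(3) by (simp add: vec.scale_right_distrib algebra_simps)
        moreover have "u - b *s u0 \<in> U"
          using uw(1) p'(1) subspace_U by (intro vec.subspace_diff vec.subspace_scale) auto
        ultimately show ?thesis unfolding E_def by blast
      qed
      fix x c assume "x \<in> E"
      then obtain u a where ua: "u \<in> U" "x = u + a *s y" unfolding E_def by blast
      have e: "(u + a *s y) + c *s p = (u + c *s u0) + (a *s y + c *s p')"
        by (simp add: p'(3) vec.scale_right_distrib algebra_simps)
      have "u + c *s u0 \<in> U" using ua(1) p'(1) subspace_U by (intro vec.subspace_add vec.subspace_scale) auto
      then have "minor j k (x + c *s p) = minor j k (a *s y + c *s p')"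
        unfolding ua(2) e by (rule minor_U)
      then show "minor j k (x + c *s p) = c\<^sup>2 * \<Delta>" unfolding mc by (simp add: True power2_eq_square)
    qed
    then have "secant_locus (pt p) X =
      double_hyperplane (projectivization S) (lin_span (projectivization U \<union> {pt y}))"
      unfolding E_def lin_span_insert[OF subspace_U y(2)] .
    moreover have "pt y \<in> projectivization S0" using y by (simp add: pt_in_projectivization subspace_S0)
    ultimately show ?thesis by blast
  qed
qed

lemma polar_N: "polar j k v w = N v $ 4 * N w $ 1 - N v $ 3 * N w $ 2 - N v $ 2 * N w $ 3 + N v $ 1 * N w $ 4"
  by (simp add: polar_def algebra_simps)

lemma classification_4:
  assumes dim: "vec.dim S0 = 4"
  shows "X \<inter> projectivization S0 \<noteq> {}"
    and "smooth_quadric (projectivization S0) (X \<inter> projectivization S0)"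
    and "secant_locus (pt p) X = vanishing_ideal (X \<inter> projectivization S)"
proof -
  have "N ` S0 = UNIV"
    by (rule vec.subspace_dim_equal[OF subspace_N vec.subspace_UNIV subset_UNIV])
      (simp only: vec_dim_card dim_N dim, simp)
  then have "\<forall>x. x \<in> N ` S0" by simp
  then have surj: "\<exists>v\<in>S0. N v = x" for x by (metis imageE)
  have pol: "\<exists>u\<in>S0. polar j k v u \<noteq> 0" if v: "v \<in> S0" "v \<noteq> 0" for v
  proof -
    have "N v \<noteq> 0" using N_zero v by blast
    then have c: "N v $ 1 \<noteq> 0 \<or> N v $ 2 \<noteq> 0 \<or> N v $ 3 \<noteq> 0 \<or> N v $ 4 \<noteq> 0"
      by (simp add: vec_eq_iff forall_4)
    obtain u1 u2 u3 u4 where "u1 \<in> S0" "N u1 = axis 1 1" "u2 \<in> S0" "N u2 = axis 2 1"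
      "u3 \<in> S0" "N u3 = axis 3 1" "u4 \<in> S0" "N u4 = axis 4 1" using surj by metis
    note u = this
    have "polar j k v u1 = N v $ 4" "polar j k v u2 = - N v $ 3" "polar j k v u3 = - N v $ 2"
      "polar j k v u4 = N v $ 1"
      unfolding polar_N u by (simp_all add: axis_def)
    then show ?thesis using c u by (metis neg_equal_0_iff_equal)
  qed
  then show "smooth_quadric (projectivization S0) (X \<inter> projectivization S0)" by (rule smooth_of_polar) auto
  obtain u0 p' where p': "p' \<in> S0" "minor j k p' = \<Delta>" by (rule p_split)
  have "vec.dim S0 \<ge> 2" using dim by simp
  then obtain y where y: "y \<in> S0" "y \<noteq> 0" "minor j k y = 0"
    by (rule singular_vector[OF _ p']) blast
  then show "X \<inter> projectivization S0 \<noteq> {}" using X_S0_iff by blast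
  show "secant_locus (pt p) X = vanishing_ideal (X \<inter> projectivization S)"
    using reduced_of_polar pol y S0_S by blast
qed

lemma S0_eqI:
  assumes "v \<in> S0" "w \<in> S0" "\<alpha> j v = \<alpha> j w" "\<alpha> k v = \<alpha> k w" "\<beta> j v = \<beta> j w" "\<beta> k v = \<beta> k w"
  shows "v = w"
proof -
  have "N v = N w" using assms(3-6) by (simp add: N_def vec_eq_iff)
  then show ?thesis using inj_N assms(1,2) by (simp add: inj_on_eq_iff)
qed

text \<open>The image of the matrices is the hyperplane orthogonal to \<open>(g1, g2, g3, g4)\<close>. A point where
  the quadric is singular along the hyperplane is proportional to the adjugate of this matrix,
  which has rank two, while the matrix of a point of the quadric has rank one.\<close>

lemma classification_3_smooth:
  assumes g: "g1 * g4 \<noteq> g2 * g3"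
    and onto: "\<And>a b c d. g1 * a + g2 * b + g3 * c + g4 * d = 0 \<Longrightarrow>
      \<exists>v\<in>S0. \<alpha> j v = a \<and> \<alpha> k v = b \<and> \<beta> j v = c \<and> \<beta> k v = d"
    and v: "v \<in> S0" "v \<noteq> 0" "minor j k v = 0"
  shows "\<exists>u\<in>S0. polar j k v u \<noteq> 0"
proof (rule ccontr)
  assume "\<not> ?thesis"
  then have no: "polar j k v u = 0" if "u \<in> S0" for u using that by blast
  have P: "\<beta> k v * a - \<beta> j v * b - \<alpha> k v * c + \<alpha> j v * d = 0"
    if eq: "g1 * a + g2 * b + g3 * c + g4 * d = 0" for a b c d
  proof -
    obtain u where "u \<in> S0" "\<alpha> j u = a" "\<alpha> k u = b" "\<beta> j u = c" "\<beta> k u = d"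
      using onto[OF eq] by blast
    then show ?thesis using no[of u] by (auto simp: polar_def algebra_simps)
  qed
  have P12: "\<beta> k v * g2 + \<beta> j v * g1 = 0" using P[of g2 "- g1" 0 0] by (simp add: algebra_simps)
  have P13: "\<beta> k v * g3 + \<alpha> k v * g1 = 0" using P[of g3 0 "- g1" 0] by (simp add: algebra_simps)
  have P14: "\<beta> k v * g4 - \<alpha> j v * g1 = 0" using P[of g4 0 0 "- g1"] by (simp add: algebra_simps)
  have P23: "\<beta> j v * g3 - \<alpha> k v * g2 = 0" using P[of 0 "- g3" g2 0] by (simp add: algebra_simps)
  have P24: "\<beta> j v * g4 + \<alpha> j v * g2 = 0" using P[of 0 "- g4" 0 g2] by (simp add: algebra_simps)
  have P34: "\<alpha> k v * g4 + \<alpha> j v * g3 = 0" using P[of 0 0 "- g4" g3] by (simp add: algebra_simps)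
  have m: "\<alpha> j v * \<beta> k v - \<alpha> k v * \<beta> j v = 0" using v(3) by (simp add: minor_def)
  define d where "d = g1 * g4 - g2 * g3"
  have d: "d \<noteq> 0" using g by (simp add: d_def)
  have "d * (\<beta> k v * \<beta> k v) = 0" using P12 P13 P14 m unfolding d_def by algebra
  moreover have "d * (\<beta> j v * \<beta> j v) = 0" using P12 P23 P24 m unfolding d_def by algebra
  moreover have "d * (\<alpha> k v * \<alpha> k v) = 0" using P13 P23 P34 m unfolding d_def by algebra
  moreover have "d * (\<alpha> j v * \<alpha> j v) = 0" using P14 P24 P34 m unfolding d_def by algebra
  ultimately have z: "\<beta> k v = 0" "\<beta> j v = 0" "\<alpha> k v = 0" "\<alpha> j v = 0" using d by simp_all
  have "v = 0"
    by (rule S0_eqI[OF v(1) vec.subspace_0[OF subspace_S0]]) (simp_all add: z lin_simps)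
  then show False using v(2) by blast
qed

lemma X_S0_eqI:
  assumes M: "vec.subspace M1" "vec.subspace M2" "M1 \<subseteq> S0" "M2 \<subseteq> S0"
    and "\<And>v. v \<in> S0 \<Longrightarrow> minor j k v = 0 \<longleftrightarrow> v \<in> M1 \<or> v \<in> M2"
  shows "X \<inter> projectivization S0 = projectivization M1 \<union> projectivization M2"
proof (rule proj_set_eqI)
  fix v :: "'b ^ 'c" assume v: "v \<noteq> 0"
  show "pt v \<in> X \<inter> projectivization S0 \<longleftrightarrow> pt v \<in> projectivization M1 \<union> projectivization M2"
    unfolding X_S0_iff[OF v] Un_iff pt_in_projectivization[OF M(1) v] pt_in_projectivization[OF M(2) v]
    using M(3,4) assms(5) by blast
qed

text \<open>The two lines of a quadric of rank two: on the first one all matrices have the column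
  \<open>(s, t)\<close>, so it lies in a ruling; on the second one all matrices have the row \<open>\<omega>\<close>, and the column
  varies over all of the projective line.\<close>

definition crossing_lines :: bool
  where "crossing_lines \<longleftrightarrow> (\<exists>v1 v2 w1 w2 s t \<omega>. {v1, v2, w1, w2} \<subseteq> S0 \<and>
      v1 \<noteq> 0 \<and> (\<forall>c. v2 \<noteq> c *s v1) \<and> w1 \<noteq> 0 \<and> (\<forall>c. w2 \<noteq> c *s w1) \<and>
      X \<inter> projectivization S0 = projectivization {a *s v1 + b *s v2 | a b. True} \<union>
        projectivization {a *s w1 + b *s w2 | a b. True} \<and>
      {a *s v1 + b *s v2 | a b. True} \<noteq> {a *s w1 + b *s w2 | a b. True} \<and>
      (s, t) \<noteq> (0, 0) \<and> (\<forall>c. t * \<alpha> c v1 = s * \<beta> c v1 \<and> t * \<alpha> c v2 = s * \<beta> c v2) \<and>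
      (\<exists>c. \<omega> c \<noteq> 0) \<and> (\<forall>c. \<alpha> c w1 = \<omega> c \<and> \<beta> c w1 = 0 \<and> \<alpha> c w2 = 0 \<and> \<beta> c w2 = \<omega> c))"

text \<open>The hyperplane is orthogonal to the product of the column \<open>(m1, m2)\<close> and the row \<open>(h1, h2)\<close>. A
  matrix of rank one lies in it if and only if its column is orthogonal to the first or its row is
  orthogonal to the second.\<close>

lemma classification_3_lines:
  assumes mh: "m1 \<noteq> 0 \<or> m2 \<noteq> 0" "h1 \<noteq> 0 \<or> h2 \<noteq> 0"
    and on: "\<And>v. v \<in> S0 \<Longrightarrow>
      m1 * h1 * \<alpha> j v + m1 * h2 * \<alpha> k v + m2 * h1 * \<beta> j v + m2 * h2 * \<beta> k v = 0"
    and onto: "\<And>a b c d. m1 * h1 * a + m1 * h2 * b + m2 * h1 * c + m2 * h2 * d = 0 \<Longrightarrow>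
      \<exists>v\<in>S0. \<alpha> j v = a \<and> \<alpha> k v = b \<and> \<beta> j v = c \<and> \<beta> k v = d"
  shows "secant_locus (pt p) X = vanishing_ideal (X \<inter> projectivization S) \<and>
    crossing_lines"
proof -
  obtain v1 where v1: "v1 \<in> S0" "\<alpha> j v1 = - m2" "\<alpha> k v1 = 0" "\<beta> j v1 = m1" "\<beta> k v1 = 0"
    using onto[of "- m2" 0 m1 0] by (auto simp: algebra_simps)
  obtain v2 where v2: "v2 \<in> S0" "\<alpha> j v2 = 0" "\<alpha> k v2 = - m2" "\<beta> j v2 = 0" "\<beta> k v2 = m1"
    using onto[of 0 "- m2" 0 m1] by (auto simp: algebra_simps)
  obtain w1 where w1: "w1 \<in> S0" "\<alpha> j w1 = - h2" "\<alpha> k w1 = h1" "\<beta> j w1 = 0" "\<beta> k w1 = 0"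
    using onto[of "- h2" h1 0 0] by (auto simp: algebra_simps)
  obtain w2 where w2: "w2 \<in> S0" "\<alpha> j w2 = 0" "\<alpha> k w2 = 0" "\<beta> j w2 = - h2" "\<beta> k w2 = h1"
    using onto[of 0 0 "- h2" h1] by (auto simp: algebra_simps)
  let ?M1 = "{a *s v1 + b *s v2 | a b. True}" and ?M2 = "{a *s w1 + b *s w2 | a b. True}"
  have M1_S0: "a *s v1 + b *s v2 \<in> S0" and M2_S0: "a *s w1 + b *s w2 \<in> S0" for a b
    using v1(1) v2(1) w1(1) w2(1) subspace_S0 by (intro vec.subspace_add vec.subspace_scale; simp)+
  have f1: "\<alpha> j (a *s v1 + b *s v2) = - (m2 * a)" "\<alpha> k (a *s v1 + b *s v2) = - (m2 * b)"
    "\<beta> j (a *s v1 + b *s v2) = m1 * a" "\<beta> k (a *s v1 + b *s v2) = m1 * b" for a b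
    by (simp_all add: lin_simps v1 v2 mult.commute)
  have f2: "\<alpha> j (a *s w1 + b *s w2) = - (h2 * a)" "\<alpha> k (a *s w1 + b *s w2) = h1 * a"
    "\<beta> j (a *s w1 + b *s w2) = - (h2 * b)" "\<beta> k (a *s w1 + b *s w2) = h1 * b" for a b
    by (simp_all add: lin_simps w1 w2 mult.commute)
  define \<omega> where "\<omega> c = \<gamma> c * (- h2) + \<delta> c * h1" for c
  have S_eq: "\<alpha> c v = \<gamma> c * \<alpha> j v + \<delta> c * \<alpha> k v" "\<beta> c v = \<gamma> c * \<beta> j v + \<delta> c * \<beta> k v"
    if "v \<in> S0" for c v
    using S0_S[OF that] unfolding S_def by blast+
  have \<omega>: "\<alpha> c w1 = \<omega> c \<and> \<beta> c w1 = 0 \<and> \<alpha> c w2 = 0 \<and> \<beta> c w2 = \<omega> c" for c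
    unfolding S_eq[OF w1(1), of c] S_eq[OF w2(1), of c] w1 w2 \<omega>_def by simp
  have "\<omega> j = - h2" "\<omega> k = h1" by (simp_all add: \<omega>_def coeffs)
  then have \<omega>0: "\<exists>c. \<omega> c \<noteq> 0" using mh(2) by (metis neg_equal_0_iff_equal)
  have ruling: "m1 * \<alpha> c v1 = - m2 * \<beta> c v1 \<and> m1 * \<alpha> c v2 = - m2 * \<beta> c v2" for c
    unfolding S_eq[OF v1(1), of c] S_eq[OF v2(1), of c] v1 v2 by (simp add: algebra_simps)
  have v10: "v1 \<noteq> 0" using v1 mh(1) by (auto simp: lin_simps)
  have w10: "w1 \<noteq> 0" using w1 mh(2) by (auto simp: lin_simps)
  have v2c: "v2 \<noteq> c *s v1" for c
    using v1(3,5) v2(3,5) mh(1) by (auto simp: lin_simps)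
  have w2c: "w2 \<noteq> c *s w1" for c
    using w1(4,5) w2(4,5) mh(2) by (auto simp: lin_simps)
  have M: "minor j k v = 0 \<longleftrightarrow> v \<in> ?M1 \<or> v \<in> ?M2" if v: "v \<in> S0" for v
  proof
    assume "minor j k v = 0"
    then have "\<forall>c d. minor c d v = 0" using minors_S[OF S0_S[OF v]] by blast
    then have "\<alpha> c v * \<beta> d v = \<alpha> d v * \<beta> c v" for c d by (simp add: minor_def)
    then obtain s t w where w: "\<And>c. \<alpha> c v = s * w c" "\<And>c. \<beta> c v = t * w c"
      by (rule rank_one[of "\<lambda>c. \<alpha> c v" "\<lambda>c. \<beta> c v"]) blast
    have "(m1 * s + m2 * t) * (h1 * w j + h2 * w k) = 0"
      using on[OF v] unfolding w by (simp add: algebra_simps)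
    then consider "m1 * s + m2 * t = 0" | "h1 * w j + h2 * w k = 0" by auto
    then show "v \<in> ?M1 \<or> v \<in> ?M2"
    proof cases
      case 1
      obtain \<rho> where \<rho>: "s = - (\<rho> * m2)" "t = \<rho> * m1" using orthogonal_2[OF mh(1) 1] by blast
      have "v = (\<rho> * w j) *s v1 + (\<rho> * w k) *s v2"
        by (rule S0_eqI[OF v M1_S0]) (simp_all only: f1, simp_all add: w \<rho> algebra_simps)
      then show ?thesis by blast
    next
      case 2
      obtain \<rho> where \<rho>: "w j = - (\<rho> * h2)" "w k = \<rho> * h1" using orthogonal_2[OF mh(2) 2] by blast
      have "v = (\<rho> * s) *s w1 + (\<rho> * t) *s w2"
        by (rule S0_eqI[OF v M2_S0]) (simp_all only: f2, simp_all add: w \<rho> algebra_simps)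
      then show ?thesis by blast
    qed
  next
    assume "v \<in> ?M1 \<or> v \<in> ?M2"
    then consider a b where "v = a *s v1 + b *s v2" | a b where "v = a *s w1 + b *s w2" by blast
    then show "minor j k v = 0"
      by cases (simp_all only: minor_def f1 f2, simp_all add: algebra_simps)
  qed
  have XS0: "X \<inter> projectivization S0 = projectivization ?M1 \<union> projectivization ?M2"
    by (rule X_S0_eqI[OF subspace_line subspace_line _ _ M]) (use M1_S0 M2_S0 in blast)+
  obtain x y where xy: "h1 * x + h2 * y \<noteq> 0"
  proof (cases "h1 = 0")
    case True then show ?thesis using mh(2) by (intro that[of 0 1]) auto
  next
    case False then show ?thesis by (intro that[of 1 0]) auto
  qed
  obtain a b where ab: "m1 * a + m2 * b \<noteq> 0"
  proof (cases "m1 = 0")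
    case True then show ?thesis using mh(1) by (intro that[of 0 1]) auto
  next
    case False then show ?thesis by (intro that[of 1 0]) auto
  qed
  have pol: "polar j k (x *s v1 + y *s v2) (a' *s w1 + b' *s w2) = - ((m1 * a' + m2 * b') * (h1 * x + h2 * y))" for a' b'
    unfolding polar_def f1 f2 by (simp add: algebra_simps)
  have "secant_locus (pt p) X = vanishing_ideal (X \<inter> projectivization S)"
  proof (rule reduced_of_polar)
    show "x *s v1 + y *s v2 \<in> S" "a *s w1 + b *s w2 \<in> S" using M1_S0 M2_S0 S0_S by blast+
    show "minor j k (x *s v1 + y *s v2) = 0" using M[OF M1_S0] by blast
    show "polar j k (x *s v1 + y *s v2) (a *s w1 + b *s w2) \<noteq> 0" unfolding pol using ab xy by simp
  qed
  moreover have "?M1 \<noteq> ?M2"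
  proof
    assume "?M1 = ?M2"
    then have "x *s v1 + y *s v2 \<in> ?M2" by blast
    then obtain a' b' where "x *s v1 + y *s v2 = a' *s w1 + b' *s w2" by blast
    then have e: "- (m2 * x) = - (h2 * a')" "- (m2 * y) = h1 * a'" "m1 * x = - (h2 * b')" "m1 * y = h1 * b'"
      using f1[of x y] f2[of a' b'] by metis+
    have "m2 * (h1 * x + h2 * y) = - (h1 * (- (m2 * x))) - h2 * (- (m2 * y))" by (simp add: algebra_simps)
    also have "\<dots> = 0" unfolding e by (simp add: algebra_simps)
    finally have m2: "m2 = 0" using xy by simp
    have "m1 * (h1 * x + h2 * y) = h1 * (m1 * x) + h2 * (m1 * y)" by (simp add: algebra_simps)
    also have "\<dots> = 0" unfolding e by (simp add: algebra_simps)
    finally have "m1 = 0" using xy by simp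
    then show False using m2 mh(1) by blast
  qed
  ultimately have main: "secant_locus (pt p) X = vanishing_ideal (X \<inter> projectivization S)" "?M1 \<noteq> ?M2"
    by blast+
  have st: "(- m2, m1) \<noteq> (0, 0)" using mh(1) by auto
  have mem: "{v1, v2, w1, w2} \<subseteq> S0" using v1(1) v2(1) w1(1) w2(1) by blast
  have crossing_lines
    unfolding crossing_lines_def
    by (rule exI[of _ v1], rule exI[of _ v2], rule exI[of _ w1], rule exI[of _ w2], rule exI[of _ "- m2"],
        rule exI[of _ m1], rule exI[of _ \<omega>],
        intro conjI allI mem v10 v2c w10 w2c XS0 main(2) st \<omega>0 \<omega>[THEN conjunct1]
        \<omega>[THEN conjunct2, THEN conjunct1] \<omega>[THEN conjunct2, THEN conjunct2, THEN conjunct1]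
        \<omega>[THEN conjunct2, THEN conjunct2, THEN conjunct2] ruling[THEN conjunct1] ruling[THEN conjunct2])
  then show ?thesis using main(1) by (intro conjI)
qed

lemma classification_3:
  assumes dim: "vec.dim S0 = 3"
  shows "X \<inter> projectivization S0 \<noteq> {}"
    and "secant_locus (pt p) X = vanishing_ideal (X \<inter> projectivization S)"
    and "smooth_quadric (projectivization S0) (X \<inter> projectivization S0) \<or>
      crossing_lines"
    (is "?smooth \<or> _")
proof -
  have "N ` S0 \<noteq> UNIV"
  proof
    assume "N ` S0 = UNIV"
    then have "vec.dim (N ` S0) = 4" by (simp only: vec_dim_card) simp
    then show False using dim dim_N by simp
  qed
  then obtain e where "e \<notin> N ` S0" by blast
  then obtain l where l: "lfun l" "\<And>x. x \<in> N ` S0 \<Longrightarrow> l x = 0" "l e = 1"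
    using lfun_vanishing_on[OF subspace_N] by metis
  have "N ` S0 = {x \<in> UNIV. l x = 0}"
  proof (rule vec.subspace_dim_equal[OF subspace_N])
    show ker: "vec.subspace {x \<in> UNIV. l x = 0}" by (rule subspace_kernel[OF vec.subspace_UNIV l(1)])
    show "N ` S0 \<subseteq> {x \<in> UNIV. l x = 0}" using l(2) by blast
    have "vec.dim {x \<in> UNIV. l x = 0} \<noteq> 4"
    proof
      assume d: "vec.dim {x \<in> UNIV. l x = 0} = 4"
      have "{x \<in> UNIV. l x = 0} = UNIV"
        by (rule vec.subspace_dim_equal[OF ker vec.subspace_UNIV subset_UNIV])
          (simp only: vec_dim_card d, simp)
      then have "e \<in> {x \<in> UNIV. l x = 0}" by (simp only: UNIV_I)
      then have "l e = 0" by simp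
      then show False using l(3) by simp
    qed
    moreover have "vec.dim {x \<in> UNIV. l x = 0} \<le> 4"
      using dim_subset_UNIV_cart_gen[of "{x \<in> UNIV. l x = 0}"] by simp
    ultimately show "vec.dim {x \<in> UNIV. l x = 0} \<le> vec.dim (N ` S0)" using dim dim_N by linarith
  qed
  then have im: "N ` S0 = {x. l x = 0}" by simp
  obtain g1 g2 g3 g4 where g: "\<And>x. l x = g1 * x $ 1 + g2 * x $ 2 + g3 * x $ 3 + g4 * x $ 4"
    by (rule lfun_4[OF l(1)]) blast
  have on: "g1 * \<alpha> j v + g2 * \<alpha> k v + g3 * \<beta> j v + g4 * \<beta> k v = 0" if "v \<in> S0" for v
    using l(2)[of "N v"] that unfolding g by simp
  have onto: "\<exists>v\<in>S0. \<alpha> j v = a \<and> \<alpha> k v = b \<and> \<beta> j v = c \<and> \<beta> k v = d"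
    if "g1 * a + g2 * b + g3 * c + g4 * d = 0" for a b c d
  proof -
    define x :: "'b ^ 4" where "x = (\<chi> i. if i = 1 then a else if i = 2 then b else if i = 3 then c else d)"
    have x: "x $ 1 = a" "x $ 2 = b" "x $ 3 = c" "x $ 4 = d" by (simp_all add: x_def)
    then have "l x = 0" unfolding g using that by simp
    then have "x \<in> N ` S0" unfolding im by simp
    then obtain v where v: "v \<in> S0" "x = N v" by (rule imageE)
    have "\<alpha> j v = a \<and> \<alpha> k v = b \<and> \<beta> j v = c \<and> \<beta> k v = d"
      using N_nth[of v] unfolding v(2)[symmetric] x by simp
    then show ?thesis using v(1) by (rule rev_bexI[rotated])
  qed
  have g0: "g1 \<noteq> 0 \<or> g2 \<noteq> 0 \<or> g3 \<noteq> 0 \<or> g4 \<noteq> 0" using l(3) unfolding g by auto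
  obtain u0 p' where p': "p' \<in> S0" "minor j k p' = \<Delta>" by (rule p_split)
  have "vec.dim S0 \<ge> 2" using dim by simp
  then obtain y where y: "y \<in> S0" "y \<noteq> 0" "minor j k y = 0"
    by (rule singular_vector[OF _ p']) blast
  then show "X \<inter> projectivization S0 \<noteq> {}" using X_S0_iff by blast
  show "secant_locus (pt p) X = vanishing_ideal (X \<inter> projectivization S)" and "?smooth \<or> crossing_lines"
  proof -
    have "secant_locus (pt p) X = vanishing_ideal (X \<inter> projectivization S) \<and> (?smooth \<or> crossing_lines)"
    proof (cases "g1 * g4 = g2 * g3")
      case False
      have pol: "\<exists>u\<in>S0. polar j k v u \<noteq> 0" if v: "v \<in> S0" "v \<noteq> 0" "minor j k v = 0" for v
        by (rule classification_3_smooth[OF False _ v]) (rule onto)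
      obtain u where u: "u \<in> S0" "polar j k y u \<noteq> 0" using pol[OF y] by blast
      have "secant_locus (pt p) X = vanishing_ideal (X \<inter> projectivization S)"
        by (rule reduced_of_polar[OF S0_S[OF y(1)] y(3) S0_S[OF u(1)] u(2)])
      moreover have ?smooth by (rule smooth_of_polar) (rule pol)
      ultimately show ?thesis by (intro conjI disjI1)
    next
      case True
      then obtain m1 m2 h1 h2 where mh: "g1 = m1 * h1" "g2 = m1 * h2" "g3 = m2 * h1" "g4 = m2 * h2"
        using rank_one_factor[OF True] by metis
      have "m1 \<noteq> 0 \<or> m2 \<noteq> 0" "h1 \<noteq> 0 \<or> h2 \<noteq> 0" using g0 mh by auto
      then have "secant_locus (pt p) X = vanishing_ideal (X \<inter> projectivization S) \<and> crossing_lines"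
        by (rule classification_3_lines) (rule on[unfolded mh], assumption, rule onto[unfolded mh], assumption)
      then show ?thesis by (elim conjE) (intro conjI disjI2)
    qed
    then show "secant_locus (pt p) X = vanishing_ideal (X \<inter> projectivization S)" and "?smooth \<or> crossing_lines"
      by (rule conjunct1, rule conjunct2)
  qed
qed

end


section \<open>Coordinates of a rational normal scroll\<close>

lemma pt_of_rep_proj:
  assumes v: "v \<in> rep_proj y" "v \<noteq> 0" shows "y = pt v"
proof -
  obtain u where u: "u \<noteq> 0" "y = pt u" "rep_proj y = range (\<lambda>c. c *s u)" by (rule proj_cases)
  then obtain c where "v = c *s u" "c \<noteq> 0" using v by auto
  then show ?thesis using u by (simp add: pt_scale)
qed

text \<open>The vectors \<open>b i j\<close> form a basis of the span \<open>V\<close> of the smooth scroll, and the \<open>x i j\<close> are the corresponding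
  coordinate functions, extended by zero to the vertex \<open>U\<close>.\<close>

locale scroll_coords =
  fixes n :: nat and a :: "nat \<Rightarrow> nat" and b :: "nat \<Rightarrow> nat \<Rightarrow> 'k::alg_closed_field ^ 'n::finite"
    and x :: "nat \<Rightarrow> nat \<Rightarrow> 'k ^ 'n \<Rightarrow> 'k" and U V :: "('k ^ 'n) set"
    and \<phi> :: "nat \<Rightarrow> ('k, 2) proj \<Rightarrow> ('k, 'n) proj"
  assumes n_pos: "n \<ge> 1" and a_pos: "i < n \<Longrightarrow> a i \<ge> 1"
    and lin_x: "i < n \<Longrightarrow> j \<le> a i \<Longrightarrow> lfun (x i j)"
    and x_U: "i < n \<Longrightarrow> j \<le> a i \<Longrightarrow> u \<in> U \<Longrightarrow> x i j u = 0"
    and x_b: "i < n \<Longrightarrow> j \<le> a i \<Longrightarrow> i' < n \<Longrightarrow> j' \<le> a i' \<Longrightarrow>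
      x i j (b i' j') = (if i = i' \<and> j = j' then 1 else 0)"
    and b_V: "i < n \<Longrightarrow> j \<le> a i \<Longrightarrow> b i j \<in> V"
    and expand: "v \<in> V \<Longrightarrow> v = (\<Sum>i<n. \<Sum>j\<le>a i. x i j v *s b i j)"
    and U: "vec.subspace U" and V: "vec.subspace V"
    and UV: "U \<inter> V = {0}" and UV_sum: "\<exists>u\<in>U. \<exists>w\<in>V. v = u + w"
    and \<phi>: "i < n \<Longrightarrow> z \<noteq> 0 \<Longrightarrow>
      \<phi> i (pt z) = pt (\<Sum>j\<le>a i. (z $ 1 ^ (a i - j) * z $ 2 ^ j) *s b i j)"
    and V_span: "V = vec_span (scroll n \<phi>)"
begin

text \<open>The columns of the matrix are indexed by all pairs; those outside the range are zero.\<close>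

definition \<alpha> :: "nat \<times> nat \<Rightarrow> 'k ^ 'n \<Rightarrow> 'k"
  where "\<alpha> c v = (if fst c < n \<and> snd c < a (fst c) then x (fst c) (snd c) v else 0)"

definition \<beta> :: "nat \<times> nat \<Rightarrow> 'k ^ 'n \<Rightarrow> 'k"
  where "\<beta> c v = (if fst c < n \<and> snd c < a (fst c) then x (fst c) (Suc (snd c)) v else 0)"

definition curve :: "nat \<Rightarrow> 'k \<Rightarrow> 'k \<Rightarrow> 'k ^ 'n"
  where "curve i s t = (\<Sum>j\<le>a i. (s ^ (a i - j) * t ^ j) *s b i j)"

lemma lin_\<alpha>: "lfun (\<alpha> c)" and lin_\<beta>: "lfun (\<beta> c)"
proof -
  have "lfun (\<alpha> c) \<and> lfun (\<beta> c)"
  proof (cases "fst c < n \<and> snd c < a (fst c)")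
    case True
    then have "\<alpha> c = x (fst c) (snd c)" "\<beta> c = x (fst c) (Suc (snd c))"
      by (auto simp: \<alpha>_def \<beta>_def)
    then show ?thesis using True by (simp add: lin_x)
  next
    case False
    then have "\<alpha> c = (\<lambda>v. 0)" "\<beta> c = (\<lambda>v. 0)" by (auto simp: \<alpha>_def \<beta>_def)
    then show ?thesis by (simp add: lfun_iff)
  qed
  then show "lfun (\<alpha> c)" "lfun (\<beta> c)" by blast+
qed

lemma x_combination:
  assumes "i < n" "j \<le> a i"
  shows "x i j (\<Sum>i<n. \<Sum>j\<le>a i. g i j *s b i j) = g i j"
proof -
  have "x i j (\<Sum>i<n. \<Sum>j\<le>a i. g i j *s b i j) =
      (\<Sum>i'<n. \<Sum>j'\<le>a i'. g i' j' * (if i = i' \<and> j = j' then 1 else 0))"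
    unfolding lfunD(2,6)[OF lin_x[OF assms]]
    by (intro sum.cong refl) (simp add: x_b[OF assms])
  also have "\<dots> = (\<Sum>i'<n. if i = i' then g i' j else 0)"
    using assms(2) by (intro sum.cong refl) (auto simp: sum.delta' if_distrib cong: if_cong)
  also have "\<dots> = g i j" using assms(1) by (simp add: sum.delta')
  finally show ?thesis .
qed

lemma scroll_combination:
  "(\<Sum>i<n. c i *s curve i s t) = (\<Sum>i<n. \<Sum>j\<le>a i. (c i * (s ^ (a i - j) * t ^ j)) *s b i j)"
  unfolding curve_def vec.scale_sum_right vec.scale_scale ..

lemma curve_V: "i < n \<Longrightarrow> curve i s t \<in> V"
  unfolding curve_def by (intro vec.subspace_sum[OF V] vec.subspace_scale[OF V] b_V) auto

lemma V_eqI: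
  assumes "v \<in> V" "\<And>i j. i < n \<Longrightarrow> j \<le> a i \<Longrightarrow> x i j v = g i j"
  shows "v = (\<Sum>i<n. \<Sum>j\<le>a i. g i j *s b i j)"
  by (subst expand[OF assms(1)]) (intro sum.cong refl, simp add: assms(2))

lemma scroll_ratio:
  "t * \<alpha> c (\<Sum>i<n. d i *s curve i s t) = s * \<beta> c (\<Sum>i<n. d i *s curve i s t)"
proof (cases "fst c < n \<and> snd c < a (fst c)")
  case True
  then have e: "a (fst c) - snd c = Suc (a (fst c) - Suc (snd c))"
    by (simp add: Suc_diff_Suc)
  show ?thesis
    using True x_combination[of "fst c" "snd c"] x_combination[of "fst c" "Suc (snd c)"]
    unfolding \<alpha>_def \<beta>_def scroll_combination by (simp add: e)
qed (auto simp: \<alpha>_def \<beta>_def)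

text \<open>The equations make the coordinates in each block a geometric progression with ratio \<open>t / s\<close>.\<close>

lemma scroll_of_ratio:
  assumes v: "v \<in> V" and st: "(s, t) \<noteq> (0, 0)" and eq: "\<And>c. t * \<alpha> c v = s * \<beta> c v"
  shows "\<exists>d. v = (\<Sum>i<n. d i *s curve i s t)"
proof -
  have e: "t * x i j v = s * x i (Suc j) v" if "i < n" "j < a i" for i j
    using eq[of "(i, j)"] that by (simp add: \<alpha>_def \<beta>_def)
  \<comment> \<open>for s = 0 only the last coordinate of each block can be different from zero\<close>
  define d where "d i = (if s = 0 then x i (a i) v / t ^ a i else x i 0 v / s ^ a i)" for i
  have "x i j v = d i * (s ^ (a i - j) * t ^ j)" if ij: "i < n" "j \<le> a i" for i j
  proof (cases "s = 0")
    case True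
    then have t: "t \<noteq> 0" using st by simp
    show ?thesis
    proof (cases "j = a i")
      case True
      then show ?thesis using \<open>s = 0\<close> t by (simp add: d_def)
    next
      case False
      then have "t * x i j v = 0" using e[of i j] ij \<open>s = 0\<close> by simp
      then show ?thesis using t False ij \<open>s = 0\<close> by (simp add: zero_power)
    qed
  next
    case False
    have "s ^ j * x i j v = t ^ j * x i 0 v" using ij(2)
    proof (induction j)
      case (Suc j)
      have "s ^ Suc j * x i (Suc j) v = s ^ j * (s * x i (Suc j) v)" by simp
      also have "\<dots> = t * (s ^ j * x i j v)" using e[of i j] ij(1) Suc.prems by simp
      also have "\<dots> = t ^ Suc j * x i 0 v" using Suc by simp
      finally show ?case .
    qed simp
    then have "x i j v = t ^ j * x i 0 v / s ^ j" using False by (simp add: field_simps)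
    moreover have "s ^ a i = s ^ (a i - j) * s ^ j" using ij(2) by (simp flip: power_add)
    ultimately show ?thesis using False by (simp add: d_def)
  qed
  then have "v = (\<Sum>i<n. \<Sum>j\<le>a i. (d i * (s ^ (a i - j) * t ^ j)) *s b i j)"
    by (intro V_eqI[OF v]) auto
  then show ?thesis unfolding scroll_combination by blast
qed

lemma curve_nonzero:
  assumes "i < n" "(s, t) \<noteq> (0, 0)" shows "curve i s t \<noteq> 0"
proof
  assume z: "curve i s t = 0"
  have c: "curve i s t = (\<Sum>i'<n. \<Sum>j\<le>a i'. ((if i' = i then 1 else 0) * (s ^ (a i' - j) * t ^ j)) *s b i' j)"
    unfolding scroll_combination[symmetric] using assms(1)
    by (simp add: if_distrib[of "\<lambda>c. c *s _"] sum.delta' cong: if_cong)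
  have x0: "x i j (curve i s t) = s ^ (a i - j) * t ^ j" if "j \<le> a i" for j
    unfolding c x_combination[OF assms(1) that] by simp
  have "x i j (curve i s t) = 0" if "j \<le> a i" for j
    using lfunD(4)[OF lin_x[OF assms(1) that]] by (simp add: z)
  then have "s ^ a i = 0" "t ^ a i = 0" using x0[of 0] x0[of "a i"] by auto
  then show False using assms(2) by auto
qed

lemma ruling_iff:
  assumes z: "z \<noteq> 0" and v: "v \<noteq> 0" "v \<in> V"
  shows "pt v \<in> ruling n \<phi> (pt z) \<longleftrightarrow> (\<forall>c. z $ 2 * \<alpha> c v = z $ 1 * \<beta> c v)"
proof -
  have z12: "(z $ 1, z $ 2) \<noteq> (0, 0)" using z by (auto simp: vec_eq_iff forall_2)
  let ?C = "(\<lambda>i. curve i (z $ 1) (z $ 2)) ` {..<n}"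
  have \<phi>c: "\<phi> i (pt z) = pt (curve i (z $ 1) (z $ 2))" if "i < n" for i
    unfolding \<phi>[OF that z] curve_def ..
  have R: "ruling n \<phi> (pt z) = projectivization (vec.span ?C)"
    unfolding ruling_def
  proof (rule lin_span_eqI[OF vec.subspace_span])
    fix w :: "'k ^ 'n" assume w: "w \<noteq> 0" "pt w \<in> (\<lambda>i. \<phi> i (pt z)) ` {..<n}"
    then obtain i where i: "i < n" "pt w = pt (curve i (z $ 1) (z $ 2))" using \<phi>c by auto
    then obtain c where "w = c *s curve i (z $ 1) (z $ 2)"
      using pt_eq_iff[OF curve_nonzero[OF i(1) z12] w(1)] by auto
    moreover have "curve i (z $ 1) (z $ 2) \<in> vec.span ?C" using i(1) by (intro vec.span_base) auto
    ultimately show "w \<in> vec.span ?C" by (simp add: vec.span_scale)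
  next
    show "vec.span ?C \<subseteq> vec_span ((\<lambda>i. \<phi> i (pt z)) ` {..<n})"
    proof (rule vec.span_minimal[OF _ vec_span_subspace], safe)
      fix i assume i: "i < n"
      show "curve i (z $ 1) (z $ 2) \<in> vec_span ((\<lambda>i. \<phi> i (pt z)) ` {..<n})"
        by (rule vec_span_pt[OF curve_nonzero[OF i z12]]) (use \<phi>c[OF i] i in force)
    qed
  qed
  have "pt v \<in> ruling n \<phi> (pt z) \<longleftrightarrow> v \<in> vec.span ?C"
    unfolding R by (rule pt_in_projectivization[OF vec.subspace_span v(1)])
  also have "\<dots> \<longleftrightarrow> (\<forall>c. z $ 2 * \<alpha> c v = z $ 1 * \<beta> c v)"
  proof
    assume "v \<in> vec.span ?C"
    moreover have "vec.subspace {v. \<forall>c. z $ 2 * \<alpha> c v + (- z $ 1) * \<beta> c v = 0}"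
      by (intro subspace_zeros lfun_combine lin_\<alpha> lin_\<beta>)
    moreover have "?C \<subseteq> {v. \<forall>c. z $ 2 * \<alpha> c v + (- z $ 1) * \<beta> c v = 0}"
    proof safe
      fix i c assume i: "i < n"
      have "curve i (z $ 1) (z $ 2) = (\<Sum>i'<n. (if i' = i then 1 else 0) *s curve i' (z $ 1) (z $ 2))"
        using i by (simp add: if_distrib[of "\<lambda>c. c *s _"] sum.delta' cong: if_cong)
      then show "z $ 2 * \<alpha> c (curve i (z $ 1) (z $ 2)) + (- z $ 1) * \<beta> c (curve i (z $ 1) (z $ 2)) = 0"
        using scroll_ratio[of "z $ 2" c "\<lambda>i'. if i' = i then 1 else 0" "z $ 1"] by simp
    qed
    ultimately have "v \<in> {v. \<forall>c. z $ 2 * \<alpha> c v + (- z $ 1) * \<beta> c v = 0}"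
      using vec.span_minimal by blast
    then show "\<forall>c. z $ 2 * \<alpha> c v = z $ 1 * \<beta> c v" by simp
  next
    assume "\<forall>c. z $ 2 * \<alpha> c v = z $ 1 * \<beta> c v"
    then obtain d where d: "v = (\<Sum>i<n. d i *s curve i (z $ 1) (z $ 2))"
      using scroll_of_ratio[OF v(2) z12] by blast
    show "v \<in> vec.span ?C"
      unfolding d by (intro vec.span_sum vec.span_scale vec.span_base) auto
  qed
  finally show ?thesis .
qed

abbreviation rank_le_1 :: "'k ^ 'n \<Rightarrow> bool"
  where "rank_le_1 v \<equiv> \<forall>c d. \<alpha> c v * \<beta> d v = \<alpha> d v * \<beta> c v"

lemma rank_le_1_ratio:
  assumes "(s, t) \<noteq> (0, 0)" "\<And>c. t * \<alpha> c v = s * \<beta> c v" shows "rank_le_1 v"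
proof (intro allI)
  fix c d
  have "s * (\<alpha> c v * \<beta> d v) = \<alpha> c v * (t * \<alpha> d v)" by (simp add: assms(2))
  also have "\<dots> = (t * \<alpha> c v) * \<alpha> d v" by (simp only: mult_ac)
  also have "\<dots> = s * (\<alpha> d v * \<beta> c v)" by (simp only: assms(2) mult_ac)
  finally have s: "s * (\<alpha> c v * \<beta> d v) = s * (\<alpha> d v * \<beta> c v)" .
  have "t * (\<alpha> c v * \<beta> d v) = (t * \<alpha> c v) * \<beta> d v" by (simp only: mult_ac)
  also have "\<dots> = (s * \<beta> d v) * \<beta> c v" by (simp only: assms(2) mult_ac)
  also have "\<dots> = t * (\<alpha> d v * \<beta> c v)" by (simp only: assms(2)[symmetric] mult_ac)
  finally have "t * (\<alpha> c v * \<beta> d v) = t * (\<alpha> d v * \<beta> c v)" .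
  with s show "\<alpha> c v * \<beta> d v = \<alpha> d v * \<beta> c v" using assms(1) by auto
qed

lemma rank_le_1_obtain:
  assumes "rank_le_1 v"
  obtains s t w where "(s, t) \<noteq> (0, 0)" "\<And>c. \<alpha> c v = s * w c" "\<And>c. \<beta> c v = t * w c"
  using rank_one[of "\<lambda>c. \<alpha> c v" "\<lambda>c. \<beta> c v"] assms by metis

lemma U_forms: "u \<in> U \<Longrightarrow> \<alpha> c u = 0 \<and> \<beta> c u = 0"
  by (auto simp: \<alpha>_def \<beta>_def x_U)

lemma forms_add_U: "u \<in> U \<Longrightarrow> \<alpha> c (u + w) = \<alpha> c w" "u \<in> U \<Longrightarrow> \<beta> c (u + w) = \<beta> c w"
  using U_forms[of u c] by (simp_all add: lfunD(1)[OF lin_\<alpha>] lfunD(1)[OF lin_\<beta>])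

lemma U_eq: "U = {v. \<forall>c. \<alpha> c v = 0 \<and> \<beta> c v = 0}"
proof (intro equalityI subsetI)
  fix v assume v: "v \<in> {v. \<forall>c. \<alpha> c v = 0 \<and> \<beta> c v = 0}"
  obtain u w where uw: "u \<in> U" "w \<in> V" "v = u + w" using UV_sum by blast
  have f: "\<alpha> c w = 0" "\<beta> c w = 0" for c
  proof -
    have "\<alpha> c (u + w) = 0 \<and> \<beta> c (u + w) = 0" using v unfolding uw(3) by blast
    then show "\<alpha> c w = 0" "\<beta> c w = 0" by (simp_all add: forms_add_U[OF uw(1)])
  qed
  have "x i j w = 0" if ij: "i < n" "j \<le> a i" for i j
  proof (cases "j = a i")
    case True
    then show ?thesis using f(2)[of "(i, a i - 1)"] a_pos[OF ij(1)] ij by (simp add: \<beta>_def)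
  next
    case False
    then show ?thesis using f(1)[of "(i, j)"] ij by (simp add: \<alpha>_def)
  qed
  then have "w = (\<Sum>i<n. \<Sum>j\<le>a i. 0 *s b i j)" by (intro V_eqI[OF uw(2)]) auto
  then show "v \<in> U" using uw by simp
qed (use U_forms in blast)

lemma scroll_pt_iff: assumes "v \<noteq> 0" shows "pt v \<in> scroll n \<phi> \<longleftrightarrow> v \<in> V \<and> rank_le_1 v"
proof
  assume s: "pt v \<in> scroll n \<phi>"
  then have v: "v \<in> V" unfolding V_span by (rule vec_span_pt[OF assms])
  obtain y where y: "pt v \<in> ruling n \<phi> y" using s by (auto simp: scroll_def)
  obtain z where z: "z \<noteq> 0" "y = pt z" by (rule proj_cases[of y])
  have "(z $ 1, z $ 2) \<noteq> (0, 0)" using z(1) by (auto simp: vec_eq_iff forall_2)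
  then have "rank_le_1 v"
    using ruling_iff[OF z(1) assms v] y unfolding z(2) by (intro rank_le_1_ratio) auto
  then show "v \<in> V \<and> rank_le_1 v" using v by blast
next
  assume v: "v \<in> V \<and> rank_le_1 v"
  then obtain s t w where w: "(s, t) \<noteq> (0, 0)" "\<And>c. \<alpha> c v = s * w c" "\<And>c. \<beta> c v = t * w c"
    using rank_le_1_obtain by metis
  define z :: "'k ^ 2" where "z = (\<chi> i. if i = 1 then s else t)"
  have z12: "z $ 1 = s" "z $ 2 = t" by (simp_all add: z_def)
  have "z \<noteq> 0" using w(1) z12 by auto
  then have "pt v \<in> ruling n \<phi> (pt z)"
    using ruling_iff[OF _ assms] v by (simp add: z12 w)
  then show "pt v \<in> scroll n \<phi>" by (auto simp: scroll_def)
qed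

lemma scroll_nonempty: "scroll n \<phi> \<noteq> {}"
proof -
  have "curve 0 1 0 \<noteq> 0" using n_pos by (intro curve_nonzero) auto
  moreover have "curve 0 1 0 = (\<Sum>i<n. (if i = 0 then 1 else 0) *s curve i 1 0)"
    using n_pos by (simp add: if_distrib[of "\<lambda>c. c *s _"] sum.delta' cong: if_cong)
  then have "rank_le_1 (curve 0 1 0)"
    using scroll_ratio[of 0 _ "\<lambda>i. if i = 0 then 1 else 0" 1] by (intro rank_le_1_ratio[of 1 0]) auto
  moreover have "curve 0 1 0 \<in> V" using n_pos by (intro curve_V) auto
  ultimately show ?thesis using scroll_pt_iff by blast
qed

definition X where "X = embedded_join (projectivization U) (scroll n \<phi>)"

lemma X_iff: assumes "v \<noteq> 0" shows "pt v \<in> X \<longleftrightarrow> rank_le_1 v"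
proof -
  let ?Z = "zeros (range (\<lambda>(c, d). det_form (\<alpha> c) (\<alpha> d) (\<beta> c) (\<beta> d)))"
  have Z: "pt v \<in> ?Z \<longleftrightarrow> rank_le_1 v" if v: "v \<noteq> 0" for v
  proof -
    have "pt v \<in> ?Z \<longleftrightarrow> (\<forall>c d. \<forall>t. t\<^sup>2 * (\<alpha> c v * \<beta> d v - \<alpha> d v * \<beta> c v) = 0)"
      unfolding zeros_def rep_pt[OF v] mem_Collect_eq
      by (simp add: det_form_def lform_eval lin_\<alpha> lin_\<beta> lfunD(2)[OF lin_\<alpha>] lfunD(2)[OF lin_\<beta>]
          power2_eq_square algebra_simps)
    also have "\<dots> \<longleftrightarrow> (\<forall>c d. \<alpha> c v * \<beta> d v - \<alpha> d v * \<beta> c v = 0)"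
      by (metis mult_1 mult_zero_right one_power2)
    finally show ?thesis by simp
  qed
  have "X = ?Z"
    unfolding X_def
  proof (rule embedded_join_eq[OF U V UV UV_sum scroll_nonempty])
    show "scroll n \<phi> \<subseteq> projectivization V"
      by (rule proj_subsetI) (simp add: scroll_pt_iff pt_in_projectivization[OF V])
    show "zclosed ?Z" unfolding zclosed_def by blast
    fix u w assume uw: "u \<in> U" "w \<in> V" "u + w \<noteq> 0"
    have "rank_le_1 0" by (simp add: lfunD(4)[OF lin_\<alpha>])
    then show "pt (u + w) \<in> ?Z \<longleftrightarrow> w = 0 \<or> pt w \<in> scroll n \<phi>"
      unfolding Z[OF uw(3)] forms_add_U[OF uw(1)]
      by (cases "w = 0") (simp_all add: scroll_pt_iff uw(2))
  qed
  then show ?thesis using Z[OF assms] by simp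
qed

lemma inf: "infinite (UNIV :: 'k set)" by (rule infinite_alg_closed)

lemma X_nonempty: "X \<noteq> {}"
proof -
  obtain y where y: "y \<in> scroll n \<phi>" using scroll_nonempty by blast
  obtain v where v: "v \<noteq> 0" "y = pt v" by (rule proj_cases[of y])
  then show ?thesis using y scroll_pt_iff X_iff by blast
qed

lemma vanishing_eval:
  assumes "f \<in> vanishing_ideal X" "rank_le_1 v" shows "mpoly_eval f v = 0"
  using assms vanishing_ideal_eval_0[OF assms(1) X_nonempty]
  by (cases "v = 0") (simp_all add: vanishing_ideal_iff[OF inf] X_iff)

section \<open>Tangent spaces of the scroll\<close>

lemma dderiv_of_line:
  assumes "f \<in> vanishing_ideal X" "\<And>e. rank_le_1 (q + e *s w)" shows "dderiv f q w = 0"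
  by (rule dderiv_zero_of_line[OF inf]) (rule vanishing_eval[OF assms])

text \<open>The lines joining a point of the vertex to the points of the smooth scroll lie in the cone, and
  these points span everything together with the vertex.\<close>

lemma tangent_vertex:
  assumes f: "f \<in> vanishing_ideal X" and q: "q \<in> U" shows "dderiv f q p = 0"
proof -
  have sub: "vec.subspace {w. dderiv f q w = 0}"
  proof (rule vec.subspaceI)
    show "0 \<in> {w. dderiv f q w = 0}" by (simp add: dderiv_def)
  qed (auto simp: dderiv_add dderiv_scale)
  have rank: "dderiv f q w = 0" if "rank_le_1 w" for w
  proof (rule dderiv_of_line[OF f])
    show "rank_le_1 (q + e *s w)" for e
      unfolding forms_add_U[OF q] using that
      by (simp add: lfunD(2)[OF lin_\<alpha>] lfunD(2)[OF lin_\<beta>])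
  qed
  have "V \<subseteq> {w. dderiv f q w = 0}"
    unfolding V_span by (rule vec_span_least[OF sub]) (simp add: scroll_pt_iff rank)
  moreover have "U \<subseteq> {w. dderiv f q w = 0}" using rank U_forms by auto
  moreover obtain u w where uw: "u \<in> U" "w \<in> V" "p = u + w" using UV_sum by blast
  ultimately have "dderiv f q u = 0" "dderiv f q w = 0" by blast+
  then show ?thesis by (simp add: uw(3) dderiv_add)
qed

text \<open>Moving the point of the projective line along the direction \<open>(s', t')\<close> gives a curve in the cone
  through \<open>u + v\<close> whose velocity is transverse to the ruling, unless the matrix of \<open>v\<close> is zero.\<close>

lemma transverse_tangent:
  assumes f: "f \<in> vanishing_ideal X" and u: "u \<in> U"
    and st: "(s, t) \<noteq> (0, 0)" and v: "v = (\<Sum>i<n. d i *s curve i s t)"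
  obtains y' where "dderiv f (u + v) y' = 0"
    "\<And>w c. (\<And>c. \<alpha> c v = s * w c) \<Longrightarrow> (\<And>c. \<beta> c v = t * w c) \<Longrightarrow> t * \<alpha> c y' - s * \<beta> c y' = w c"
proof -
  obtain s' t' where st': "t * s' - s * t' = 1"
  proof (cases "s = 0")
    case True then show ?thesis using st by (intro that[of "1 / t" 0]) auto
  next
    case False then show ?thesis by (intro that[of 0 "- 1 / s"]) auto
  qed
  define P where "P i j = [:s, s':] ^ (a i - j) * [:t, t':] ^ j" for i j
  define Y where "Y l = [:u $ l:] + (\<Sum>i<n. \<Sum>j\<le>a i. smult (d i * b i j $ l) (P i j))" for l
  define y' where "y' = (\<Sum>i<n. \<Sum>j\<le>a i. (d i * poly (pderiv (P i j)) 0) *s b i j)"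
  have pds: "pderiv (sum g A) = (\<Sum>a\<in>A. pderiv (g a))" for g :: "nat \<Rightarrow> 'k poly" and A
    by (induction A rule: infinite_finite_induct) (auto simp: pderiv_add)
  have Y: "(\<chi> l. poly (Y l) e) = u + (\<Sum>i<n. d i *s curve i (s + e * s') (t + e * t'))" for e
    unfolding scroll_combination
    by (simp add: vec_eq_iff Y_def P_def poly_sum poly_power algebra_simps)
  have dY: "(\<chi> l. poly (pderiv (Y l)) 0) = y'"
    by (simp add: vec_eq_iff Y_def y'_def pderiv_add pds pderiv_smult poly_sum algebra_simps)
  have rank: "rank_le_1 (\<chi> l. poly (Y l) e)" for e
  proof -
    have "t * (s + e * s') - s * (t + e * t') = e * (t * s' - s * t')" by (simp add: algebra_simps)
    then have e1: "t * (s + e * s') - s * (t + e * t') = e" by (simp add: st')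
    have e2: "(t + e * t') * s' - (s + e * s') * t' = 1" using st' by (simp add: algebra_simps)
    have "(s + e * s', t + e * t') \<noteq> (0, 0)" using e2 by auto
    then have "rank_le_1 (\<Sum>i<n. d i *s curve i (s + e * s') (t + e * t'))"
      by (rule rank_le_1_ratio) (rule scroll_ratio)
    then show ?thesis unfolding Y forms_add_U[OF u] .
  qed
  have "mpoly_subst (\<lambda>c. [:c:]) Y f = 0"
  proof (rule infinite_field_poly_zero[OF inf])
    fix e
    have "poly (mpoly_subst (\<lambda>c. [:c:]) Y f) e = mpoly_eval f (\<chi> l. poly (Y l) e)"
      unfolding mpoly_eval_eq_subst
      by (subst subst_compose[where g = "\<lambda>p. poly p e"]) (auto simp: mpoly_subst_def)
    then show "poly (mpoly_subst (\<lambda>c. [:c:]) Y f) e = 0" using vanishing_eval[OF f rank] by simp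
  qed
  then have "dderiv f (\<chi> l. poly (Y l) 0) (\<chi> l. poly (pderiv (Y l)) 0) = 0"
    unfolding chain_rule[symmetric] by simp
  then have "dderiv f (u + v) y' = 0" unfolding dY Y by (simp add: v)
  moreover have "t * \<alpha> c y' - s * \<beta> c y' = w c"
    if w: "\<And>c. \<alpha> c v = s * w c" "\<And>c. \<beta> c v = t * w c" for w c
  proof (cases "fst c < n \<and> snd c < a (fst c)")
    case True
    obtain i j where c: "c = (i, j)" by (cases c)
    have ij: "i < n" "j < a i" using True by (simp_all add: c)
    have e: "a i - j = Suc (a i - Suc j)" using ij(2) by (simp add: Suc_diff_Suc)
    have Pd: "smult t (P i j) - smult s (P i (Suc j)) =
        [:0, 1:] * ([:s, s':] ^ (a i - Suc j) * [:t, t':] ^ j)"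
    proof -
      have "smult t (P i j) - smult s (P i (Suc j)) =
          (smult t [:s, s':] - smult s [:t, t':]) * ([:s, s':] ^ (a i - Suc j) * [:t, t':] ^ j)"
        unfolding P_def e by (simp only: power_Suc) (simp only: mult_smult_left[symmetric] algebra_simps)
      also have "smult t [:s, s':] - smult s [:t, t':] = [:0, 1:]" using st' by (simp add: mult.commute)
      finally show ?thesis .
    qed
    have "t * \<alpha> c y' - s * \<beta> c y' =
        d i * (t * poly (pderiv (P i j)) 0 - s * poly (pderiv (P i (Suc j))) 0)"
      using ij unfolding y'_def by (simp add: c \<alpha>_def \<beta>_def x_combination algebra_simps)
    also have "t * poly (pderiv (P i j)) 0 - s * poly (pderiv (P i (Suc j))) 0 =
        poly (pderiv (smult t (P i j) - smult s (P i (Suc j)))) 0"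
      by (simp add: pderiv_diff pderiv_smult)
    also have "\<dots> = s ^ (a i - Suc j) * t ^ j"
      unfolding Pd by (simp add: pderiv_mult pderiv_pCons poly_power)
    finally have z: "t * \<alpha> c y' - s * \<beta> c y' = d i * (s ^ (a i - Suc j) * t ^ j)" .
    have "\<alpha> c v = s * (d i * (s ^ (a i - Suc j) * t ^ j))" "\<beta> c v = t * (d i * (s ^ (a i - Suc j) * t ^ j))"
      using ij unfolding v scroll_combination by (simp_all add: c \<alpha>_def \<beta>_def x_combination e)
    note av = this
    have "s * (d i * (s ^ (a i - Suc j) * t ^ j)) = s * w c"
      "t * (d i * (s ^ (a i - Suc j) * t ^ j)) = t * w c"
      by (rule av(1)[symmetric, THEN trans, OF w(1)], rule av(2)[symmetric, THEN trans, OF w(2)])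
    then show ?thesis unfolding z using st by auto
  next
    case False
    then have "\<alpha> c = (\<lambda>v. 0)" "\<beta> c = (\<lambda>v. 0)" by (auto simp: \<alpha>_def \<beta>_def)
    then show ?thesis using w[of c] st by auto
  qed
  ultimately show ?thesis using that by blast
qed

text \<open>The defect \<open>z\<close> of proportionality of the columns of \<open>p\<close> to the column \<open>(s, t)\<close> of \<open>q\<close> is a multiple of
  the row \<open>w\<close> of \<open>q\<close>, by the equations for \<open>p\<close>. Subtracting a multiple of the transverse tangent vector \<open>y'\<close> removes the defect, and the
  rest lies in the cone over the ruling through \<open>q\<close>, hence is a tangent vector as well.\<close>

lemma tangent:
  assumes q: "rank_le_1 q"
    and pol: "\<forall>c d. \<alpha> c q * \<beta> d p + \<alpha> c p * \<beta> d q - \<alpha> d q * \<beta> c p - \<alpha> d p * \<beta> c q = 0"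
    and f: "f \<in> vanishing_ideal X"
  shows "dderiv f q p = 0"
proof (cases "q \<in> U")
  case True
  then show ?thesis by (rule tangent_vertex[OF f])
next
  case False
  obtain s t w where w: "(s, t) \<noteq> (0, 0)" "\<And>c. \<alpha> c q = s * w c" "\<And>c. \<beta> c q = t * w c"
    by (rule rank_le_1_obtain[OF q]) blast
  obtain u v where uv: "u \<in> U" "v \<in> V" "q = u + v" using UV_sum by blast
  have wv: "\<alpha> c v = s * w c" "\<beta> c v = t * w c" for c
    using w(2,3)[of c] unfolding uv(3) forms_add_U[OF uv(1)] by blast+
  obtain d where d: "v = (\<Sum>i<n. d i *s curve i s t)"
    using scroll_of_ratio[OF uv(2) w(1)] by (auto simp: wv mult_ac)
  obtain y' where y': "dderiv f (u + v) y' = 0"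
    "\<And>w c. (\<And>c. \<alpha> c v = s * w c) \<Longrightarrow> (\<And>c. \<beta> c v = t * w c) \<Longrightarrow> t * \<alpha> c y' - s * \<beta> c y' = w c"
    by (rule transverse_tangent[OF f uv(1) w(1) d]) blast
  have y'w: "t * \<alpha> c y' - s * \<beta> c y' = w c" for c by (rule y'(2)[OF wv])
  define z where "z c = t * \<alpha> c p - s * \<beta> c p" for c
  obtain c0 where c0: "w c0 \<noteq> 0"
  proof -
    have "\<exists>c. \<alpha> c q \<noteq> 0 \<or> \<beta> c q \<noteq> 0" using False unfolding U_eq by blast
    then show ?thesis using that w(2,3) by auto
  qed
  have zw: "z c * w c0 = z c0 * w c" for c
  proof -
    have "z c * w c0 - z c0 * w c =
        \<alpha> c q * \<beta> c0 p + \<alpha> c p * \<beta> c0 q - \<alpha> c0 q * \<beta> c p - \<alpha> c0 p * \<beta> c q"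
      unfolding w z_def by (simp add: algebra_simps)
    then show ?thesis using pol by simp
  qed
  define \<kappa> where "\<kappa> = z c0 / w c0"
  have z\<kappa>: "z c = \<kappa> * w c" for c using zw[of c] c0 by (simp add: \<kappa>_def field_simps)
  define r where "r = p - \<kappa> *s y'"
  have r: "t * \<alpha> c r = s * \<beta> c r" for c
  proof -
    have "t * \<alpha> c r - s * \<beta> c r = z c - \<kappa> * (t * \<alpha> c y' - s * \<beta> c y')"
      by (simp add: r_def z_def lfunD(2,3)[OF lin_\<alpha>] lfunD(2,3)[OF lin_\<beta>] algebra_simps)
    then show ?thesis unfolding y'w z\<kappa> by simp
  qed
  have "dderiv f q r = 0"
  proof (rule dderiv_of_line[OF f], rule rank_le_1_ratio[OF w(1)])
    fix e c
    show "t * \<alpha> c (q + e *s r) = s * \<beta> c (q + e *s r)"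
      using r[of c] w(2,3)[of c]
      by (simp add: lfunD(1,2)[OF lin_\<alpha>] lfunD(1,2)[OF lin_\<beta>] distrib_left mult.left_commute)
  qed
  moreover have "p = r + \<kappa> *s y'" by (simp add: r_def)
  ultimately show ?thesis using y'(1) unfolding uv(3)[symmetric] by (simp add: dderiv_add dderiv_scale)
qed

lemma pencil: "pencil \<alpha> \<beta> U V X"
  by (rule pencil.intro, rule lin_\<alpha>, rule lin_\<beta>, rule U_eq, rule V, rule UV, rule UV_sum,
      rule X_nonempty, erule X_iff, erule tangent, assumption+)

section \<open>Lines on the scroll\<close>

lemma line_in_ruling:
  assumes v: "v1 \<in> V" "v2 \<in> V" and st: "(s, t) \<noteq> (0, 0)"
    and r: "\<And>c. t * \<alpha> c v1 = s * \<beta> c v1" "\<And>c. t * \<alpha> c v2 = s * \<beta> c v2"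
  shows "\<exists>y. projectivization {a *s v1 + b *s v2 | a b. True} \<subseteq> ruling n \<phi> y \<inter> scroll n \<phi>"
proof -
  define z :: "'k ^ 2" where "z = (\<chi> i. if i = 1 then s else t)"
  have z12: "z $ 1 = s" "z $ 2 = t" by (simp_all add: z_def)
  have z0: "z \<noteq> 0" using st z12 by auto
  have "projectivization {a *s v1 + b *s v2 | a b. True} \<subseteq> ruling n \<phi> (pt z)"
  proof (rule proj_subsetI)
    fix w :: "'k ^ 'n" assume w: "w \<noteq> 0" "pt w \<in> projectivization {a *s v1 + b *s v2 | a b. True}"
    have "w \<in> {a *s v1 + b *s v2 | a b. True}"
      using w(2) unfolding pt_in_projectivization[OF subspace_line w(1)] .
    then obtain a b where ab: "w = a *s v1 + b *s v2" by blast
    have wV: "w \<in> V" unfolding ab by (intro vec.subspace_add[OF V] vec.subspace_scale[OF V] v)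
    have "t * \<alpha> c w = s * \<beta> c w" for c
    proof -
      have "t * \<alpha> c w = a * (t * \<alpha> c v1) + b * (t * \<alpha> c v2)"
        unfolding ab lfunD(1,2)[OF lin_\<alpha>] by (simp add: algebra_simps)
      also have "\<dots> = s * \<beta> c w"
        unfolding ab lfunD(1,2)[OF lin_\<beta>] r by (simp add: algebra_simps)
      finally show ?thesis .
    qed
    then show "pt w \<in> ruling n \<phi> (pt z)" by (simp add: ruling_iff[OF z0 w(1) wV] z12)
  qed
  then show ?thesis unfolding scroll_def by blast
qed

text \<open>A pencil of matrices with a fixed row and an arbitrary column: the column is the image of
  the point under the projection to the projective line.\<close>

lemma line_section_of_row:
  assumes w: "w1 \<in> V" "w2 \<in> V" and \<omega>0: "\<omega> c0 \<noteq> 0"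
    and \<omega>: "\<And>c. \<alpha> c w1 = \<omega> c" "\<And>c. \<beta> c w1 = 0" "\<And>c. \<alpha> c w2 = 0" "\<And>c. \<beta> c w2 = \<omega> c"
  shows "line_section n \<phi> (projectivization {a *s w1 + b *s w2 | a b. True})"
proof -
  let ?M = "{a *s w1 + b *s w2 | a b. True}"
  let ?L = "projectivization ?M"
  define e :: "'k ^ 2 \<Rightarrow> 'k ^ 'n" where "e z = z $ 1 *s w1 + z $ 2 *s w2" for z
  have eV: "e z \<in> V" for z
    unfolding e_def by (intro vec.subspace_add[OF V] vec.subspace_scale[OF V] w)
  have f: "\<alpha> c (e z) = z $ 1 * \<omega> c" "\<beta> c (e z) = z $ 2 * \<omega> c" for c z
    by (simp_all add: e_def lfunD(1,2)[OF lin_\<alpha>] lfunD(1,2)[OF lin_\<beta>] \<omega>)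
  have e0: "e z \<noteq> 0" if "z \<noteq> 0" for z
  proof
    assume "e z = 0"
    then have "z $ 1 * \<omega> c0 = 0" "z $ 2 * \<omega> c0 = 0"
      using f[of c0 z] lfunD(4)[OF lin_\<alpha>] lfunD(4)[OF lin_\<beta>] by simp_all
    then show False using \<omega>0 that by (simp add: vec_eq_iff forall_2)
  qed
  have M: "\<exists>z. v = e z" if "v \<in> ?M" for v
  proof -
    obtain a b where ab: "v = a *s w1 + b *s w2" using \<open>v \<in> ?M\<close> by blast
    show ?thesis by (rule exI[of _ "\<chi> i. if i = 1 then a else b"]) (simp add: ab e_def)
  qed
  have eM: "e z \<in> ?M" for z unfolding e_def by blast
  have L: "\<exists>z. z \<noteq> 0 \<and> v = e z" if "y \<in> ?L" "v \<in> rep_proj y" "v \<noteq> 0" for y v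
  proof -
    have "v \<in> ?M" using that(1,2) unfolding projectivization_def by blast
    then obtain z where z: "v = e z" using M by blast
    moreover have "e 0 = 0" by (simp add: e_def)
    ultimately show ?thesis using that(3) by metis
  qed
  have eL: "pt (e z) \<in> ?L" if "z \<noteq> 0" for z
    using eM by (simp only: pt_in_projectivization[OF subspace_line e0[OF that]])
  have rul: "pt (e z) \<in> ruling n \<phi> (pt z') \<longleftrightarrow> z' $ 2 * z $ 1 = z' $ 1 * z $ 2"
    if "z \<noteq> 0" "z' \<noteq> 0" for z z'
  proof -
    have "pt (e z) \<in> ruling n \<phi> (pt z') \<longleftrightarrow> (\<forall>c. (z' $ 2 * z $ 1) * \<omega> c = (z' $ 1 * z $ 2) * \<omega> c)"
      unfolding ruling_iff[OF that(2) e0[OF that(1)] eV] f by (simp only: mult.assoc)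
    then show ?thesis unfolding mult_cancel_right using \<omega>0 by blast
  qed
  have proj: "scroll_projection n \<phi> (pt (e z)) = pt z" if z: "z \<noteq> 0" for z
    unfolding scroll_projection_def
  proof (rule the_equality)
    show "pt (e z) \<in> ruling n \<phi> (pt z)" by (simp add: rul[OF z z] mult.commute)
    fix y assume y: "pt (e z) \<in> ruling n \<phi> y"
    obtain z' where z': "z' \<noteq> 0" "y = pt z'" by (rule proj_cases[of y])
    have "z' $ 2 * z $ 1 = z' $ 1 * z $ 2" using y rul[OF z z'(1)] unfolding z'(2) by blast
    then have "z $ 2 * z' $ 1 + (- z $ 1) * z' $ 2 = 0" by (simp add: mult.commute)
    moreover have "z $ 2 \<noteq> 0 \<or> - z $ 1 \<noteq> 0" using z by (auto simp: vec_eq_iff forall_2)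
    ultimately obtain \<rho> where "z' $ 1 = - (\<rho> * - z $ 1)" "z' $ 2 = \<rho> * z $ 2"
      using orthogonal_2 by metis
    then have "z' = \<rho> *s z" by (simp add: vec_eq_iff forall_2)
    then have "pt z = pt z'" using pt_eq_iff[OF z z'(1)] by blast
    then show "y = pt z" unfolding z'(2) by (rule sym)
  qed
  have inj: "inj_on (scroll_projection n \<phi>) ?L"
  proof (rule inj_onI)
    fix y y' assume y: "y \<in> ?L" "y' \<in> ?L" "scroll_projection n \<phi> y = scroll_projection n \<phi> y'"
    obtain v where v: "v \<noteq> 0" "y = pt v" "rep_proj y = range (\<lambda>c. c *s v)" by (rule proj_cases)
    obtain v' where v': "v' \<noteq> 0" "y' = pt v'" "rep_proj y' = range (\<lambda>c. c *s v')" by (rule proj_cases)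
    have mem: "v \<in> rep_proj y" "v' \<in> rep_proj y'"
      unfolding v(3) v'(3) by (rule range_eqI[of _ _ 1], simp)+
    obtain z where z1: "z \<noteq> 0" "v = e z" using L[OF y(1) mem(1) v(1)] by blast
    obtain z' where z2: "z' \<noteq> 0" "v' = e z'" using L[OF y(2) mem(2) v'(1)] by blast
    note z = z1 z2
    have "pt z = pt z'" using y(3) unfolding v(2) v'(2) z(2,4) proj[OF z(1)] proj[OF z(3)] .
    then obtain c where c: "z' = c *s z" using pt_eq_iff[OF z(1,3)] by blast
    have "v' = c *s v" unfolding z(2,4) c by (simp add: e_def vec.scale_right_distrib)
    then have "pt v = pt v'" using pt_eq_iff[OF v(1) v'(1)] by blast
    then show "y = y'" unfolding v(2) v'(2) .
  qed
  have "scroll_projection n \<phi> ` ?L = UNIV"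
  proof (rule proj_set_eqI)
    fix z :: "'k ^ 2" assume z: "z \<noteq> 0"
    show "pt z \<in> scroll_projection n \<phi> ` ?L \<longleftrightarrow> pt z \<in> UNIV"
      using imageI[OF eL[OF z], of "scroll_projection n \<phi>"] unfolding proj[OF z] by simp
  qed
  then have bij: "bij_betw (scroll_projection n \<phi>) ?L UNIV" using inj by (simp add: bij_betw_def)
  have inv: "inv_into ?L (scroll_projection n \<phi>) (pt z) = pt (e z)" if "z \<noteq> 0" for z
    using inv_into_f_f[OF inj eL[OF that]] proj[OF that] by simp
  have reg: "regular_map ?L (scroll_projection n \<phi>)"
    unfolding regular_map_def
  proof
    fix y assume y: "y \<in> ?L"
    define F :: "2 \<Rightarrow> ('k, 'n) mpoly" where "F i = (if i = 1 then lform (\<alpha> c0) else lform (\<beta> c0))" for i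
    have F: "(\<chi> i. mpoly_eval (F i) (e z)) = \<omega> c0 *s z" for z
      by (simp add: vec_eq_iff forall_2 F_def lform_eval lin_\<alpha> lin_\<beta> f mult.commute)
    show "\<exists>d F. (\<forall>j. homogeneous d (F j)) \<and>
        (\<forall>v\<in>rep_proj y - {0}. (\<chi> j. mpoly_eval (F j) v) \<noteq> 0) \<and>
        (\<forall>y\<in>?L. \<forall>v\<in>rep_proj y - {0}. (\<chi> j. mpoly_eval (F j) v) \<noteq> 0 \<longrightarrow>
          scroll_projection n \<phi> y = pt (\<chi> j. mpoly_eval (F j) v))"
    proof (intro exI[of _ 1] exI[of _ F] conjI allI ballI impI)
      show "homogeneous 1 (F i)" for i unfolding F_def using homogeneous_lform by auto
    next
      fix v assume "v \<in> rep_proj y - {0}"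
      then obtain z where "z \<noteq> 0" "v = e z" using L[OF y, of v] by blast
      then show "(\<chi> i. mpoly_eval (F i) v) \<noteq> 0" using \<omega>0 by (simp add: F)
    next
      fix y' v assume v: "y' \<in> ?L" "v \<in> rep_proj y' - {0}"
      then obtain z where z: "z \<noteq> 0" "v = e z" using L[OF v(1), of v] by blast
      have "y' = pt v" using pt_of_rep_proj[of v y'] v(2) by simp
      then show "scroll_projection n \<phi> y' = pt (\<chi> i. mpoly_eval (F i) v)"
        unfolding z(2) F using proj[OF z(1)] \<omega>0 z(1) by (simp add: pt_scale)
    qed
  qed
  have reg': "regular_map UNIV (inv_into ?L (scroll_projection n \<phi>))"
    unfolding regular_map_def
  proof
    fix y :: "('k, 2) proj"
    define F :: "'n \<Rightarrow> ('k, 2) mpoly" where "F l = lform (\<lambda>z. e z $ l)" for l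
    have "lfun (\<lambda>z. e z $ l)" for l by (simp add: e_def lfun_iff algebra_simps)
    then have F: "(\<chi> l. mpoly_eval (F l) z) = e z" for z
      by (simp add: vec_eq_iff F_def lform_eval)
    show "\<exists>d F. (\<forall>j. homogeneous d (F j)) \<and>
        (\<forall>v\<in>rep_proj y - {0}. (\<chi> j. mpoly_eval (F j) v) \<noteq> 0) \<and>
        (\<forall>y\<in>UNIV. \<forall>v\<in>rep_proj y - {0}. (\<chi> j. mpoly_eval (F j) v) \<noteq> 0 \<longrightarrow>
          inv_into ?L (scroll_projection n \<phi>) y = pt (\<chi> j. mpoly_eval (F j) v))"
    proof (intro exI[of _ 1] exI[of _ F] conjI allI ballI impI)
      show "homogeneous 1 (F i)" for i unfolding F_def by (rule homogeneous_lform)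
    next
      fix z :: "'k ^ 2" assume "z \<in> rep_proj y - {0}"
      then show "(\<chi> l. mpoly_eval (F l) z) \<noteq> 0" unfolding F using e0[of z] by simp
    next
      fix y' :: "('k, 2) proj" and z assume z: "z \<in> rep_proj y' - {0}"
      then have "y' = pt z" using pt_of_rep_proj[of z y'] by simp
      then show "inv_into ?L (scroll_projection n \<phi>) y' = pt (\<chi> l. mpoly_eval (F l) z)"
        unfolding F using inv[of z] z by simp
    qed
  qed
  have w10: "w1 \<noteq> 0" using \<omega>(1)[of c0] \<omega>0 lfunD(4)[OF lin_\<alpha>[of c0]] by auto
  have w2c: "w2 \<noteq> c *s w1" for c
    using \<omega>(2,4)[of c0] \<omega>0 lfunD(2)[OF lin_\<beta>[of c0]] by auto
  have "?L \<subseteq> scroll n \<phi>"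
  proof (rule proj_subsetI)
    fix v :: "'k ^ 'n" assume v: "v \<noteq> 0" "pt v \<in> ?L"
    have "v \<in> ?M" using v(2) unfolding pt_in_projectivization[OF subspace_line v(1)] .
    then obtain z where z: "v = e z" using M by blast
    show "pt v \<in> scroll n \<phi>" unfolding scroll_pt_iff[OF v(1)] unfolding z using eV by (simp add: f)
  qed
  then show ?thesis
    unfolding line_section_def isomorphism_def by (intro conjI linear_space_line[OF w10 w2c] bij reg reg')
qed

end


section \<open>Existence of coordinates\<close>

text \<open>The functional dual to a basis vector of a complement of \<open>U\<close> vanishes on the span of \<open>U\<close>
  and of the other basis vectors.\<close>

lemma dual_coordinates:
  fixes f :: "'i \<Rightarrow> 'k::field ^ 'n::finite"
  assumes I: "finite I" and f: "inj_on f I" "vec.independent (f ` I)" and V: "V = vec.span (f ` I)"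
    and U: "vec.subspace U" and UV: "U \<inter> V = {0}"
  shows "\<exists>x. (\<forall>i\<in>I. lfun (x i) \<and> (\<forall>u\<in>U. x i u = 0) \<and> (\<forall>i'\<in>I. x i (f i') = (if i = i' then 1 else 0))) \<and>
    (\<forall>v\<in>V. v = (\<Sum>i\<in>I. x i v *s f i))"
proof -
  have "\<exists>l. lfun l \<and> (\<forall>u\<in>U. l u = 0) \<and> (\<forall>i'\<in>I. l (f i') = (if i = i' then 1 else 0))" if i: "i \<in> I" for i
  proof -
    define W where "W = vec.span (f ` (I - {i}))"
    define E where "E = {u + w | u w. u \<in> U \<and> w \<in> W}"
    have E: "vec.subspace E" unfolding E_def W_def by (rule vec.subspace_sums[OF U vec.subspace_span])
    have img: "f ` (I - {i}) = f ` I - {f i}" using f(1) i by (auto simp: inj_on_def)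
    have "f i \<notin> E"
    proof
      assume "f i \<in> E"
      then obtain u w where uw: "u \<in> U" "w \<in> W" "f i = u + w" unfolding E_def by blast
      have "W \<subseteq> V" unfolding W_def V by (rule vec.span_mono) auto
      then have wV: "w \<in> V" using uw(2) by blast
      have fV: "f i \<in> V" unfolding V by (rule vec.span_base) (use i in blast)
      have VV: "vec.subspace V" unfolding V by (rule vec.subspace_span)
      have "f i - w \<in> V" by (rule vec.subspace_diff[OF VV fV wV])
      then have "u \<in> V" by (simp add: uw(3))
      then have "u = 0" using UV uw(1) by blast
      then have "f i \<in> vec.span (f ` I - {f i})" using uw(2,3) unfolding W_def img by simp
      then have "vec.dependent (f ` I)" unfolding vec.dependent_def using i by blast
      then show False using f(2) by blast
    qed
    then obtain l where l: "lfun l" "\<And>y. y \<in> E \<Longrightarrow> l y = 0" "l (f i) = 1"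
      using lfun_vanishing_on[OF E] by metis
    have "l u = 0" if "u \<in> U" for u
    proof (rule l(2))
      have "u = u + 0" "0 \<in> W" by (simp_all add: W_def vec.span_zero)
      then show "u \<in> E" unfolding E_def using that by blast
    qed
    moreover have "l (f i') = 0" if "i' \<in> I" "i \<noteq> i'" for i'
    proof (rule l(2))
      have "f i' \<in> W" unfolding W_def using that by (intro vec.span_base) auto
      moreover have "f i' = 0 + f i'" by simp
      ultimately show "f i' \<in> E" unfolding E_def using vec.subspace_0[OF U] by blast
    qed
    ultimately show ?thesis using l(1,3) by (intro exI[of _ l]) auto
  qed
  then obtain x where x: "\<And>i. i \<in> I \<Longrightarrow> lfun (x i)" "\<And>i u. i \<in> I \<Longrightarrow> u \<in> U \<Longrightarrow> x i u = 0"
    "\<And>i i'. i \<in> I \<Longrightarrow> i' \<in> I \<Longrightarrow> x i (f i') = (if i = i' then 1 else 0)" by metis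
  have "v = (\<Sum>i\<in>I. x i v *s f i)" if "v \<in> V" for v
  proof -
    have sub: "vec.subspace {v. v = (\<Sum>i\<in>I. x i v *s f i)}"
    proof (rule vec.subspaceI)
      show "0 \<in> {v. v = (\<Sum>i\<in>I. x i v *s f i)}" by (simp add: lfunD(4)[OF x(1)])
      fix v w c assume v: "v \<in> {v. v = (\<Sum>i\<in>I. x i v *s f i)}"
      have "(\<Sum>i\<in>I. x i (c *s v) *s f i) = c *s (\<Sum>i\<in>I. x i v *s f i)"
        unfolding vec.scale_sum_right by (intro sum.cong refl) (simp add: lfunD(2)[OF x(1)])
      then show "c *s v \<in> {v. v = (\<Sum>i\<in>I. x i v *s f i)}" using v by simp
      assume w: "w \<in> {v. v = (\<Sum>i\<in>I. x i v *s f i)}"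
      have "(\<Sum>i\<in>I. x i (v + w) *s f i) = (\<Sum>i\<in>I. x i v *s f i) + (\<Sum>i\<in>I. x i w *s f i)"
        unfolding sum.distrib[symmetric]
        by (intro sum.cong refl) (simp add: lfunD(1)[OF x(1)] vec.scale_left_distrib)
      then show "v + w \<in> {v. v = (\<Sum>i\<in>I. x i v *s f i)}" using v w by simp
    qed
    have "f ` I \<subseteq> {v. v = (\<Sum>i\<in>I. x i v *s f i)}"
    proof safe
      fix i assume i: "i \<in> I"
      have "(\<Sum>i'\<in>I. x i' (f i) *s f i') = (\<Sum>i'\<in>I. if i' = i then f i' else 0)"
        by (intro sum.cong refl) (simp add: x(3) i)
      then show "f i = (\<Sum>i'\<in>I. x i' (f i) *s f i')" using I i by (simp add: sum.delta)
    qed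
    then have "V \<subseteq> {v. v = (\<Sum>i\<in>I. x i v *s f i)}" unfolding V using sub by (rule vec.span_minimal)
    then show ?thesis using that by blast
  qed
  then show ?thesis using x by (intro exI[of _ x]) auto
qed

text \<open>The spaces \<open>\<Lambda> i\<close> span a space of the largest possible dimension, so the union of their bases is
  a basis.\<close>

lemma scroll_coords_exist:
  fixes \<phi> :: "nat \<Rightarrow> ('k::alg_closed_field, 2) proj \<Rightarrow> ('k, 'n::finite) proj" and a :: "nat list"
  assumes smooth: "smooth_scroll_data (lin_span (scroll (length a) \<phi>)) a \<phi>"
    and U: "vec.subspace U"
    and compl: "complementary (projectivization U) (lin_span (scroll (length a) \<phi>))"
  shows "\<exists>b x. scroll_coords (length a) ((!) a) b x U (vec_span (scroll (length a) \<phi>)) \<phi>"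
proof -
  define n where "n = length a"
  define V where "V = vec_span (scroll n \<phi>)"
  have V: "vec.subspace V" by (simp add: V_def)
  have PV: "lin_span (scroll n \<phi>) = projectivization V" by (simp add: lin_span_def V_def)
  have n: "n \<ge> 1" and a1: "\<And>i. i < n \<Longrightarrow> a ! i \<ge> 1"
    and ls: "linear_space (int (sum_list a) + int n - 1) (projectivization V)"
    and "\<exists>\<Lambda>. (\<forall>i<n. linear_space (int (a ! i)) (\<Lambda> i) \<and>
             rational_normal_embedding (a ! i) (\<Lambda> i) (\<phi> i)) \<and>
          lin_span (\<Union>i<n. \<Lambda> i) = projectivization V"
    using smooth unfolding smooth_scroll_data_def n_def[symmetric] PV by simp_all
  then obtain \<Lambda> where \<Lambda>: "\<And>i. i < n \<Longrightarrow> rational_normal_embedding (a ! i) (\<Lambda> i) (\<phi> i)"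
    "lin_span (\<Union>i<n. \<Lambda> i) = projectivization V" by blast
  have "\<exists>b :: nat \<Rightarrow> 'k ^ 'n. \<Lambda> i = projectivization (vec.span (b ` {..a ! i})) \<and>
    (\<forall>v. v \<noteq> 0 \<longrightarrow> \<phi> i (pt v) = pt (\<Sum>j\<le>a ! i. (v $ 1 ^ (a ! i - j) * v $ 2 ^ j) *s b j))" if "i < n" for i
    using \<Lambda>(1)[OF that] unfolding rational_normal_embedding_def
    by (elim exE conjE) (intro exI conjI)
  then have "\<forall>i. \<exists>bi :: nat \<Rightarrow> 'k ^ 'n. i < n \<longrightarrow> \<Lambda> i = projectivization (vec.span (bi ` {..a ! i})) \<and>
    (\<forall>v. v \<noteq> 0 \<longrightarrow> \<phi> i (pt v) = pt (\<Sum>j\<le>a ! i. (v $ 1 ^ (a ! i - j) * v $ 2 ^ j) *s bi j))"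
    by simp
  from choice[OF this] obtain b :: "nat \<Rightarrow> nat \<Rightarrow> 'k ^ 'n" where b':
    "\<forall>i. i < n \<longrightarrow> \<Lambda> i = projectivization (vec.span (b i ` {..a ! i})) \<and>
    (\<forall>v. v \<noteq> 0 \<longrightarrow> \<phi> i (pt v) = pt (\<Sum>j\<le>a ! i. (v $ 1 ^ (a ! i - j) * v $ 2 ^ j) *s b i j))"
    by (rule exE)
  have b: "\<Lambda> i = projectivization (vec.span (b i ` {..a ! i}))" if "i < n" for i
    using b' that by simp
  have \<phi>: "\<phi> i (pt v) = pt (\<Sum>j\<le>a ! i. (v $ 1 ^ (a ! i - j) * v $ 2 ^ j) *s b i j)"
    if "i < n" "v \<noteq> 0" for i v
    using b' that by simp
  define I where "I = Sigma {..<n} (\<lambda>i. {..a ! i})"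
  define f where "f c = b (fst c) (snd c)" for c
  have I: "finite I" by (simp add: I_def)
  have II: "(i, j) \<in> I" if "i < n" "j \<le> a ! i" for i j using that by (simp add: I_def)
  have bI: "b i j \<in> f ` I" if "i < n" "j \<le> a ! i" for i j
    using imageI[OF II[OF that], of f] by (simp add: f_def)
  have cardI: "card I = sum_list a + n"
    by (simp add: I_def n_def sum_list_sum_nth atLeast0LessThan sum_Suc)
  have "vec.dim V = sum_list a + n"
  proof -
    obtain W where W: "vec.subspace W" "int (vec.dim W) = int (sum_list a) + int n - 1 + 1"
      "projectivization V = projectivization W" using ls unfolding linear_space_def by blast
    have "V = W" using W(1,3) V projectivization_eq_iff by blast
    then show ?thesis using W(2) by simp
  qed
  have span: "V = vec.span (f ` I)"
  proof
    have vV: "vec_span (\<Union>i<n. \<Lambda> i) = V"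
      using \<Lambda>(2) unfolding lin_span_def by (simp add: projectivization_eq_iff V)
    have sub: "vec.span (b i ` {..a ! i}) \<subseteq> vec.span (f ` I)" if "i < n" for i
      by (rule vec.span_mono, rule image_subsetI, rule bI[OF that]) simp
    show "V \<subseteq> vec.span (f ` I)"
      unfolding vV[symmetric]
    proof (rule vec_span_least[OF vec.subspace_span])
      fix v :: "'k ^ 'n" assume v: "v \<noteq> 0" "pt v \<in> (\<Union>i<n. \<Lambda> i)"
      then obtain i where i: "i < n" "pt v \<in> \<Lambda> i" by blast
      have "v \<in> vec.span (b i ` {..a ! i})"
        using i(2) unfolding b[OF i(1)] pt_in_projectivization[OF vec.subspace_span v(1)] .
      then show "v \<in> vec.span (f ` I)" using sub[OF i(1)] by blast
    qed
    show "vec.span (f ` I) \<subseteq> V"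
    proof (rule vec.span_minimal[OF _ V], safe)
      fix i j assume "(i, j) \<in> I"
      then have ij: "i < n" "j \<le> a ! i" by (auto simp: I_def)
      have "vec.span (b i ` {..a ! i}) \<subseteq> vec_span (\<Union>i<n. \<Lambda> i)"
        by (rule subspace_le_vec_span[OF vec.subspace_span], unfold b[OF ij(1), symmetric])
          (rule UN_upper, simp add: ij(1))
      moreover have "b i j \<in> vec.span (b i ` {..a ! i})" using ij(2) by (intro vec.span_base) auto
      ultimately show "f (i, j) \<in> V" unfolding vV f_def by auto
    qed
  qed
  have cardle: "card (f ` I) \<le> vec.dim V"
    unfolding \<open>vec.dim V = _\<close> cardI[symmetric] by (rule card_image_le[OF I])
  have ind: "vec.independent (f ` I)"
    by (rule vec.card_le_dim_spanning[of _ V]) (use span I cardle in \<open>auto simp: vec.span_superset\<close>)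
  have "card (f ` I) = vec.dim V" unfolding span vec.dim_span using ind by (simp add: vec.dim_eq_card_independent)
  then have inj: "inj_on f I" using I by (intro eq_card_imp_inj_on) (simp_all add: cardI \<open>vec.dim V = _\<close>)
  have UV: "U \<inter> V = {0}"
  proof -
    have "v = 0" if "v \<in> U" "v \<in> V" for v
    proof (rule ccontr)
      assume "v \<noteq> 0"
      then have "pt v \<in> projectivization U \<inter> projectivization V"
        using that by (simp add: pt_in_projectivization U V)
      then show False using compl unfolding complementary_def n_def[symmetric] PV by blast
    qed
    then show ?thesis using vec.subspace_0[OF U] vec.subspace_0[OF V] by blast
  qed
  have UV_sum: "\<exists>u\<in>U. \<exists>w\<in>V. v = u + w" for v
  proof -
    have sum: "vec.subspace {u + w | u w. u \<in> U \<and> w \<in> V}" by (rule vec.subspace_sums[OF U V])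
    have "vec_span (projectivization U \<union> projectivization V) \<subseteq> {u + w | u w. u \<in> U \<and> w \<in> V}"
    proof (rule vec_span_least[OF sum])
      fix v :: "'k ^ 'n" assume "v \<noteq> 0" "pt v \<in> projectivization U \<union> projectivization V"
      then have "v \<in> U \<or> v \<in> V" by (simp add: pt_in_projectivization U V)
      moreover have "v = v + 0" "v = 0 + v" by simp_all
      ultimately show "v \<in> {u + w | u w. u \<in> U \<and> w \<in> V}"
        using vec.subspace_0[OF U] vec.subspace_0[OF V] by blast
    qed
    moreover have "v \<in> vec_span (projectivization U \<union> projectivization V)"
    proof (cases "v = 0")
      case True then show ?thesis by (simp add: vec.subspace_0)
    next
      case False
      have "lin_span (projectivization U \<union> projectivization V) = UNIV"
        using compl unfolding complementary_def n_def[symmetric] PV by blast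
      then have "pt v \<in> projectivization (vec_span (projectivization U \<union> projectivization V))"
        unfolding lin_span_def by simp
      then show ?thesis using False by (simp add: pt_in_projectivization)
    qed
    ultimately show ?thesis by blast
  qed
  obtain x where x: "\<forall>i\<in>I. lfun (x i) \<and> (\<forall>u\<in>U. x i u = 0) \<and> (\<forall>i'\<in>I. x i (f i') = (if i = i' then 1 else 0))"
    "\<forall>v\<in>V. v = (\<Sum>i\<in>I. x i v *s f i)"
    using dual_coordinates[OF I inj ind span U UV] by blast
  have "scroll_coords n ((!) a) b (\<lambda>i j. x (i, j)) U V \<phi>"
  proof (rule scroll_coords.intro)
    show "x (i, j) (b i' j') = (if i = i' \<and> j = j' then 1 else 0)"
      if "i < n" "j \<le> a ! i" "i' < n" "j' \<le> a ! i'" for i j i' j'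
    proof -
      have "x (i, j) (f (i', j')) = (if (i, j) = (i', j') then 1 else 0)" using x(1) II that by blast
      then show ?thesis by (simp add: f_def)
    qed
    show "b i j \<in> V" if "i < n" "j \<le> a ! i" for i j
      unfolding span by (rule vec.span_base) (rule bI[OF that])
    show "v = (\<Sum>i<n. \<Sum>j\<le>a ! i. x (i, j) v *s b i j)" if "v \<in> V" for v
    proof -
      have "(\<Sum>i<n. \<Sum>j\<le>a ! i. x (i, j) v *s b i j) = (\<Sum>c\<in>I. x c v *s f c)"
        unfolding I_def by (subst sum.Sigma) (auto simp: f_def case_prod_unfold)
      then show ?thesis using x(2) that by simp
    qed
    show "n \<ge> 1" by (rule n)
    show "a ! i \<ge> 1" if "i < n" for i by (rule a1[OF that])
    show "lfun (x (i, j))" if "i < n" "j \<le> a ! i" for i j using x(1) II[OF that] by blast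
    show "x (i, j) u = 0" if "i < n" "j \<le> a ! i" "u \<in> U" for i j u
      using x(1) II[OF that(1,2)] that(3) by blast
    show "vec.subspace U" "vec.subspace V" "U \<inter> V = {0}" by (rule U V UV)+
    show "\<exists>u\<in>U. \<exists>w\<in>V. v = u + w" for v by (rule UV_sum)
    show "\<phi> i (pt z) = pt (\<Sum>j\<le>a ! i. (z $ 1 ^ (a ! i - j) * z $ 2 ^ j) *s b i j)"
      if "i < n" "z \<noteq> 0" for i z by (rule \<phi>[OF that])
    show "V = vec_span (scroll n \<phi>)" by (rule V_def)
  qed
  then show ?thesis unfolding n_def V_def by blast
qed


section \<open>The secant cone and the secant locus\<close>

theorem theorem3p4:
  fixes r :: nat and h :: int and a :: "nat list"
    and \<phi> :: "nat \<Rightarrow> ('k::alg_closed_field, 2) proj \<Rightarrow> ('k, 'n::finite) proj"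
    and Vert X0 X :: "('k, 'n) proj set" and p :: "('k, 'n) proj"
  assumes ambient: "CARD('n) = r + 2"
    and h: "h \<ge> -1"
    and Vert: "linear_space h Vert"
    and X0: "X0 = scroll (length a) \<phi>"
    and smooth: "smooth_scroll_data (lin_span X0) a \<phi>"
    and span_X0: "linear_space (int r - h) (lin_span X0)"
    and compl: "complementary Vert (lin_span X0)"
    and X: "X = embedded_join Vert X0"
    and codim: "zdim X + 2 \<le> enat (r + 1)"
    and p: "p \<notin> X"
  shows
    "\<comment> \<open>(a)\<close>
     (secant_cone p X = lin_span (Vert \<union> {p}) \<and> linear_space (h + 1) (secant_cone p X) \<and>
      secant_locus p X = double_hyperplane (lin_span (Vert \<union> {p})) Vert)
   \<or> \<comment> \<open>(b)\<close>
     (\<exists>L. linear_space 1 L \<and> L \<subseteq> lin_span X0 \<and>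
        secant_cone p X = lin_span (Vert \<union> L) \<and> linear_space (h + 2) (secant_cone p X) \<and>
        ((\<exists>z z'. z \<noteq> z' \<and> {z, z'} \<subseteq> L \<and>
            secant_locus p X = vanishing_ideal (embedded_join Vert {z, z'})) \<or>
         (\<exists>z. {z} \<subseteq> L \<and>
            secant_locus p X = double_hyperplane (lin_span (Vert \<union> L)) (lin_span (Vert \<union> {z})))))
   \<or> \<comment> \<open>(c)\<close>
     (\<exists>P W. linear_space 2 P \<and> P \<subseteq> lin_span X0 \<and>
        secant_cone p X = lin_span (Vert \<union> P) \<and> linear_space (h + 3) (secant_cone p X) \<and>
        W \<subseteq> P \<and> secant_locus p X = vanishing_ideal (embedded_join Vert W) \<and>
        (smooth_quadric P W \<or>
         (\<exists>L L'. linear_space 1 L \<and> linear_space 1 L' \<and> L \<noteq> L' \<and> L \<subseteq> P \<and> L' \<subseteq> P \<and>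
            W = L \<union> L' \<and> (\<exists>x. L \<subseteq> ruling (length a) \<phi> x \<inter> X0) \<and>
            line_section (length a) \<phi> L')))
   \<or> \<comment> \<open>(d)\<close>
     (\<exists>D V. linear_space 3 D \<and> D \<subseteq> lin_span X0 \<and>
        secant_cone p X = lin_span (Vert \<union> D) \<and> linear_space (h + 4) (secant_cone p X) \<and>
        V \<subseteq> D \<and> smooth_quadric D V \<and>
        secant_locus p X = vanishing_ideal (embedded_join Vert V))"
    (is "?a \<or> ?b \<or> ?c \<or> ?d")
proof -
  obtain U where U: "vec.subspace U" "int (vec.dim U) = h + 1" "Vert = projectivization U"
    using Vert unfolding linear_space_def by blast
  define V where "V = vec_span X0"
  have spanX0: "lin_span X0 = projectivization V" by (simp add: lin_span_def V_def)
  have "complementary (projectivization U) (lin_span (scroll (length a) \<phi>))"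
    using compl unfolding U(3) X0 .
  then obtain b x where "scroll_coords (length a) ((!) a) b x U V \<phi>"
    using scroll_coords_exist[OF smooth[unfolded X0] U(1)] unfolding V_def X0 by blast
  then interpret sc: scroll_coords "length a" "(!) a" b x U V \<phi> .
  have XX: "X = sc.X" unfolding X sc.X_def X0 U(3) ..
  obtain v where v: "v \<noteq> 0" "p = pt v" by (rule proj_cases[of p])
  have "\<not> sc.rank_le_1 v" using p sc.X_iff[OF v(1)] unfolding v(2) XX by blast
  then obtain j k where jk: "sc.\<alpha> j v * sc.\<beta> k v \<noteq> sc.\<alpha> k v * sc.\<beta> j v" by blast
  interpret pc: pencil sc.\<alpha> sc.\<beta> U V sc.X by (rule sc.pencil)
  interpret pp: pencil_point sc.\<alpha> sc.\<beta> U V sc.X v j k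
    by unfold_locales (use jk in \<open>simp add: pc.minor_def\<close>)
  let ?S = "projectivization pp.S" and ?T = "projectivization pp.S0"
  let ?W = "X \<inter> ?T"
  have cone: "secant_cone p X = ?S" unfolding v(2) XX by (rule pp.secant_cone_eq)
  have span: "lin_span (Vert \<union> ?T) = ?S" unfolding U(3) by (rule pp.lin_span_S)
  have lsS: "linear_space (h + int (vec.dim pp.S0)) ?S"
    using pp.linear_space_S U(2) by simp
  have lsS0: "linear_space (int (vec.dim pp.S0) - 1) ?T" by (rule pp.linear_space_S0)
  have sub: "?T \<subseteq> lin_span X0"
    unfolding spanX0 by (rule projectivization_mono_iff[OF pp.subspace_S0 sc.V, THEN iffD2])
      (simp add: pp.S0_def)
  have join: "embedded_join Vert ?W = X \<inter> ?S" if "?W \<noteq> {}"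
    unfolding U(3) XX by (rule pp.join_S) (use that XX in simp)
  have "vec.dim pp.S0 \<in> {1, 2, 3, 4}" using pp.dim_S0_pos pp.dim_S0_le by auto
  then consider "vec.dim pp.S0 = 1" | "vec.dim pp.S0 = 2" | "vec.dim pp.S0 = 3" | "vec.dim pp.S0 = 4"
    by blast
  then show ?thesis
  proof cases
    case 1
    have "lin_span (Vert \<union> {p}) = ?S" unfolding U(3) v(2) by (rule pp.classification_1(1)[OF 1])
    moreover have "secant_locus p X = double_hyperplane ?S Vert"
      unfolding U(3) v(2) XX by (rule pp.classification_1(2)[OF 1])
    ultimately have ?a using cone lsS 1 by simp
    then show ?thesis by (rule disjI1)
  next
    case 2
    have ls: "linear_space 1 ?T" "linear_space (h + 2) ?S" using lsS0 lsS 2 by simp_all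
    have "(\<exists>z z'. z \<noteq> z' \<and> {z, z'} \<subseteq> ?T \<and>
            secant_locus p X = vanishing_ideal (embedded_join Vert {z, z'})) \<or>
         (\<exists>z. {z} \<subseteq> ?T \<and>
            secant_locus p X = double_hyperplane (lin_span (Vert \<union> ?T)) (lin_span (Vert \<union> {z})))"
      using pp.classification_2[OF 2]
    proof
      assume "\<exists>z z'. z \<noteq> z' \<and> sc.X \<inter> ?T = {z, z'} \<and>
        secant_locus (pt v) sc.X = vanishing_ideal (sc.X \<inter> ?S)"
      then obtain z z' where z: "z \<noteq> z'" "sc.X \<inter> ?T = {z, z'}"
        "secant_locus (pt v) sc.X = vanishing_ideal (sc.X \<inter> ?S)" by (elim exE conjE)
      have W: "?W = {z, z'}" unfolding XX by (rule z(2))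
      then have "secant_locus p X = vanishing_ideal (embedded_join Vert {z, z'})"
        using join z(3) unfolding XX v(2) by simp
      moreover have "{z, z'} \<subseteq> ?T" using W by blast
      ultimately show ?thesis using z(1) by (intro disjI1 exI[of _ z] exI[of _ z'] conjI)
    next
      assume "\<exists>z\<in>?T. secant_locus (pt v) sc.X =
        double_hyperplane ?S (lin_span (projectivization U \<union> {z}))"
      then obtain z where z: "z \<in> ?T" "secant_locus (pt v) sc.X =
        double_hyperplane ?S (lin_span (projectivization U \<union> {z}))" by (rule bexE)
      show ?thesis
        by (intro disjI2 exI[of _ z] conjI) (simp_all only: span, simp_all add: z XX v(2) U(3))
    qed
    then have ?b by (intro exI[of _ ?T] conjI ls(1) sub) (simp_all add: cone span ls(2))
    then show ?thesis by blast
  next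
    case 3
    have ls: "linear_space 2 ?T" "linear_space (h + 3) ?S" using lsS0 lsS 3 by simp_all
    have W: "?W \<noteq> {}" unfolding XX by (rule pp.classification_3(1)[OF 3])
    have loc: "secant_locus p X = vanishing_ideal (embedded_join Vert ?W)"
      unfolding join[OF W] unfolding XX v(2) by (rule pp.classification_3(2)[OF 3])
    have "smooth_quadric ?T ?W \<or>
         (\<exists>L L'. linear_space 1 L \<and> linear_space 1 L' \<and> L \<noteq> L' \<and> L \<subseteq> ?T \<and> L' \<subseteq> ?T \<and>
            ?W = L \<union> L' \<and> (\<exists>x. L \<subseteq> ruling (length a) \<phi> x \<inter> X0) \<and>
            line_section (length a) \<phi> L')"
      using pp.classification_3(3)[OF 3]
    proof
      assume "smooth_quadric ?T (sc.X \<inter> ?T)"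
      then show ?thesis unfolding XX by blast
    next
      assume pp.crossing_lines
      then show ?thesis
        unfolding pp.crossing_lines_def
      proof (elim exE conjE)
        fix v1 v2 w1 w2 s t \<omega> c0
        assume q: "{v1, v2, w1, w2} \<subseteq> pp.S0" "v1 \<noteq> 0" "w1 \<noteq> 0"
          "sc.X \<inter> ?T = projectivization {a *s v1 + b *s v2 | a b. True} \<union>
            projectivization {a *s w1 + b *s w2 | a b. True}"
          "{a *s v1 + b *s v2 | a b. True} \<noteq> {a *s w1 + b *s w2 | a b. True}"
          "(s, t) \<noteq> (0, 0)" and c0: "\<omega> c0 \<noteq> 0"
          and ind: "\<forall>c. v2 \<noteq> c *s v1" "\<forall>c. w2 \<noteq> c *s w1"
          and r: "\<forall>c. t * sc.\<alpha> c v1 = s * sc.\<beta> c v1 \<and> t * sc.\<alpha> c v2 = s * sc.\<beta> c v2"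
          and \<omega>: "\<forall>c. sc.\<alpha> c w1 = \<omega> c \<and> sc.\<beta> c w1 = 0 \<and> sc.\<alpha> c w2 = 0 \<and> sc.\<beta> c w2 = \<omega> c"
        let ?L = "projectivization {a *s v1 + b *s v2 | a b. True}"
        let ?L' = "projectivization {a *s w1 + b *s w2 | a b. True}"
        have inV: "v1 \<in> V" "v2 \<in> V" "w1 \<in> V" "w2 \<in> V" using q(1) unfolding pp.S0_def by blast+
        have WL: "?W = ?L \<union> ?L'" unfolding XX by (rule q(4))
        have "linear_space 1 ?L" "linear_space 1 ?L'" 
          by (rule linear_space_line[OF q(2) ind(1)[rule_format]], rule linear_space_line[OF q(3) ind(2)[rule_format]])
        moreover have "?L \<noteq> ?L'" using q(5) unfolding projectivization_eq_iff[OF subspace_line subspace_line] .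
        moreover have "?L \<subseteq> ?T" "?L' \<subseteq> ?T" using WL by blast+
        moreover have "\<exists>x. ?L \<subseteq> ruling (length a) \<phi> x \<inter> X0"
          unfolding X0 by (rule sc.line_in_ruling[OF inV(1,2) q(6)]) (use r in blast)+
        moreover have "line_section (length a) \<phi> ?L'"
          by (rule sc.line_section_of_row[of w1 w2 \<omega> c0, OF inV(3,4) c0]) (use \<omega> in blast)+
        ultimately show ?thesis using WL by (intro disjI2 exI[of _ ?L] exI[of _ ?L'] conjI)
      qed
    qed
    then have ?c
      by (intro exI[of _ ?T] exI[of _ ?W] conjI ls(1) sub loc) (simp_all add: cone span ls(2))
    then show ?thesis by blast
  next
    case 4
    have ls: "linear_space 3 ?T" "linear_space (h + 4) ?S" using lsS0 lsS 4 by simp_all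
    have W: "?W \<noteq> {}" unfolding XX by (rule pp.classification_4(1)[OF 4])
    have loc: "secant_locus p X = vanishing_ideal (embedded_join Vert ?W)"
      unfolding join[OF W] unfolding XX v(2) by (rule pp.classification_4(3)[OF 4])
    have sq: "smooth_quadric ?T ?W" unfolding XX by (rule pp.classification_4(2)[OF 4])
    have ?d
      by (intro exI[of _ ?T] exI[of _ ?W] conjI ls(1) sub loc sq) (simp_all add: cone span ls(2))
    then show ?thesis by blast
  qed
qed

end
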